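(* Let $W^{\alpha\beta}$ be a smooth real antisymmetric tensor field on Minkowski space, let $\zeta$ be a real constant, and let $\theta_\alpha=H_\alpha:=-iW^{\rho\sigma}(\sin\zeta+i\cos\zeta\,\mathcal J)\Theta_{\alpha\rho\sigma}$. Then $$\begin{aligned}L_V=\;&1024\cos^2 2\zeta\,\bigl[W^{\alpha\beta}W_{\beta\rho}W^{\rho\sigma}W_{\sigma\alpha}-(W^{\alpha\beta}W_{\alpha\beta})^2\bigr]\\&+64\cos2\zeta\,\bigl[(\partial_\alpha W^{\rho\sigma})(\partial^\alpha W_{\rho\sigma})+2(\partial_\beta W^{\alpha\beta})(\partial^\sigma W_{\alpha\sigma})\bigr].\end{aligned}$$ If $\tau\ne0$ is a real constant and $\cos2\zeta\neq0$, then the field equation obtained by varying $L=L_K-\tau L_V$ with respect to the antisymmetric field $W^{\alpha\beta}$ is $$\begin{aligned}&\partial_\mu\partial^\mu W_{\alpha\beta}-\partial_\alpha\partial^\sigma W_{\beta\sigma}+\partial_\beta\partial^\sigma W_{\alpha\sigma}+16\cos2\zeta\,\bigl[W_{\alpha\rho}W^{\rho\sigma}W_{\sigma\beta}+(W^{\rho\sigma}W_{\rho\sigma})W_{\alpha\beta}\bigr]\\&\qquad=\frac{i}{128\,\tau\cos2\zeta}\,\psi^\dagger\hat\eta\gamma^\nu(\sin\zeta+i\cos\zeta\,\mathcal J)\Theta_{\nu\alpha\beta}\psi .\end{aligned}$$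
   Context: Minkowski space is $\mathbb R^4$ with coordinates $x^\alpha$ and constant metric $\eta=\mathrm{diag}(1,-1,-1,-1)$; indices are raised and lowered with $\eta$, and repeated indices are summed (over all values). The complex exterior algebra $\bigwedge_*$ of $\mathbb R^4$ has basis $\mathbf e_I=\mathbf e_{\alpha_1}\wedge\cdots\wedge\mathbf e_{\alpha_k}$, $\alpha_1<\dots<\alpha_k$, $|I|=k$ ($\mathbf e_\emptyset=1$), and $\mathbf e_I$ is defined by the same formula for any multi-index; $16\times16$ matrices are operators on it in this basis and $\dagger$ is conjugate transpose. Gamma matrices: $\gamma_\alpha\psi=\mathbf e_\alpha\wedge\psi-\iota_\alpha\psi$, where $\iota_\alpha$ is the linear operator with $\iota_\alpha\mathbf e_\emptyset=0$, $\iota_\alpha\mathbf e_\beta=\eta_{\alpha\beta}\mathbf e_\emptyset$, $\iota_\alpha(\mathbf e_I\wedge\mathbf e_J)=(\iota_\alpha\mathbf e_I)\wedge\mathbf e_J+(-1)^{|I|}\mathbf e_I\wedge\iota_\alpha\mathbf e_J$. Extended metric: $\hat\eta_{IJ}=0$ if $|I|\ne|J|$, and $\hat\eta_{IJ}=\det(\eta_{\alpha_i\beta_j})$ if $I=\alpha_1\cdots\alpha_k$, $J=\beta_1\cdots\beta_k$. $\Theta_I$ is the $16\times16$ matrix that commutes with all gamma matrices and satisfies $\Theta_I\mathbf e_\emptyset=\mathbf e_I$ (so $\Theta_{\alpha\rho\sigma}$ is totally antisymmetric in its indices); $\mathcal J=\Theta_{0123}$ (scalars stand for multiples of the identity). Given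 four matrix-valued fields $\theta_\alpha$, put $\Omega_{\alpha\beta}=\partial_\alpha\theta_\beta-\partial_\beta\theta_\alpha+\theta_\alpha\theta_\beta-\theta_\beta\theta_\alpha$ and $$L_V=\tfrac12\,\mathrm{tr}(\Omega_{\alpha\beta}\Omega^{\alpha\beta})+c.c.$$ For a smooth field $\psi:\mathbb R^4\to\bigwedge_*\cong\mathbb C^{16}$ and a real constant $m$, put $D\psi=\gamma^\alpha(\partial_\alpha\psi+\theta_\alpha\psi)$ and $$L_K=\tfrac12\psi^\dagger\hat\eta D\psi+c.c.-m\,\psi^\dagger\hat\eta\psi ,$$ where $c.c.$ is the complex conjugate of the preceding term. "The field equation obtained by varying $L$" means the Euler–Lagrange equation: stationarity of $\int L\,d^4x$ under compactly supported antisymmetric variations of $W^{\alpha\beta}$, with $\psi$ fixed.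
   Formalization: The cubic term's coefficient 16 cos 2ζ in the field equation is corrected to 32 cos 2ζ: varying the stated L_V gives 4·1024cos²2ζ/(128 cos 2ζ). With 16 it fails, e.g. for ψ=0, W^{12}=f(x^0), where stationarity means f''+32 cos 2ζ f³=0. *)

theory Defs
  imports "HOL-Analysis.Analysis"
begin

section \<open>Minkowski space and smooth fields\<close>

text \<open>The indices are the elements \<open>0, 1, 2, 3\<close> of the four-element type \<open>4\<close>, in this order.\<close>

type_synonym idx = "4"
type_synonym spacetime = "real ^ idx"

text \<open>The matrix \<open>\<eta>\<close> is its own inverse, so the same function serves for \<open>\<eta>\<close> with upper indices.\<close>

definition \<eta> :: "idx \<Rightarrow> idx \<Rightarrow> real" where
  "\<eta> \<alpha> \<beta> = (if \<alpha> = \<beta> then (if \<alpha> = 0 then 1 else - 1) else 0)"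

definition pd :: "idx \<Rightarrow> (spacetime \<Rightarrow> 'b::real_normed_vector) \<Rightarrow> spacetime \<Rightarrow> 'b" where
  "pd \<alpha> f x = vector_derivative (\<lambda>t. f (x + t *\<^sub>R axis \<alpha> 1)) (at 0)"

definition pd_up :: "idx \<Rightarrow> (spacetime \<Rightarrow> 'b::real_normed_vector) \<Rightarrow> spacetime \<Rightarrow> 'b" where
  "pd_up \<alpha> f x = (\<Sum>\<beta>\<in>UNIV. \<eta> \<alpha> \<beta> *\<^sub>R pd \<beta> f x)"

text \<open>Smoothness: all iterated partial derivatives are differentiable everywhere
  (hence all of them exist and are continuous).\<close>

definition smooth :: "(spacetime \<Rightarrow> 'b::real_normed_vector) \<Rightarrow> bool" where
  "smooth f \<longleftrightarrow> (\<forall>\<alpha>s x. foldr pd \<alpha>s f differentiable (at x))"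

text \<open>A field with two indices, \<open>T \<alpha> \<beta> x\<close>. For the field \<open>W\<close> these are upper indices, and
  \<open>lower W\<close> is the field with both indices lowered.\<close>

type_synonym 'b tensor2 = "idx \<Rightarrow> idx \<Rightarrow> spacetime \<Rightarrow> 'b"

definition lower :: "real tensor2 \<Rightarrow> real tensor2" where
  "lower T \<alpha> \<beta> x = (\<Sum>\<mu>\<in>UNIV. \<Sum>\<nu>\<in>UNIV. \<eta> \<alpha> \<mu> * \<eta> \<beta> \<nu> * T \<mu> \<nu> x)"

definition smooth_antisymmetric :: "real tensor2 \<Rightarrow> bool" where
  "smooth_antisymmetric T \<longleftrightarrow>
     (\<forall>\<alpha> \<beta>. smooth (T \<alpha> \<beta>)) \<and> (\<forall>\<alpha> \<beta> x. T \<beta> \<alpha> x = - T \<alpha> \<beta> x)"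


section \<open>The exterior algebra\<close>

text \<open>The increasing multi-indices are identified with the subsets of the index type, so the
  component of \<open>\<psi>\<close> along \<open>\<ee> I\<close> is \<open>\<psi> $ I\<close>; arbitrary multi-indices are lists.\<close>

type_synonym form = "complex ^ idx set"
type_synonym operator = "complex ^ idx set ^ idx set"

text \<open>The sign of the permutation sorting the concatenation of the increasing multi-indices
  \<open>I\<close> and \<open>J\<close>.\<close>

definition wsign :: "idx set \<Rightarrow> idx set \<Rightarrow> complex" where
  "wsign I J = (- 1) ^ card {(i, j). i \<in> I \<and> j \<in> J \<and> j < i}"

definition wedge :: "form \<Rightarrow> form \<Rightarrow> form"  (infixr \<open>\<and>\<^sub>e\<close> 71) where
  "u \<and>\<^sub>e v = (\<chi> K. \<Sum>I\<in>Pow K. wsign I (K - I) * (u $ I) * (v $ (K - I)))"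

definition \<ee> :: "idx list \<Rightarrow> form" where
  "\<ee> I = foldr (\<lambda>\<alpha> u. axis {\<alpha>} 1 \<and>\<^sub>e u) I (axis {} 1)"

definition \<iota> :: "idx \<Rightarrow> operator" where
  "\<iota> \<alpha> = (THE M. M *v \<ee> [] = 0 \<and> (\<forall>\<beta>. M *v \<ee> [\<beta>] = of_real (\<eta> \<alpha> \<beta>) *s \<ee> []) \<and>
     (\<forall>I J. M *v (\<ee> I \<and>\<^sub>e \<ee> J) =
        (M *v \<ee> I) \<and>\<^sub>e \<ee> J + (- 1) ^ length I *s (\<ee> I \<and>\<^sub>e (M *v \<ee> J))))"

definition \<gamma> :: "idx \<Rightarrow> operator" where
  "\<gamma> \<alpha> = matrix (\<lambda>\<psi>. \<ee> [\<alpha>] \<and>\<^sub>e \<psi> - \<iota> \<alpha> *v \<psi>)"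

definition \<gamma>_up :: "idx \<Rightarrow> operator" where
  "\<gamma>_up \<alpha> = (\<Sum>\<beta>\<in>UNIV. \<eta> \<alpha> \<beta> *\<^sub>R \<gamma> \<beta>)"

definition \<Theta> :: "idx list \<Rightarrow> operator" where
  "\<Theta> I = (THE M. (\<forall>\<alpha>. M ** \<gamma> \<alpha> = \<gamma> \<alpha> ** M) \<and> M *v \<ee> [] = \<ee> I)"

definition \<J> :: operator where
  "\<J> = \<Theta> [0, 1, 2, 3]"

text \<open>The determinant below has a size depending on the multi-indices, so it is written out by
  the Leibniz formula, as in the library's definition of \<open>det\<close>.\<close>

definition ext_metric :: "idx list \<Rightarrow> idx list \<Rightarrow> real" where
  "ext_metric I J = (if length I \<noteq> length J then 0
     else \<Sum>p | p permutes {..<length I}.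
            of_int (sign p) * (\<Prod>i<length I. \<eta> (I ! i) (J ! p i)))"

definition \<eta>_hat :: operator where
  "\<eta>_hat = (\<chi> I J. of_real (ext_metric (sorted_list_of_set I) (sorted_list_of_set J)))"

text \<open>The scalar \<open>\<phi>\<^sup>\<dagger> \<psi>\<close>.\<close>

definition dag :: "form \<Rightarrow> form \<Rightarrow> complex" where
  "dag \<phi> \<psi> = (\<Sum>I\<in>UNIV. cnj (\<phi> $ I) * \<psi> $ I)"


section \<open>Lagrangians and stationarity\<close>

type_synonym potential = "idx \<Rightarrow> spacetime \<Rightarrow> operator"

definition curvature :: "potential \<Rightarrow> operator tensor2" where
  "curvature \<theta> \<alpha> \<beta> x = pd \<alpha> (\<theta> \<beta>) x - pd \<beta> (\<theta> \<alpha>) x + \<theta> \<alpha> x ** \<theta> \<beta> x - \<theta> \<beta> x ** \<theta> \<alpha> x"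

definition plus_cc :: "complex \<Rightarrow> complex" where
  "plus_cc z = z + cnj z"

definition L\<^sub>V :: "potential \<Rightarrow> spacetime \<Rightarrow> complex" where
  "L\<^sub>V \<theta> x = plus_cc (1 / 2 * trace (\<Sum>\<alpha>\<in>UNIV. \<Sum>\<beta>\<in>UNIV. \<Sum>\<mu>\<in>UNIV. \<Sum>\<nu>\<in>UNIV.
      (\<eta> \<alpha> \<mu> * \<eta> \<beta> \<nu>) *\<^sub>R (curvature \<theta> \<alpha> \<beta> x ** curvature \<theta> \<mu> \<nu> x)))"

definition dirac :: "potential \<Rightarrow> (spacetime \<Rightarrow> form) \<Rightarrow> spacetime \<Rightarrow> form" where
  "dirac \<theta> \<psi> x = (\<Sum>\<alpha>\<in>UNIV. \<gamma>_up \<alpha> *v (pd \<alpha> \<psi> x + \<theta> \<alpha> x *v \<psi> x))"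

definition L\<^sub>K :: "real \<Rightarrow> (spacetime \<Rightarrow> form) \<Rightarrow> potential \<Rightarrow> spacetime \<Rightarrow> complex" where
  "L\<^sub>K m \<psi> \<theta> x = plus_cc (1 / 2 * dag (\<psi> x) (\<eta>_hat *v dirac \<theta> \<psi> x))
     - of_real m * dag (\<psi> x) (\<eta>_hat *v \<psi> x)"

text \<open>The factor \<open>sin \<zeta> + i cos \<zeta> \<J>\<close>; \<open>mat c\<close> is the scalar matrix with diagonal entry \<open>c\<close>.\<close>

definition \<S> :: "real \<Rightarrow> operator" where
  "\<S> \<zeta> = mat (of_real (sin \<zeta>)) + mat (\<i> * of_real (cos \<zeta>)) ** \<J>"

definition H :: "real \<Rightarrow> real tensor2 \<Rightarrow> potential" where
  "H \<zeta> W \<alpha> x = (\<Sum>\<rho>\<in>UNIV. \<Sum>\<sigma>\<in>UNIV.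
      mat (- \<i> * of_real (W \<rho> \<sigma> x)) ** \<S> \<zeta> ** \<Theta> [\<alpha>, \<rho>, \<sigma>])"

text \<open>Stationarity of the action at \<open>W\<close>: the integral is taken over an arbitrary compact region
  containing the support of the variation, since \<open>L\<close> itself need not be integrable over the
  whole space.\<close>

definition stationary :: "(real tensor2 \<Rightarrow> spacetime \<Rightarrow> complex) \<Rightarrow> real tensor2 \<Rightarrow> bool" where
  "stationary L W \<longleftrightarrow> (\<forall>V K. smooth_antisymmetric V \<and> compact K \<and>
       (\<forall>\<alpha> \<beta>. closure {x. V \<alpha> \<beta> x \<noteq> 0} \<subseteq> K) \<longrightarrow>
     ((\<lambda>t. integral K (L (\<lambda>\<alpha> \<beta> x. W \<alpha> \<beta> x + t * V \<alpha> \<beta> x)))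
        has_vector_derivative 0) (at 0))"


section \<open>Well-definedness of \<open>\<iota>\<close> and \<open>\<Theta>\<close>\<close>

text \<open>The operators with the defining properties of \<open>\<iota> \<alpha>\<close> and \<open>\<Theta> I\<close> exist and are unique, so
  that the definite descriptions above denote.\<close>

abbreviation bas :: "idx set \<Rightarrow> form" where
  "bas K \<equiv> axis K 1"

lemma form_expand: "v = (\<Sum>K\<in>UNIV. v $ K *s bas K)" for v :: form
  by (simp add: basis_expansion)

lemma form_linear_eqI:
  fixes f g :: "form \<Rightarrow> form"
  assumes "Vector_Spaces.linear (*s) (*s) f" "Vector_Spaces.linear (*s) (*s) g"
    and "\<And>K. f (bas K) = g (bas K)"
  shows "f v = g v"
proof -
  interpret f: Vector_Spaces.linear "(*s)" "(*s)" f by (rule assms)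
  interpret g: Vector_Spaces.linear "(*s)" "(*s)" g by (rule assms)
  have "f v = (\<Sum>K\<in>UNIV. v $ K *s f (bas K))"
    by (subst form_expand) (simp only: f.sum f.scale)
  also have "\<dots> = g v"
    by (subst (2) form_expand) (simp only: g.sum g.scale assms(3))
  finally show ?thesis .
qed

lemma
  fixes f :: "form \<Rightarrow> form"
  assumes "Vector_Spaces.linear (*s) (*s) f"
  shows lin_scale: "f (c *s v) = c *s f v"
    and lin_zero: "f 0 = 0"
    and lin_add: "f (u + v) = f u + f v"
    and lin_diff: "f (u - v) = f u - f v"
    and lin_neg: "f (- v) = - f v"
proof -
  interpret f: Vector_Spaces.linear "(*s)" "(*s)" f by (rule assms)
  show "f (c *s v) = c *s f v" "f 0 = 0" "f (u + v) = f u + f v" "f (u - v) = f u - f v"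
    "f (- v) = - f v"
    by (fact f.scale f.zero f.add f.diff f.neg)+
qed

lemma operator_eqI: "A = B" if "\<And>v. A *v v = B *v v" for A B :: operator
  using that by (simp add: matrix_eq)

lemma operator_eq_basI: "A = B" if "\<And>K. A *v bas K = B *v bas K" for A B :: operator
  by (rule operator_eqI, rule form_linear_eqI) (use that in auto)

lemma wsign_Un_right:
  assumes "J \<inter> K = {}"
  shows "wsign I (J \<union> K) = wsign I J * wsign I K"
proof -
  have "{(i, j). i \<in> I \<and> j \<in> J \<union> K \<and> j < i} =
      {(i, j). i \<in> I \<and> j \<in> J \<and> j < i} \<union> {(i, j). i \<in> I \<and> j \<in> K \<and> j < i}" by auto
  moreover have "{(i, j). i \<in> I \<and> j \<in> J \<and> j < i} \<inter> {(i, j). i \<in> I \<and> j \<in> K \<and> j < i} = {}"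
    using assms by auto
  ultimately show ?thesis
    unfolding wsign_def by (simp add: card_Un_disjoint power_add)
qed

lemma wsign_Un_left:
  assumes "I \<inter> J = {}"
  shows "wsign (I \<union> J) K = wsign I K * wsign J K"
proof -
  have "{(i, j). i \<in> I \<union> J \<and> j \<in> K \<and> j < i} =
      {(i, j). i \<in> I \<and> j \<in> K \<and> j < i} \<union> {(i, j). i \<in> J \<and> j \<in> K \<and> j < i}" by auto
  moreover have "{(i, j). i \<in> I \<and> j \<in> K \<and> j < i} \<inter> {(i, j). i \<in> J \<and> j \<in> K \<and> j < i} = {}"
    using assms by auto
  ultimately show ?thesis
    unfolding wsign_def by (simp add: card_Un_disjoint power_add)
qed

lemma wsign_square [simp]: "wsign I J * wsign I J = 1"
  by (simp add: wsign_def flip: power_add mult_2)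

lemma wsign_nonzero [simp]: "wsign I J \<noteq> 0"
  by (simp add: wsign_def)

lemma wsign_empty [simp]: "wsign {} J = 1" "wsign I {} = 1"
  by (simp_all add: wsign_def)

lemma wsign_singletons: "wsign {a} {b} = (if b < a then - 1 else 1)"
proof -
  have "{(i, j). i \<in> {a} \<and> j \<in> {b} \<and> j < i} = (if b < a then {(a, b)} else {})" by auto
  then show ?thesis by (simp add: wsign_def)
qed

lemma wedge_linear_right: "Vector_Spaces.linear (*s) (*s) (\<lambda>v. u \<and>\<^sub>e v)"
  by unfold_locales
    (simp_all add: wedge_def vec_eq_iff algebra_simps sum.distrib sum_distrib_left)

lemma wedge_linear_left: "Vector_Spaces.linear (*s) (*s) (\<lambda>u. u \<and>\<^sub>e v)"
  by unfold_locales
    (simp_all add: wedge_def vec_eq_iff algebra_simps sum.distrib sum_distrib_left)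

lemma wedge_bas: "bas I \<and>\<^sub>e bas J = (if I \<inter> J = {} then wsign I J *s bas (I \<union> J) else 0)"
proof -
  have "(bas I \<and>\<^sub>e bas J) $ K = (if I \<inter> J = {} then wsign I J *s bas (I \<union> J) else 0) $ K" for K
  proof -
    have "(bas I \<and>\<^sub>e bas J) $ K =
        (\<Sum>L\<in>Pow K. if L = I then (if K - I = J then wsign I J else 0) else 0)"
      unfolding wedge_def vec_lambda_beta by (rule sum.cong) (auto simp: axis_def)
    also have "\<dots> = (if I \<subseteq> K \<and> K - I = J then wsign I J else 0)"
      by (subst sum.delta) auto
    also have "(I \<subseteq> K \<and> K - I = J) \<longleftrightarrow> I \<inter> J = {} \<and> I \<union> J = K" by auto
    finally show ?thesis by (auto simp: axis_def)
  qed
  then show ?thesis by (simp add: vec_eq_iff)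
qed

lemmas wedge_simps =
  lin_scale[OF wedge_linear_right] lin_scale[OF wedge_linear_left]

lemma wedge_zero [simp]: "u \<and>\<^sub>e 0 = 0" "0 \<and>\<^sub>e u = 0"
  by (simp_all add: wedge_def vec_eq_iff)

lemma wedge_add: "u \<and>\<^sub>e (v + w) = u \<and>\<^sub>e v + u \<and>\<^sub>e w" "(v + w) \<and>\<^sub>e u = v \<and>\<^sub>e u + w \<and>\<^sub>e u"
  using lin_add[OF wedge_linear_right] lin_add[OF wedge_linear_left]
  by auto

lemma wedge_diff: "u \<and>\<^sub>e (v - w) = u \<and>\<^sub>e v - u \<and>\<^sub>e w" "(v - w) \<and>\<^sub>e u = v \<and>\<^sub>e u - w \<and>\<^sub>e u"
  using lin_diff[OF wedge_linear_right] lin_diff[OF wedge_linear_left]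
  by auto

lemma wedge_assoc_bas: "(bas I \<and>\<^sub>e bas J) \<and>\<^sub>e bas K = bas I \<and>\<^sub>e (bas J \<and>\<^sub>e bas K)"
proof (cases "I \<inter> J = {} \<and> I \<inter> K = {} \<and> J \<inter> K = {}")
  case True
  then have "(I \<union> J) \<inter> K = {}" "I \<inter> (J \<union> K) = {}" by auto
  with True show ?thesis
    by (simp add: wedge_bas wedge_simps wsign_Un_left wsign_Un_right Un_assoc)
next
  case False
  then have "I \<inter> J \<noteq> {} \<or> (I \<union> J) \<inter> K \<noteq> {}" "J \<inter> K \<noteq> {} \<or> I \<inter> (J \<union> K) \<noteq> {}" by auto
  then show ?thesis
    by (auto simp: wedge_bas wedge_simps)
qed

lemma linear_comp: "Vector_Spaces.linear (*s) (*s) (\<lambda>v. f (g v))"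
  if "Vector_Spaces.linear (*s) (*s) f" "Vector_Spaces.linear (*s) (*s) g"
  for f g :: "form \<Rightarrow> form"
  using Vector_Spaces.linear_compose[OF that(2,1)] by (simp add: o_def)

lemma wedge_assoc: "(u \<and>\<^sub>e v) \<and>\<^sub>e w = u \<and>\<^sub>e (v \<and>\<^sub>e w)"
proof -
  have 1: "(bas I \<and>\<^sub>e bas J) \<and>\<^sub>e w = bas I \<and>\<^sub>e (bas J \<and>\<^sub>e w)" for I J w
    by (rule form_linear_eqI[OF wedge_linear_right linear_comp])
      (simp_all add: wedge_linear_right wedge_assoc_bas)
  have 2: "(bas I \<and>\<^sub>e v) \<and>\<^sub>e w = bas I \<and>\<^sub>e (v \<and>\<^sub>e w)" for I v w
    by (rule form_linear_eqI[OF linear_comp[OF wedge_linear_left wedge_linear_right]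
          linear_comp[OF wedge_linear_right wedge_linear_left]]) (rule 1)
  show ?thesis
    by (rule form_linear_eqI[OF linear_comp[OF wedge_linear_left wedge_linear_left]
          wedge_linear_left]) (rule 2)
qed

lemma linear_ident: "Vector_Spaces.linear (*s) (*s) (\<lambda>v. v :: form)"
  by unfold_locales simp_all

lemma linear_smult: "Vector_Spaces.linear (*s) (*s) (\<lambda>v. c *s f v)"
  if "Vector_Spaces.linear (*s) (*s) f" for f :: "form \<Rightarrow> form"
  by unfold_locales
    (simp_all add: lin_add[OF that] lin_scale[OF that] vec_eq_iff algebra_simps)

lemma linear_uminus: "Vector_Spaces.linear (*s) (*s) (\<lambda>v. - f v)"
  if "Vector_Spaces.linear (*s) (*s) f" for f :: "form \<Rightarrow> form"
  by unfold_locales (simp_all add: lin_add[OF that] lin_scale[OF that] vec_eq_iff)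

lemma wedge_one [simp]: "bas {} \<and>\<^sub>e v = v"
  by (rule form_linear_eqI[OF wedge_linear_right]) (simp_all add: wedge_bas linear_ident)

lemma basis_Nil: "\<ee> [] = bas {}"
  by (simp add: \<ee>_def)

lemma basis_Cons: "\<ee> (a # I) = bas {a} \<and>\<^sub>e \<ee> I"
  by (simp add: \<ee>_def)

lemma basis_single: "\<ee> [a] = bas {a}"
  by (simp add: basis_Nil basis_Cons wedge_bas)

text \<open>The identification of subsets with increasing multi-indices.\<close>

lemma basis_sorted: "\<ee> (sorted_list_of_set K) = bas K"
proof -
  have "\<ee> I = bas (set I)" if "sorted_wrt (<) I" for I
    using that
  proof (induction I)
    case (Cons a I)
    then have *: "{(i, j). i \<in> {a} \<and> j \<in> set I \<and> j < i} = {}" "a \<notin> set I" by auto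
    then have "wsign {a} (set I) = 1" unfolding wsign_def by (simp only: * card.empty power_0)
    with * Cons show ?case
      by (simp add: basis_Cons wedge_bas)
  qed (simp add: basis_Nil)
  from this[OF strict_sorted_list_of_set] show ?thesis by simp
qed

text \<open>The partial derivative with respect to \<open>\<ee> [b]\<close>, the transpose of the left multiplication by it.\<close>

definition contract :: "idx \<Rightarrow> form \<Rightarrow> form" where
  "contract b v = (\<chi> K. if b \<in> K then 0 else wsign {b} K * v $ insert b K)"

lemma contract_linear: "Vector_Spaces.linear (*s) (*s) (contract b)"
  by unfold_locales (simp_all add: contract_def vec_eq_iff algebra_simps)

lemma contract_bas:
  "contract b (bas K) = (if b \<in> K then wsign {b} (K - {b}) *s bas (K - {b}) else 0)"
  by (auto simp: contract_def vec_eq_iff axis_def insert_absorb)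

lemma contract_wedge_bas:
  "contract b (bas {a} \<and>\<^sub>e bas K) = (if a = b then 1 else 0) *s bas K - bas {a} \<and>\<^sub>e contract b (bas K)"
proof (cases "a = b")
  case True
  then show ?thesis
    by (auto simp: wedge_bas contract_bas wedge_simps insert_absorb
        lin_scale[OF contract_linear] lin_zero[OF contract_linear])
next
  case False
  show ?thesis
  proof (cases "a \<notin> K \<and> b \<in> K")
    case True
    have "wsign {a} K = wsign {a} ({b} \<union> (K - {b}))" using True by (simp add: insert_absorb)
    also have "\<dots> = wsign {a} {b} * wsign {a} (K - {b})" by (rule wsign_Un_right) auto
    finally have 1: "wsign {a} K = wsign {a} {b} * wsign {a} (K - {b})" .
    have "wsign {b} (insert a K - {b}) = wsign {b} ({a} \<union> (K - {b}))"
      using False by (simp add: insert_Diff_if)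
    also have "\<dots> = wsign {b} {a} * wsign {b} (K - {b})"
      by (rule wsign_Un_right) (use True in auto)
    finally have 2: "wsign {b} (insert a K - {b}) = wsign {b} {a} * wsign {b} (K - {b})" .
    have 3: "wsign {b} {a} = - wsign {a} {b}" using False by (auto simp: wsign_singletons)
    have 4: "insert a K - {b} = insert a (K - {b})" using False by auto
    have 5: "wsign {a} {b} * (wsign {a} {b} * z) = z" for z
      by (simp flip: mult.assoc)
    show ?thesis
      using True False 1 2 3
      by (simp add: wedge_bas contract_bas wedge_simps 4 5 algebra_simps
        lin_scale[OF contract_linear] vec_eq_iff)
  next
    case *: False
    with False show ?thesis
      by (auto simp: wedge_bas contract_bas wedge_simps
        lin_scale[OF contract_linear] lin_zero[OF contract_linear])
  qed
qed

definition iota_fun :: "idx \<Rightarrow> form \<Rightarrow> form" where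
  "iota_fun a v = (\<Sum>b\<in>UNIV. of_real (\<eta> a b) *s contract b v)"

lemma iota_fun_eq: "iota_fun a v = of_real (\<eta> a a) *s contract a v"
proof -
  have "iota_fun a v = (\<Sum>b\<in>UNIV. if b = a then of_real (\<eta> a a) *s contract a v else 0)"
    unfolding iota_fun_def by (intro sum.cong) (auto simp: \<eta>_def)
  then show ?thesis by simp
qed

lemma iota_fun_linear: "Vector_Spaces.linear (*s) (*s) (iota_fun a)"
proof -
  interpret c: Vector_Spaces.linear "(*s)" "(*s)" "contract a" by (rule contract_linear)
  show ?thesis
    by unfold_locales (simp_all add: iota_fun_eq c.add c.scale algebra_simps vec_eq_iff)
qed

lemma linear_add_fun: "Vector_Spaces.linear (*s) (*s) (\<lambda>v. f v + g v)"
  if "Vector_Spaces.linear (*s) (*s) f" "Vector_Spaces.linear (*s) (*s) g"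
  for f g :: "form \<Rightarrow> form"
  using that by (rule vec.linear_compose_add)

lemma iota_fun_wedge: "iota_fun b (bas {a} \<and>\<^sub>e v) = of_real (\<eta> b a) *s v - bas {a} \<and>\<^sub>e iota_fun b v"
proof (rule form_linear_eqI[where f = "\<lambda>v. iota_fun b (bas {a} \<and>\<^sub>e v)"
      and g = "\<lambda>v. of_real (\<eta> b a) *s v - bas {a} \<and>\<^sub>e iota_fun b v"])
  show "Vector_Spaces.linear (*s) (*s) (\<lambda>v. iota_fun b (bas {a} \<and>\<^sub>e v))"
    by (rule linear_comp[OF iota_fun_linear wedge_linear_right])
  show "Vector_Spaces.linear (*s) (*s) (\<lambda>v. of_real (\<eta> b a) *s v - bas {a} \<and>\<^sub>e iota_fun b v)"
    by (rule vec.linear_compose_sub[OF linear_smult[OF linear_ident]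
          linear_comp[OF wedge_linear_right iota_fun_linear]])
  show "iota_fun b (bas {a} \<and>\<^sub>e bas K) = of_real (\<eta> b a) *s bas K - bas {a} \<and>\<^sub>e iota_fun b (bas K)"
    for K
    by (cases "a = b")
      (simp_all add: iota_fun_eq contract_wedge_bas wedge_simps vec_eq_iff algebra_simps, simp add: \<eta>_def)
qed

lemma iota_fun_leibniz:
  "iota_fun a (\<ee> I \<and>\<^sub>e v) = iota_fun a (\<ee> I) \<and>\<^sub>e v + (- 1) ^ length I *s (\<ee> I \<and>\<^sub>e iota_fun a v)"
proof (induction I)
  case Nil
  then show ?case by (simp add: basis_Nil iota_fun_eq contract_bas)
next
  case (Cons b I)
  have "iota_fun a (\<ee> (b # I) \<and>\<^sub>e v) = iota_fun a (bas {b} \<and>\<^sub>e (\<ee> I \<and>\<^sub>e v))"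
    by (simp add: basis_Cons wedge_assoc)
  then show ?case
    by (simp add: iota_fun_wedge Cons basis_Cons wedge_assoc wedge_add wedge_diff wedge_simps vec_eq_iff)
qed

definition is_interior :: "idx \<Rightarrow> operator \<Rightarrow> bool" where
  "is_interior \<alpha> M \<longleftrightarrow> M *v \<ee> [] = 0 \<and> (\<forall>\<beta>. M *v \<ee> [\<beta>] = of_real (\<eta> \<alpha> \<beta>) *s \<ee> []) \<and>
     (\<forall>I J. M *v (\<ee> I \<and>\<^sub>e \<ee> J) =
        (M *v \<ee> I) \<and>\<^sub>e \<ee> J + (- 1) ^ length I *s (\<ee> I \<and>\<^sub>e (M *v \<ee> J)))"

lemma is_interior_matrix: "is_interior a (matrix (iota_fun a))"
  unfolding is_interior_def matrix_works[OF iota_fun_linear]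
  using iota_fun_leibniz iota_fun_wedge[of a _ "bas {}"]
  by (auto simp: basis_Nil basis_single iota_fun_eq contract_bas \<eta>_def)

lemma is_interior_unique:
  assumes "is_interior a M" "is_interior a N"
  shows "M = N"
proof -
  have eq: "M *v \<ee> I = N *v \<ee> I" for I
  proof (induction I)
    case Nil
    then show ?case using assms by (simp add: is_interior_def)
  next
    case (Cons b I)
    have "\<ee> (b # I) = \<ee> [b] \<and>\<^sub>e \<ee> I" unfolding basis_Cons[of b I] basis_single ..
    with assms Cons show ?case unfolding is_interior_def by simp
  qed
  show ?thesis
    by (rule operator_eq_basI) (use eq basis_sorted in metis)
qed

theorem interior_unique_existence:
  "\<exists>!M. M *v \<ee> [] = 0 \<and> (\<forall>\<beta>. M *v \<ee> [\<beta>] = of_real (\<eta> \<alpha> \<beta>) *s \<ee> []) \<and>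
     (\<forall>I J. M *v (\<ee> I \<and>\<^sub>e \<ee> J) =
        (M *v \<ee> I) \<and>\<^sub>e \<ee> J + (- 1) ^ length I *s (\<ee> I \<and>\<^sub>e (M *v \<ee> J)))"
  using is_interior_matrix is_interior_unique unfolding is_interior_def[symmetric] by blast

lemma iota_eq_matrix: "\<iota> \<alpha> = matrix (iota_fun \<alpha>)"
  unfolding \<iota>_def is_interior_def[symmetric]
  by (rule the_equality) (use is_interior_matrix is_interior_unique in blast)+

lemma is_interior_iota: "is_interior \<alpha> (\<iota> \<alpha>)"
  by (simp add: iota_eq_matrix is_interior_matrix)

lemma iota_mult: "\<iota> \<alpha> *v v = iota_fun \<alpha> v"
  by (simp add: iota_eq_matrix matrix_works[OF iota_fun_linear])

lemma gamma_mult: "\<gamma> \<alpha> *v v = bas {\<alpha>} \<and>\<^sub>e v - iota_fun \<alpha> v"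
proof -
  have "Vector_Spaces.linear (*s) (*s) (\<lambda>v. bas {\<alpha>} \<and>\<^sub>e v - iota_fun \<alpha> v)"
    by (rule vec.linear_compose_sub[OF wedge_linear_right iota_fun_linear])
  then show ?thesis
    by (simp add: \<gamma>_def basis_single iota_mult matrix_works)
qed

text \<open>With \<open>c = - 1\<close> the operators in the last premise are the \<open>\<gamma> a\<close>; with \<open>c = 1\<close> they are, up to
  sign, the right multiplications below, which commute with the \<open>\<gamma> a\<close>.\<close>

lemma cyclic_induct:
  fixes P :: "form \<Rightarrow> bool"
  assumes one: "P (bas {})"
    and lin: "\<And>u v. P u \<Longrightarrow> P v \<Longrightarrow> P (u + v)" "\<And>c v. P v \<Longrightarrow> P (c *s v)"
    and step: "\<And>a K. P (bas K) \<Longrightarrow> a \<notin> K \<Longrightarrow> \<exists>c. P (bas {a} \<and>\<^sub>e bas K + c *s iota_fun a (bas K))"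
  shows "P v"
proof -
  have *: "P (bas K)" for K
  proof -
    have "finite K" by simp
    then show ?thesis
    proof (induction K rule: finite_induct)
      case (insert a K)
      have 0: "iota_fun a (bas K) = 0" using insert by (simp add: iota_fun_eq contract_bas)
      obtain c where "P (bas {a} \<and>\<^sub>e bas K + c *s iota_fun a (bas K))"
        using step[OF insert.IH insert.hyps(2)] by blast
      then have "P (wsign {a} K *s bas (insert a K))"
        using insert.hyps(2) by (simp add: 0 wedge_bas)
      from lin(2)[OF this, of "wsign {a} K"] show ?case by (simp add: vector_smult_assoc)
    qed (rule one)
  qed
  have "P 0" using lin(2)[OF one, of 0] by simp
  have "P (\<Sum>K\<in>A. v $ K *s bas K)" for A
    using finite[of A] by (induction A rule: finite_induct) (use \<open>P 0\<close> * lin in auto)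
  from this[of UNIV] show ?thesis by (simp add: form_expand[symmetric])
qed

definition grade :: "form \<Rightarrow> form" where
  "grade v = (\<chi> K. (- 1) ^ card K * v $ K)"

lemma grade_linear: "Vector_Spaces.linear (*s) (*s) grade"
  by unfold_locales (simp_all add: grade_def vec_eq_iff algebra_simps)

lemma grade_bas: "grade (bas K) = (- 1) ^ card K *s bas K"
  by (simp add: grade_def vec_eq_iff axis_def)

lemma grade_wedge: "grade (bas {a} \<and>\<^sub>e v) = - (bas {a} \<and>\<^sub>e grade v)"
proof (rule form_linear_eqI[where f = "\<lambda>v. grade (bas {a} \<and>\<^sub>e v)"
      and g = "\<lambda>v. - (bas {a} \<and>\<^sub>e grade v)"])
  show "Vector_Spaces.linear (*s) (*s) (\<lambda>v. grade (bas {a} \<and>\<^sub>e v))"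
    by (rule linear_comp[OF grade_linear wedge_linear_right])
  show "Vector_Spaces.linear (*s) (*s) (\<lambda>v. - (bas {a} \<and>\<^sub>e grade v))"
    by (rule linear_uminus[OF linear_comp[OF wedge_linear_right grade_linear]])
  show "grade (bas {a} \<and>\<^sub>e bas K) = - (bas {a} \<and>\<^sub>e grade (bas K))" for K
    by (simp add: wedge_bas wedge_simps grade_bas lin_scale[OF grade_linear]
        lin_zero[OF grade_linear] vec_eq_iff)
qed

lemma grade_iota: "grade (iota_fun a v) = - iota_fun a (grade v)"
proof (rule form_linear_eqI[where f = "\<lambda>v. grade (iota_fun a v)"
      and g = "\<lambda>v. - iota_fun a (grade v)"])
  show "Vector_Spaces.linear (*s) (*s) (\<lambda>v. grade (iota_fun a v))"
    by (rule linear_comp[OF grade_linear iota_fun_linear])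
  show "Vector_Spaces.linear (*s) (*s) (\<lambda>v. - iota_fun a (grade v))"
    by (rule linear_uminus[OF linear_comp[OF iota_fun_linear grade_linear]])
  show "grade (iota_fun a (bas K)) = - iota_fun a (grade (bas K))" for K
  proof (cases "a \<in> K")
    case True
    then obtain n where "card K = Suc n" "card (K - {a}) = n"
      using card_Suc_Diff1[of K a] finite[of K] by metis
    with True show ?thesis
      by (simp add: iota_fun_eq contract_bas grade_bas lin_scale[OF grade_linear]
        lin_neg[OF contract_linear] lin_scale[OF contract_linear] vec_eq_iff)
  qed (simp add: iota_fun_eq contract_bas grade_bas lin_scale[OF grade_linear]
        lin_scale[OF contract_linear] lin_zero[OF grade_linear])
qed

definition rmult :: "idx \<Rightarrow> form \<Rightarrow> form" where
  "rmult a v = bas {a} \<and>\<^sub>e grade v + iota_fun a (grade v)"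

lemma rmult_linear: "Vector_Spaces.linear (*s) (*s) (rmult a)"
  unfolding rmult_def
  by (rule linear_add_fun[OF linear_comp[OF wedge_linear_right grade_linear]
        linear_comp[OF iota_fun_linear grade_linear]])

lemma wedge_anticommute: "bas {a} \<and>\<^sub>e (bas {b} \<and>\<^sub>e v) = - (bas {b} \<and>\<^sub>e (bas {a} \<and>\<^sub>e v))"
proof -
  have "bas {a} \<and>\<^sub>e bas {b} = - (bas {b} \<and>\<^sub>e bas {a})"
    by (auto simp: wedge_bas wsign_singletons insert_commute vec_eq_iff)
  then have "(bas {a} \<and>\<^sub>e bas {b}) \<and>\<^sub>e v = - (bas {b} \<and>\<^sub>e bas {a}) \<and>\<^sub>e v" by simp
  then show ?thesis
    using lin_neg[OF wedge_linear_left] by (simp add: wedge_assoc)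
qed

lemma iota_anticommute: "iota_fun a (iota_fun b v) = - iota_fun b (iota_fun a v)"
proof -
  interpret a: Vector_Spaces.linear "(*s)" "(*s)" "contract a" by (rule contract_linear)
  interpret b: Vector_Spaces.linear "(*s)" "(*s)" "contract b" by (rule contract_linear)
  have "(contract a (contract b v)) $ K = - (contract b (contract a v)) $ K" for K
  proof (cases "a = b \<or> a \<in> K \<or> b \<in> K")
    case False
    then have "wsign {b} (insert a K) = wsign {b} {a} * wsign {b} K"
      "wsign {a} (insert b K) = wsign {a} {b} * wsign {a} K"
      using wsign_Un_right[of "{a}" K "{b}"] wsign_Un_right[of "{b}" K "{a}"] by auto
    moreover have "wsign {b} {a} = - wsign {a} {b}" using False by (auto simp: wsign_singletons)
    ultimately show ?thesis
      using False by (auto simp: contract_def insert_commute)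
  qed (auto simp: contract_def)
  then have "contract a (contract b v) = - contract b (contract a v)" by (simp add: vec_eq_iff)
  then show ?thesis
    by (simp add: iota_fun_eq a.scale b.scale vec_eq_iff)
qed

lemma rmult_commute: "rmult a (\<gamma> b *v v) = \<gamma> b *v rmult a v"
proof -
  interpret g: Vector_Spaces.linear "(*s)" "(*s)" grade by (rule grade_linear)
  interpret i: Vector_Spaces.linear "(*s)" "(*s)" "iota_fun a" by (rule iota_fun_linear)
  interpret i': Vector_Spaces.linear "(*s)" "(*s)" "iota_fun b" by (rule iota_fun_linear)
  interpret w: Vector_Spaces.linear "(*s)" "(*s)" "\<lambda>v. bas {a} \<and>\<^sub>e v" by (rule wedge_linear_right)
  interpret w': Vector_Spaces.linear "(*s)" "(*s)" "\<lambda>v. bas {b} \<and>\<^sub>e v" by (rule wedge_linear_right)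
  have "\<eta> a b = \<eta> b a" by (simp add: \<eta>_def)
  then have "rmult a (\<gamma> b *v v) = - (bas {a} \<and>\<^sub>e bas {b} \<and>\<^sub>e grade v) + bas {a} \<and>\<^sub>e iota_fun b (grade v)
      - of_real (\<eta> b a) *s grade v + bas {b} \<and>\<^sub>e iota_fun a (grade v) + iota_fun a (iota_fun b (grade v))"
    by (simp add: gamma_mult rmult_def g.diff grade_wedge grade_iota i.diff i.add i.neg
        w.add w.diff w.neg iota_fun_wedge)
  moreover have "\<gamma> b *v rmult a v = bas {b} \<and>\<^sub>e bas {a} \<and>\<^sub>e grade v + bas {a} \<and>\<^sub>e iota_fun b (grade v)
      - of_real (\<eta> b a) *s grade v + bas {b} \<and>\<^sub>e iota_fun a (grade v) - iota_fun b (iota_fun a (grade v))"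
    by (simp add: gamma_mult rmult_def i'.add w'.add iota_fun_wedge)
  ultimately show ?thesis
    by (simp add: wedge_anticommute[of a b "grade v"] iota_anticommute[of a b "grade v"])
qed

definition is_theta :: "form \<Rightarrow> operator \<Rightarrow> bool" where
  "is_theta v M \<longleftrightarrow> (\<forall>\<alpha>. M ** \<gamma> \<alpha> = \<gamma> \<alpha> ** M) \<and> M *v \<ee> [] = v"

lemma is_theta_exists: "\<exists>M. is_theta v M"
proof (induction v rule: cyclic_induct)
  case 1
  have "is_theta (bas {}) (mat 1)" by (simp add: is_theta_def basis_Nil)
  then show ?case by blast
next
  case (2 u v)
  then obtain M N where "is_theta u M" "is_theta v N" by blast
  then have "is_theta (u + v) (M + N)"
    by (simp add: is_theta_def matrix_vector_mult_add_rdistrib matrix_eq matrix_vector_right_distrib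
        flip: matrix_vector_mul_assoc)
  then show ?case by blast
next
  case (3 c v)
  then obtain M where M: "is_theta v M" by blast
  have scal: "mat c ** A = A ** mat c" for A :: operator
    by (simp add: matrix_matrix_mult_def mat_def vec_eq_iff if_distrib if_distribR cong: if_cong)
  have "mat c *v w = c *s w" for w :: form
    by (simp add: matrix_vector_mult_def mat_def vec_eq_iff if_distrib if_distribR cong: if_cong)
  then have "is_theta (c *s v) (mat c ** M)"
    using M unfolding is_theta_def by (metis scal matrix_mul_assoc matrix_vector_mul_assoc)
  then show ?case by blast
next
  case (4 a K)
  then obtain M where M: "is_theta (bas K) M" by blast
  let ?s = "(- 1) ^ card K :: complex"
  let ?R = "\<lambda>v. ?s *s rmult a v"
  interpret r: Vector_Spaces.linear "(*s)" "(*s)" "rmult a" by (rule rmult_linear)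
  have R: "Vector_Spaces.linear (*s) (*s) ?R"
    by (rule linear_smult[OF rmult_linear])
  interpret i: Vector_Spaces.linear "(*s)" "(*s)" "iota_fun a" by (rule iota_fun_linear)
  have "?s * ?s = 1" by (simp flip: power_add mult_2)
  then have "?R (bas K) = bas {a} \<and>\<^sub>e bas K + 1 *s iota_fun a (bas K)"
    by (simp add: rmult_def grade_bas i.scale wedge_simps vector_add_ldistrib)
  then have Rb: "matrix ?R *v bas K = bas {a} \<and>\<^sub>e bas K + 1 *s iota_fun a (bas K)"
    by (simp only: matrix_works[OF R])
  have Rg: "matrix ?R ** \<gamma> b = \<gamma> b ** matrix ?R" for b
    by (rule operator_eqI)
      (simp add: matrix_vector_mul_assoc[symmetric] matrix_works[OF R] rmult_commute vector_scalar_commute)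
  have "matrix ?R ** M ** \<gamma> b = \<gamma> b ** (matrix ?R ** M)" for b
  proof -
    have "matrix ?R ** M ** \<gamma> b = matrix ?R ** (\<gamma> b ** M)"
      using M by (simp add: is_theta_def flip: matrix_mul_assoc)
    also have "\<dots> = \<gamma> b ** (matrix ?R ** M)"
      by (simp only: matrix_mul_assoc Rg)
    finally show ?thesis .
  qed
  then have "is_theta (bas {a} \<and>\<^sub>e bas K + 1 *s iota_fun a (bas K)) (matrix ?R ** M)"
    using M Rb by (simp add: is_theta_def flip: matrix_vector_mul_assoc)
  then show ?case by blast
qed

lemma is_theta_unique:
  assumes "is_theta v M" "is_theta v N"
  shows "M = N"
proof (rule operator_eqI)
  fix w
  show "M *v w = N *v w"
  proof (induction w rule: cyclic_induct)
    case 1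
    then show ?case using assms by (simp add: is_theta_def basis_Nil)
  next
    case (4 a K)
    have "\<gamma> a *v bas K = bas {a} \<and>\<^sub>e bas K + (- 1) *s iota_fun a (bas K)"
      by (simp add: gamma_mult vec_eq_iff)
    moreover have "M *v (\<gamma> a *v bas K) = N *v (\<gamma> a *v bas K)"
      using assms 4 unfolding is_theta_def by (metis matrix_vector_mul_assoc)
    ultimately show ?case by metis
  qed (simp_all add: matrix_vector_right_distrib vector_scalar_commute)
qed

theorem theta_unique_existence:
  "\<exists>!M. (\<forall>\<alpha>. M ** \<gamma> \<alpha> = \<gamma> \<alpha> ** M) \<and> M *v \<ee> [] = \<ee> I"
  using is_theta_exists[of "\<ee> I"] is_theta_unique[of "\<ee> I"] unfolding is_theta_def[symmetric]
  by blast

end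

(* Right Clifford multiplication by the e_a gives generators Gamma_a of the commutant of the gamma
   matrices, and Theta_{abc} = -Gamma_a Gamma_b Gamma_c for distinct indices, a multiple of J Gamma_d.
   Since S = sin + i cos J is conjugated when it moves past an odd element, the operators
   Q_d = -i S J Gamma_d satisfy Q_d Q_e = cos(2 zeta) Gamma_d Gamma_e.  Hence H_a = A_a^d Q_d, where A
   is essentially the dual of W, and the traces of words in the Gamma_a reduce L_V to a polynomial
   in W and its first derivatives.  Self-adjointness of Theta_{abc} and anti-self-adjointness of
   gamma_a for the form psi^dagger eta_hat psi make the current on the right-hand side real, so L is
   affine-linear in W up to -tau L_V.  The Euler-Lagrange equation follows by differentiating under
   the integral, integration by parts and testing with smooth bumps; the integral of a
   partial derivative of a compactly supported F vanishes because the integral of F is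
   translation invariant. *)
theory Submission
  imports Defs
begin

section \<open>The commutant of the gamma matrices\<close>

text \<open>The commutant is graded by its behaviour under \<open>\<J>\<close>. In the curvature the
  derivatives of W lie in the odd span of the Q_d, while the products of two potentials lie in the
  even span of the commutators of the Gamma_a. An odd operator has trace zero, so no term of L_V
  mixes derivatives of W with the products W W. The constants have three sources: 16 is the trace of
  the identity, a product of two commutators has traces with factor 64, and the dual field carries a
  factor 2. Hence 1024 is 64 times 2^4, and the kinetic coefficient 64 is 16 times 2^2. The formula
  for L_V is pointwise, so no total derivative may be discarded. The passage from the dual field
  back to W rests on polynomial identities in the six independent components of W, with the
  derivatives treated as independent variables. Two features of stationarity shape the analysis. The
  region K is an arbitrary compact set, whereas the Leibniz rule is applied on boxes. The variations
  are antisymmetric, so only the antisymmetric part of an Euler-Lagrange expression can be tested,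
  and the expression has to be brought into antisymmetric form.\<close>

lemma matrix_mult_bilinear:
  fixes A B C :: operator
  shows "(- A) ** B = - (A ** B)" "A ** (- B) = - (A ** B)"
    "(A + B) ** C = A ** C + B ** C" "A ** (B + C) = A ** B + A ** C"
    "(A - B) ** C = A ** C - B ** C" "A ** (B - C) = A ** B - A ** C"
    "(r *\<^sub>R A) ** B = r *\<^sub>R (A ** B)" "A ** (r *\<^sub>R B) = r *\<^sub>R (A ** B)"
    "0 ** A = 0" "A ** 0 = 0"
  by (simp_all add: matrix_matrix_mult_def vec_eq_iff sum_negf sum_subtractf sum.distrib algebra_simps
      scaleR_sum_right)

lemma matrix_mult_sum:
  fixes A :: operator
  shows "sum F X ** A = (\<Sum>x\<in>X. F x ** A)" "A ** sum F X = (\<Sum>x\<in>X. A ** F x)"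
  by (induction X rule: infinite_finite_induct)
    (simp_all add: matrix_mult_bilinear)

lemma mat_mult: "mat c *v v = c *s v" for v :: form
  by (simp add: matrix_vector_mult_def mat_def vec_eq_iff if_distrib if_distribR cong: if_cong)

lemma mat_commute: "A ** mat c = mat c ** A" for A :: operator
  by (simp add: matrix_matrix_mult_def mat_def vec_eq_iff if_distrib if_distribR cong: if_cong)

lemma mat_of_real: "(mat (of_real r) :: operator) = r *\<^sub>R mat 1"
  by (simp add: mat_def vec_eq_iff) (simp add: scaleR_conv_of_real)

lemma mat_times_of_real: "(mat (c * of_real r) :: operator) = r *\<^sub>R mat c"
  by (simp add: mat_def vec_eq_iff) (simp add: scaleR_conv_of_real)

lemma matrix_vector_bilinear:
  fixes A :: operator
  shows "(- A) *v v = - (A *v v)" "(r *\<^sub>R A) *v v = of_real r *s (A *v v)"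
  by (simp_all add: matrix_vector_mult_def vec_eq_iff sum_negf sum_distrib_left mult.assoc)
    (simp add: scaleR_conv_of_real mult.assoc)

lemma trace_scaleR: "trace (r *\<^sub>R A) = of_real r * trace A" for A :: operator
  by (simp add: trace_def sum_distrib_left) (simp add: scaleR_conv_of_real)

lemma trace_uminus: "trace (- A) = - trace A" for A :: operator
  by (simp add: trace_def sum_negf)

lemma trace_sum: "trace (sum F X) = (\<Sum>x\<in>X. trace (F x))" for F :: "'a \<Rightarrow> operator"
  by (induction X rule: infinite_finite_induct) (simp_all add: trace_add, simp_all add: trace_def)

lemma is_theta_Theta: "is_theta (\<ee> I) (\<Theta> I)"
  unfolding \<Theta>_def is_theta_def using theI'[OF theta_unique_existence] by blast

text \<open>The way past the definite description: each \<open>\<Theta> I\<close> is computed by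
  exhibiting an operator in the commutant with the right value on \<open>\<ee> []\<close>.\<close>

lemma Theta_eqI: "is_theta (\<ee> I) M \<Longrightarrow> \<Theta> I = M"
  using is_theta_Theta is_theta_unique by blast

lemma Theta_gamma_commute: "\<Theta> I ** \<gamma> a = \<gamma> a ** \<Theta> I"
  using is_theta_Theta by (simp add: is_theta_def)

section \<open>Clifford relations in the commutant, and \<open>\<Theta>\<close> as words in its
  generators\<close>

definition \<Gamma> :: "idx \<Rightarrow> operator" where
  "\<Gamma> a = matrix (rmult a)"

lemma Gamma_mult: "\<Gamma> a *v v = rmult a v"
  by (simp add: \<Gamma>_def matrix_works[OF rmult_linear])

lemma Gamma_gamma_commute: "\<Gamma> a ** \<gamma> b = \<gamma> b ** \<Gamma> a"
  by (rule operator_eqI) (simp add: Gamma_mult rmult_commute flip: matrix_vector_mul_assoc)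

lemma grade_grade: "grade (grade v) = v"
  by (simp add: grade_def vec_eq_iff flip: mult.assoc power_add mult_2)

text \<open>In \<open>rmult a (rmult b v)\<close> the double wedge, the double contraction and the
  pair of mixed terms are all antisymmetric in a and b, so only the metric term survives
  symmetrization. The generators satisfy the Clifford relation of the metric with opposite
  sign.\<close>

lemma Gamma_anticommute: "\<Gamma> a ** \<Gamma> b = - (\<Gamma> b ** \<Gamma> a) - (2 * \<eta> a b) *\<^sub>R mat 1"
proof (rule operator_eqI)
  fix v
  interpret g: Vector_Spaces.linear "(*s)" "(*s)" grade by (rule grade_linear)
  interpret i: Vector_Spaces.linear "(*s)" "(*s)" "iota_fun a" for a by (rule iota_fun_linear)
  interpret w: Vector_Spaces.linear "(*s)" "(*s)" "\<lambda>v. bas {a} \<and>\<^sub>e v" for a by (rule wedge_linear_right)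
  have *: "rmult a (rmult b v) = - (bas {a} \<and>\<^sub>e bas {b} \<and>\<^sub>e v) - bas {a} \<and>\<^sub>e iota_fun b v
     - of_real (\<eta> a b) *s v + bas {b} \<and>\<^sub>e iota_fun a v - iota_fun a (iota_fun b v)" for a b
    by (simp add: rmult_def g.add grade_wedge grade_iota grade_grade w.diff w.neg i.diff i.neg
        iota_fun_wedge)
  have "\<eta> a b = \<eta> b a" by (simp add: \<eta>_def)
  then have "rmult a (rmult b v) = - rmult b (rmult a v) - of_real (2 * \<eta> a b) *s v"
    unfolding *
    by (simp add: wedge_anticommute[of a b v] iota_anticommute[of a b v] vec_eq_iff algebra_simps)
  moreover have "(- (\<Gamma> b ** \<Gamma> a) - (2 * \<eta> a b) *\<^sub>R mat 1) *v v
      = - rmult b (rmult a v) - of_real (2 * \<eta> a b) *s v"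
    by (simp add: matrix_vector_mult_diff_rdistrib matrix_vector_bilinear Gamma_mult
        flip: matrix_vector_mul_assoc)
  ultimately show "(\<Gamma> a ** \<Gamma> b) *v v = (- (\<Gamma> b ** \<Gamma> a) - (2 * \<eta> a b) *\<^sub>R mat 1) *v v"
    by (simp add: Gamma_mult flip: matrix_vector_mul_assoc)
qed

lemma grade_basis: "grade (\<ee> I) = (- 1) ^ length I *s \<ee> I"
proof (induction I)
  case (Cons a I)
  then show ?case
    by (simp add: basis_Cons grade_wedge wedge_simps)
qed (simp add: basis_Nil grade_bas)

lemma iota_basis: "a \<notin> set I \<Longrightarrow> iota_fun a (\<ee> I) = 0"
proof (induction I)
  case (Cons b I)
  then show ?case
    by (simp add: basis_Cons iota_fun_wedge \<eta>_def)
qed (simp add: basis_Nil iota_fun_eq contract_bas)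

lemma Theta_Nil: "\<Theta> [] = mat 1"
  by (rule Theta_eqI) (simp add: is_theta_def)

text \<open>On \<open>\<ee> I\<close> the grading inside \<open>rmult a\<close> contributes the sign
  of \<open>length I\<close>, which the prefactor cancels, and the contraction vanishes because
  \<open>a\<close> does not occur in \<open>I\<close>.\<close>

lemma Theta_Cons:
  assumes "a \<notin> set I"
  shows "\<Theta> (a # I) = (- 1) ^ length I *\<^sub>R (\<Gamma> a ** \<Theta> I)"
proof (rule Theta_eqI)
  have "\<Gamma> a ** \<Theta> I ** \<gamma> b = \<gamma> b ** (\<Gamma> a ** \<Theta> I)" for b
    unfolding matrix_mul_assoc Gamma_gamma_commute[symmetric]
    by (simp add: Theta_gamma_commute flip: matrix_mul_assoc)
  moreover have "rmult a (\<ee> I) = (- 1) ^ length I *s \<ee> (a # I)"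
    using assms by (simp add: rmult_def grade_basis wedge_simps basis_Cons iota_basis
        lin_scale[OF iota_fun_linear])
  moreover have "\<Theta> I *v \<ee> [] = \<ee> I"
    using is_theta_Theta[of I] by (simp add: is_theta_def)
  ultimately show "is_theta (\<ee> (a # I)) ((- 1) ^ length I *\<^sub>R (\<Gamma> a ** \<Theta> I))"
    by (cases "even (length I)")
      (simp_all add: is_theta_def matrix_mult_bilinear matrix_vector_bilinear Gamma_mult
        flip: matrix_vector_mul_assoc)
qed

lemma Theta_single: "\<Theta> [a] = \<Gamma> a"
  by (simp add: Theta_Cons Theta_Nil)

lemma Theta3:
  assumes "a \<noteq> b" "a \<noteq> c" "b \<noteq> c"
  shows "\<Theta> [a, b, c] = - (\<Gamma> a ** (\<Gamma> b ** \<Gamma> c))"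
  using assms by (simp add: Theta_Cons Theta_single matrix_mult_bilinear)

lemma Theta_zero: "\<ee> I = 0 \<Longrightarrow> \<Theta> I = 0"
  by (rule Theta_eqI) (simp add: is_theta_def matrix_mult_bilinear)

text \<open>The wedge product itself is zero here, and the zero operator represents the zero form.
  These cases arise because the sums in \<open>H\<close> run over all index values.\<close>

lemma Theta3_repeated:
  "\<Theta> [a, a, b] = 0" "\<Theta> [a, b, b] = 0" "\<Theta> [a, b, a] = 0"
proof -
  have 0: "u = 0" if "u = - u" for u :: form
    using that by (simp add: vec_eq_iff)
  have 1: "bas {a} \<and>\<^sub>e (bas {a} \<and>\<^sub>e v) = 0" for a v
    by (rule 0) (rule wedge_anticommute)
  show "\<Theta> [a, a, b] = 0" "\<Theta> [a, b, b] = 0"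
    by (rule Theta_zero, simp add: basis_Cons 1)+
  show "\<Theta> [a, b, a] = 0"
    by (rule Theta_zero)
      (simp add: basis_Cons wedge_anticommute[of b a] lin_neg[OF wedge_linear_right] 1)
qed

lemma J_eq: "\<J> = \<Gamma> 0 ** (\<Gamma> 1 ** (\<Gamma> 2 ** \<Gamma> 3))"
  by (simp add: \<J>_def Theta_Cons Theta_single matrix_mult_bilinear)

lemma Gamma_swap:
  "\<Gamma> 1 ** \<Gamma> 0 = - (\<Gamma> 0 ** \<Gamma> 1)" "\<Gamma> 2 ** \<Gamma> 0 = - (\<Gamma> 0 ** \<Gamma> 2)" "\<Gamma> 3 ** \<Gamma> 0 = - (\<Gamma> 0 ** \<Gamma> 3)"
  "\<Gamma> 2 ** \<Gamma> 1 = - (\<Gamma> 1 ** \<Gamma> 2)" "\<Gamma> 3 ** \<Gamma> 1 = - (\<Gamma> 1 ** \<Gamma> 3)" "\<Gamma> 3 ** \<Gamma> 2 = - (\<Gamma> 2 ** \<Gamma> 3)"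
  by (subst Gamma_anticommute, simp add: \<eta>_def)+

lemma Gamma_square: "\<Gamma> a ** \<Gamma> a = - \<eta> a a *\<^sub>R mat 1"
proof -
  have "\<Gamma> a ** \<Gamma> a + \<Gamma> a ** \<Gamma> a = \<Gamma> a ** \<Gamma> a + (- (\<Gamma> a ** \<Gamma> a) - (2 * \<eta> a a) *\<^sub>R mat 1)"
    by (rule arg_cong[OF Gamma_anticommute])
  then have "2 *\<^sub>R (\<Gamma> a ** \<Gamma> a) = 2 *\<^sub>R (- \<eta> a a *\<^sub>R mat 1)"
    by (simp add: scaleR_2)
  then show ?thesis unfolding real_vector.scale_cancel_left by simp
qed

text \<open>Rewrite rules that sort words in the \<open>\<Gamma> a\<close> by index and contract
  squares. The variants with a trailing factor act inside right-nested products.\<close>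

lemmas Gamma_normalize = Gamma_swap Gamma_square
  Gamma_swap[THEN arg_cong[where f = "\<lambda>A. A ** M" for M], folded matrix_mul_assoc]
  Gamma_square[THEN arg_cong[where f = "\<lambda>A. A ** M" for M], folded matrix_mul_assoc]

lemma idx_cases: "a = 0 \<or> a = 1 \<or> a = 2 \<or> a = 3" for a :: idx
  using exhaust_4[of a] by auto

lemma J_Gamma: "\<J> ** \<Gamma> a = - (\<Gamma> a ** \<J>)"
  using idx_cases[of a]
  by (auto simp: J_eq \<eta>_def Gamma_normalize matrix_mult_bilinear simp flip: matrix_mul_assoc)

text \<open>Reversing four anticommuting factors takes six transpositions and costs no sign; the
  squares are -1 for index 0 and +1 for the other three.\<close>

lemma J_square: "\<J> ** \<J> = - mat 1"
  by (simp add: J_eq Gamma_normalize matrix_mult_bilinear \<eta>_def flip: matrix_mul_assoc)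

section \<open>Traces of words in the generators\<close>

lemma trace_Gamma2: "trace (\<Gamma> a ** \<Gamma> b) = - 16 * of_real (\<eta> a b)"
proof -
  \<comment> \<open>The 16 is the trace of the identity on the exterior algebra, of dimension
    2^4.\<close>
  have "trace (\<Gamma> a ** \<Gamma> b) = - trace (\<Gamma> b ** \<Gamma> a) - 2 * of_real (\<eta> a b) * 16"
    by (subst Gamma_anticommute)
      (simp add: trace_sub trace_uminus trace_scaleR trace_I card_UNIV_set)
  then show ?thesis using trace_mul_sym[of "\<Gamma> b" "\<Gamma> a"] by simp
qed

text \<open>Three anticommutations move \<open>\<Gamma> a\<close> to the far right, each leaving a
  metric factor times a trace of two letters. Cyclicity identifies the resulting word with the
  original one, but with the opposite sign, so twice the trace is determined.\<close>

lemma trace_Gamma4: "trace (\<Gamma> a ** (\<Gamma> b ** (\<Gamma> c ** \<Gamma> d))) =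
  16 * of_real (\<eta> a b * \<eta> c d - \<eta> a c * \<eta> b d + \<eta> a d * \<eta> b c)"
proof -
  have *: "\<Gamma> a ** (\<Gamma> b ** M) = - (\<Gamma> b ** (\<Gamma> a ** M)) - (2 * \<eta> a b) *\<^sub>R M" for a b and M :: operator
    unfolding matrix_mul_assoc
    by (subst Gamma_anticommute) (simp add: matrix_mult_bilinear)
  have t: "trace (\<Gamma> a ** (\<Gamma> b ** M)) = - trace (\<Gamma> b ** (\<Gamma> a ** M)) - 2 * of_real (\<eta> a b) * trace M"
    for a b and M :: operator by (subst *) (simp add: trace_sub trace_uminus trace_scaleR)
  have "trace (\<Gamma> b ** (\<Gamma> a ** (\<Gamma> c ** \<Gamma> d)))
      = - trace (\<Gamma> b ** (\<Gamma> c ** (\<Gamma> a ** \<Gamma> d))) - 2 * of_real (\<eta> a c) * trace (\<Gamma> b ** \<Gamma> d)"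
    by (subst *[of a c]) (simp add: matrix_mult_bilinear trace_sub trace_uminus trace_scaleR)
  moreover have "trace (\<Gamma> b ** (\<Gamma> c ** (\<Gamma> a ** \<Gamma> d)))
      = - trace (\<Gamma> b ** (\<Gamma> c ** (\<Gamma> d ** \<Gamma> a))) - 2 * of_real (\<eta> a d) * trace (\<Gamma> b ** \<Gamma> c)"
    by (subst Gamma_anticommute[of a d]) (simp add: matrix_mult_bilinear trace_sub trace_uminus trace_scaleR)
  moreover have "trace (\<Gamma> b ** (\<Gamma> c ** (\<Gamma> d ** \<Gamma> a))) = trace (\<Gamma> a ** (\<Gamma> b ** (\<Gamma> c ** \<Gamma> d)))"
    by (subst trace_mul_sym[of "\<Gamma> a"]) (simp add: matrix_mul_assoc)
  moreover note t[of a b "\<Gamma> c ** \<Gamma> d"]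
  ultimately have "2 * trace (\<Gamma> a ** (\<Gamma> b ** (\<Gamma> c ** \<Gamma> d))) =
      2 * (16 * of_real (\<eta> a b * \<eta> c d - \<eta> a c * \<eta> b d + \<eta> a d * \<eta> b c))"
    unfolding trace_Gamma2 of_real_add of_real_diff of_real_mult by algebra
  then show ?thesis unfolding mult_cancel_left by simp
qed

text \<open>Two evaluations of the trace of \<open>\<J> ** A ** \<J>\<close>: cyclicity and
  \<open>J_square\<close> give minus the trace of A, anticommutation and \<open>J_square\<close>
  give plus the trace of A.\<close>

lemma trace_odd:
  assumes "\<J> ** A = - (A ** \<J>)"
  shows "trace A = 0"
proof -
  have "trace (\<J> ** A ** \<J>) = trace (\<J> ** (\<J> ** A))"
    by (rule trace_mul_sym)
  then have "trace (\<J> ** A ** \<J>) = - trace A"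
    by (simp add: matrix_mul_assoc J_square matrix_mult_bilinear trace_uminus)
  moreover have "\<J> ** A ** \<J> = A"
    by (simp add: assms matrix_mult_bilinear J_square flip: matrix_mul_assoc)
  ultimately show ?thesis by simp
qed

section \<open>The indefinite Hermitian form and adjoints with respect to it\<close>

definition pairing :: "form \<Rightarrow> form \<Rightarrow> complex" where
  "pairing u v = dag u (\<eta>_hat *v v)"

text \<open>Since \<open>\<eta>\<close> is diagonal, a nonzero Leibniz term forces the two lists to
  agree entry by entry after the permutation; for strictly increasing lists this means equal sets
  and the identity permutation. Thus \<open>\<eta>_hat\<close> is a diagonal matrix of
  signs.\<close>

lemma ext_metric_sorted:
  "ext_metric (sorted_list_of_set I) (sorted_list_of_set J) =
    (if I = J then (\<Prod>i\<in>I. \<eta> i i) else 0)" for I J :: "idx set"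
proof -
  let ?xs = "sorted_list_of_set I" and ?ys = "sorted_list_of_set J"
  have len: "length (sorted_list_of_set K) = card K" for K :: "idx set" by simp
  have eta: "\<eta> a b \<noteq> 0 \<longleftrightarrow> a = b" for a b by (simp add: \<eta>_def)
  have nz: "\<forall>i<card I. ?xs ! i = ?ys ! p i" if "(\<Prod>i<card I. \<eta> (?xs ! i) (?ys ! p i)) \<noteq> 0" for p
    using that eta unfolding prod_zero_iff[OF finite_lessThan] by blast
  show ?thesis
  proof (cases "I = J")
    case True
    have 0: "(\<Prod>i<card I. \<eta> (?xs ! i) (?xs ! p i)) = 0" if p: "p permutes {..<card I}" "p \<noteq> id" for p
    proof (rule ccontr)
      assume "(\<Prod>i<card I. \<eta> (?xs ! i) (?xs ! p i)) \<noteq> 0"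
      then have *: "\<forall>i<card I. ?xs ! i = ?xs ! p i" using nz[of p] unfolding True[symmetric] by blast
      have "p i = i" for i
      proof (cases "i < card I")
        case True
        then have "p i < card I" using permutes_in_image[OF p(1)] by simp
        moreover have "?xs ! i = ?xs ! p i" using * True by blast
        ultimately show ?thesis
          using True nth_eq_iff_index_eq[OF distinct_sorted_list_of_set[of I], of i "p i"] by simp
      next
        case False
        then show ?thesis using p(1) by (simp add: permutes_def)
      qed
      then show False using p(2) by auto
    qed
    have "ext_metric ?xs ?xs = (\<Sum>p\<in>{p. p permutes {..<card I}}.
        if p = id then \<Prod>i<card I. \<eta> (?xs ! i) (?xs ! i) else 0)"
      unfolding ext_metric_def by (simp only: len simp_thms if_False) (rule sum.cong, auto simp: 0 sign_id)
    also have "\<dots> = (\<Prod>i<card I. \<eta> (?xs ! i) (?xs ! i))"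
      by (subst sum.delta) (simp_all add: finite_permutations permutes_id)
    also have "\<dots> = (\<Prod>a\<in>I. \<eta> a a)"
      by (rule prod.reindex_bij_betw[OF bij_betw_nth]) auto
    finally show ?thesis using True by simp
  next
    case False
    have "(\<Prod>i<card I. \<eta> (?xs ! i) (?ys ! p i)) = 0" if c: "card I = card J" and p: "p permutes {..<card I}" for p
    proof (rule ccontr)
      assume "(\<Prod>i<card I. \<eta> (?xs ! i) (?ys ! p i)) \<noteq> 0"
      then have *: "\<forall>i<card I. ?xs ! i = ?ys ! p i" by (rule nz)
      have "I \<subseteq> J"
      proof
        fix a assume "a \<in> I"
        then have "a \<in> set ?xs" by simp
        then obtain i where i: "i < card I" "?xs ! i = a"
          unfolding in_set_conv_nth len by blast
        moreover have "p i < card J" using permutes_in_image[OF p] i(1) c by simp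
        moreover have "?xs ! i = ?ys ! p i" using * i(1) by blast
        ultimately show "a \<in> J" using nth_mem[of "p i" ?ys] by simp
      qed
      then show False using card_subset_eq[of J I] c False by simp
    qed
    then show ?thesis using False by (auto simp: ext_metric_def intro!: sum.neutral)
  qed
qed

lemma eta_hat_mult: "\<eta>_hat *v v = (\<chi> I. of_real (\<Prod>i\<in>I. \<eta> i i) * v $ I)"
  by (simp add: matrix_vector_mult_def \<eta>_hat_def ext_metric_sorted vec_eq_iff if_distrib if_distribR
      cong: if_cong)

lemma pairing_eq: "pairing u v = (\<Sum>I\<in>UNIV. cnj (u $ I) * of_real (\<Prod>i\<in>I. \<eta> i i) * v $ I)"
  by (simp add: pairing_def dag_def eta_hat_mult mult.assoc)

lemma pairing_simps:
  "pairing (u + u') v = pairing u v + pairing u' v" "pairing u (v + v') = pairing u v + pairing u v'"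
  "pairing (- u) v = - pairing u v" "pairing u (- v) = - pairing u v"
  "pairing (u - u') v = pairing u v - pairing u' v" "pairing u (v - v') = pairing u v - pairing u v'"
  "pairing (c *s u) v = cnj c * pairing u v" "pairing u (c *s v) = c * pairing u v"
  "pairing 0 v = 0" "pairing u 0 = 0"
  by (simp_all add: pairing_eq algebra_simps sum.distrib sum_subtractf sum_negf sum_distrib_left)

lemma pairing_cnj: "cnj (pairing u v) = pairing v u"
  by (simp add: pairing_eq algebra_simps)

lemma pairing_grade: "pairing (grade u) v = pairing u (grade v)"
  by (simp add: pairing_eq grade_def algebra_simps)

lemma wedge_single_nth:
  "(bas {a} \<and>\<^sub>e u) $ K = (if a \<in> K then wsign {a} (K - {a}) * u $ (K - {a}) else 0)"
proof -
  have "(bas {a} \<and>\<^sub>e u) $ K =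
      (\<Sum>I\<in>Pow K. if I = {a} then wsign {a} (K - {a}) * u $ (K - {a}) else 0)"
    unfolding wedge_def vec_lambda_beta by (rule sum.cong) (auto simp: axis_def)
  then show ?thesis by (simp add: sum.delta)
qed

text \<open>The weights of K and \<open>K - {a}\<close> in the form differ by
  \<open>\<eta> a a\<close>, which is the factor that \<open>iota_fun a\<close> puts in front of the
  contraction; the wedge signs on the two sides coincide.\<close>

lemma pairing_wedge: "pairing (bas {a} \<and>\<^sub>e u) v = pairing u (iota_fun a v)"
proof -
  have real: "cnj (wsign I J) = wsign I J" for I J
    by (simp add: wsign_def)
  have "pairing (bas {a} \<and>\<^sub>e u) v = (\<Sum>K | a \<in> K.
      wsign {a} (K - {a}) * cnj (u $ (K - {a})) * of_real (\<Prod>i\<in>K. \<eta> i i) * v $ K)"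
    unfolding pairing_eq wedge_single_nth
    by (rule sum.mono_neutral_cong_right) (auto simp: real)
  also have "\<dots> = (\<Sum>L | a \<notin> L.
      wsign {a} L * cnj (u $ L) * of_real (\<eta> a a * (\<Prod>i\<in>L. \<eta> i i)) * v $ insert a L)"
    by (rule sum.reindex_bij_witness[where i = "insert a" and j = "\<lambda>K. K - {a}"])
      (auto simp: insert_absorb prod.remove)
  also have "\<dots> = pairing u (iota_fun a v)"
    unfolding pairing_eq iota_fun_eq
    by (rule sum.mono_neutral_cong_left) (auto simp: contract_def)
  finally show ?thesis .
qed

lemma pairing_iota: "pairing (iota_fun a u) v = pairing u (bas {a} \<and>\<^sub>e v)"
  by (metis pairing_cnj pairing_wedge)

text \<open>A relation instead of an adjoint operation, so that adjoints of composite operators are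
  assembled by introduction rules.\<close>

definition adjoint_pair :: "operator \<Rightarrow> operator \<Rightarrow> bool" where
  "adjoint_pair A B \<longleftrightarrow> (\<forall>u v. pairing (A *v u) v = pairing u (B *v v))"

lemma adjoint_mult:
  "adjoint_pair A A' \<Longrightarrow> adjoint_pair B B' \<Longrightarrow> adjoint_pair (A ** B) (B' ** A')"
  by (simp add: adjoint_pair_def flip: matrix_vector_mul_assoc)

lemma adjoint_add:
  "adjoint_pair A A' \<Longrightarrow> adjoint_pair B B' \<Longrightarrow> adjoint_pair (A + B) (A' + B')"
  by (simp add: adjoint_pair_def pairing_simps matrix_vector_mult_add_rdistrib)

lemma adjoint_minus: "adjoint_pair A A' \<Longrightarrow> adjoint_pair (- A) (- A')"
  by (simp add: adjoint_pair_def pairing_simps matrix_vector_bilinear)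

lemma adjoint_scaleR: "adjoint_pair A A' \<Longrightarrow> adjoint_pair (r *\<^sub>R A) (r *\<^sub>R A')"
  by (simp add: adjoint_pair_def pairing_simps matrix_vector_bilinear)

lemma adjoint_zero: "adjoint_pair 0 0"
  by (simp add: adjoint_pair_def pairing_simps)

lemma adjoint_sum:
  "(\<And>x. adjoint_pair (F x) (G x)) \<Longrightarrow> adjoint_pair (sum F X) (sum G X)"
  by (induction X rule: infinite_finite_induct) (simp_all add: adjoint_zero adjoint_add)

lemma adjoint_mat: "adjoint_pair (mat c) (mat (cnj c))"
  by (simp add: adjoint_pair_def pairing_simps mat_mult)

lemma adjoint_gamma: "adjoint_pair (\<gamma> a) (- \<gamma> a)"
  by (simp add: adjoint_pair_def gamma_mult matrix_vector_bilinear pairing_simps pairing_wedge pairing_iota)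

text \<open>Wedge and contraction are exchanged and \<open>grade\<close> is self-adjoint, so the
  adjoint is \<open>grade\<close> applied after their sum; \<open>grade\<close> anticommutes with
  both, whence the sign.\<close>

lemma adjoint_Gamma: "adjoint_pair (\<Gamma> a) (- \<Gamma> a)"
  unfolding adjoint_pair_def Gamma_mult matrix_vector_bilinear
proof (intro allI)
  fix u v
  have "pairing (rmult a u) v = pairing u (grade (iota_fun a v + bas {a} \<and>\<^sub>e v))"
    by (simp add: rmult_def pairing_simps pairing_wedge pairing_iota pairing_grade lin_add[OF grade_linear])
  also have "grade (iota_fun a v + bas {a} \<and>\<^sub>e v) = - rmult a v"
    by (simp add: rmult_def lin_add[OF grade_linear] grade_wedge grade_iota)
  finally show "pairing (rmult a u) v = pairing u (- rmult a v)" .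
qed

lemma adjoint_J: "adjoint_pair \<J> \<J>"
proof -
  have "adjoint_pair \<J> (((- \<Gamma> 3 ** - \<Gamma> 2) ** - \<Gamma> 1) ** - \<Gamma> 0)"
    unfolding J_eq by (intro adjoint_mult adjoint_Gamma)
  also have "((- \<Gamma> 3 ** - \<Gamma> 2) ** - \<Gamma> 1) ** - \<Gamma> 0 = \<J>"
    by (simp add: J_eq Gamma_normalize matrix_mult_bilinear flip: matrix_mul_assoc)
  finally show ?thesis .
qed

lemma Theta3_cases:
  obtains "\<Theta> [a, b, c] = 0" | "a \<noteq> b" "a \<noteq> c" "b \<noteq> c" "\<Theta> [a, b, c] = - (\<Gamma> a ** (\<Gamma> b ** \<Gamma> c))"
  using Theta3 Theta3_repeated by metis

lemma Gamma_anticommute':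
  fixes M :: operator
  assumes "a \<noteq> b"
  shows "\<Gamma> a ** \<Gamma> b = - (\<Gamma> b ** \<Gamma> a)" "\<Gamma> a ** (\<Gamma> b ** M) = - (\<Gamma> b ** (\<Gamma> a ** M))"
proof -
  show *: "\<Gamma> a ** \<Gamma> b = - (\<Gamma> b ** \<Gamma> a)"
    using assms by (subst Gamma_anticommute) (simp add: \<eta>_def)
  show "\<Gamma> a ** (\<Gamma> b ** M) = - (\<Gamma> b ** (\<Gamma> a ** M))"
    unfolding matrix_mul_assoc * by (simp add: matrix_mult_bilinear)
qed

text \<open>The three minus signs of the factors cancel against the three transpositions that undo
  the reversal of their order.\<close>

lemma adjoint_Theta3: "adjoint_pair (\<Theta> [a, b, c]) (\<Theta> [a, b, c])"
proof (cases rule: Theta3_cases[of a b c])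
  case 1
  then show ?thesis by (simp add: adjoint_zero)
next
  case 2
  have "adjoint_pair (\<Theta> [a, b, c]) (- ((- \<Gamma> c ** - \<Gamma> b) ** - \<Gamma> a))"
    unfolding 2(4) by (intro adjoint_mult adjoint_Gamma adjoint_minus)
  also have "- ((- \<Gamma> c ** - \<Gamma> b) ** - \<Gamma> a) = \<Theta> [a, b, c]"
    using 2 by (simp add: matrix_mult_bilinear Gamma_anticommute'[of c b] Gamma_anticommute'[of c a]
        Gamma_anticommute'[of b a] flip: matrix_mul_assoc)
  finally show ?thesis .
qed

lemma J_Theta3: "\<J> ** \<Theta> [a, b, c] = - (\<Theta> [a, b, c] ** \<J>)"
proof (cases rule: Theta3_cases[of a b c])
  case 2
  have "\<J> ** (\<Gamma> a ** M) = - (\<Gamma> a ** (\<J> ** M))" for a and M :: operator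
    unfolding matrix_mul_assoc J_Gamma by (simp add: matrix_mult_bilinear)
  then show ?thesis
    by (simp add: 2(4) matrix_mult_bilinear J_Gamma flip: matrix_mul_assoc)
qed (simp add: matrix_mult_bilinear)

lemma Theta3_swap: "\<Theta> [a, c, b] = - \<Theta> [a, b, c]"
proof (cases rule: Theta3_cases[of a b c])
  case 2
  then show ?thesis
    by (simp add: Theta3 Gamma_anticommute'[of c b] matrix_mult_bilinear)
next
  case 1
  then show ?thesis
    by (cases "a = b \<or> a = c \<or> b = c")
      (auto simp: Theta3_repeated Theta3 Gamma_anticommute'[of c b] matrix_mult_bilinear)
qed

lemma S_eq: "\<S> \<zeta> = sin \<zeta> *\<^sub>R mat 1 + cos \<zeta> *\<^sub>R (mat \<i> ** \<J>)"
  by (simp add: \<S>_def mat_of_real mat_times_of_real matrix_mult_bilinear)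

lemma gamma_up_eq: "\<gamma>_up a = \<eta> a a *\<^sub>R \<gamma> a"
proof -
  have "\<gamma>_up a = (\<Sum>b\<in>UNIV. if b = a then \<eta> a a *\<^sub>R \<gamma> a else 0)"
    unfolding \<gamma>_up_def by (intro sum.cong) (auto simp: \<eta>_def)
  then show ?thesis by simp
qed

text \<open>\<open>\<S>\<close> turns into its conjugate when it is moved past the odd operator \<open>\<Theta> [n, a, b]\<close>, which
  makes the product anti-self-adjoint.\<close>

lemma adjoint_current:
  fixes \<zeta> n a b
  defines "M \<equiv> \<gamma>_up n ** \<S> \<zeta> ** \<Theta> [n, a, b]"
  shows "adjoint_pair M (- M)"
proof -
  let ?T = "\<Theta> [n, a, b]"
  have 1: "adjoint_pair (\<S> \<zeta>) (sin \<zeta> *\<^sub>R mat 1 + cos \<zeta> *\<^sub>R (\<J> ** mat (cnj \<i>)))"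
    unfolding S_eq using adjoint_mat[of 1]
    by (intro adjoint_add adjoint_scaleR adjoint_mult adjoint_J adjoint_mat) simp
  have "adjoint_pair M (?T ** ((sin \<zeta> *\<^sub>R mat 1 + cos \<zeta> *\<^sub>R (\<J> ** mat (cnj \<i>))) ** (\<eta> n n *\<^sub>R (- \<gamma> n))))"
    unfolding M_def gamma_up_eq
    by (intro adjoint_mult adjoint_scaleR 1 adjoint_Theta3 adjoint_gamma)
  also have "?T ** ((sin \<zeta> *\<^sub>R mat 1 + cos \<zeta> *\<^sub>R (\<J> ** mat (cnj \<i>))) ** (\<eta> n n *\<^sub>R (- \<gamma> n))) = - M"
  proof -
    have minus: "mat (- \<i>) = - (mat \<i> :: operator)" by (simp add: mat_def vec_eq_iff)
    have T: "?T ** (\<J> ** A) = - (\<J> ** (?T ** A))" for A :: operator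
      unfolding matrix_mul_assoc J_Theta3 by (simp add: matrix_mult_bilinear)
    have Ji: "\<J> ** (mat \<i> ** A) = mat \<i> ** (\<J> ** A)" for A :: operator
      unfolding matrix_mul_assoc mat_commute ..
    have g: "\<gamma> n ** (mat \<i> ** A) = mat \<i> ** (\<gamma> n ** A)" "\<gamma> n ** (\<J> ** A) = \<J> ** (\<gamma> n ** A)" for A :: operator
      unfolding matrix_mul_assoc mat_commute \<J>_def Theta_gamma_commute by simp_all
    have Ti: "?T ** (mat \<i> ** A) = mat \<i> ** (?T ** A)" for A :: operator
      unfolding matrix_mul_assoc mat_commute ..
    show ?thesis
      unfolding M_def gamma_up_eq S_eq
      by (simp add: matrix_mult_bilinear minus T Ji g Ti Theta_gamma_commute scaleR_add_right mult.commute[of "\<eta> n n"]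
        flip: matrix_mul_assoc)
  qed
  finally show ?thesis .
qed

lemma pairing_imaginary:
  assumes "adjoint_pair M (- M)"
  shows "\<i> * pairing u (M *v u) \<in> \<real>"
proof -
  have "cnj (pairing u (M *v u)) = - pairing u (M *v u)"
    using assms by (simp add: pairing_cnj adjoint_pair_def matrix_vector_bilinear pairing_simps)
  then have "Re (pairing u (M *v u)) = 0"
    by (simp add: complex_eq_iff)
  then show ?thesis by (simp add: complex_is_Real_iff)
qed

section \<open>The potential\<close>

text \<open>In the type \<open>4\<close> the numeral 4 denotes 0, so the general expansion
  \<open>sum_4\<close> only has to be reordered to start at index 0.\<close>

lemma sum_idx: "sum f (UNIV :: idx set) = f 0 + f 1 + f 2 + f 3"
  for f :: "idx \<Rightarrow> 'b::comm_monoid_add"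
proof -
  have "(4 :: idx) = 0" by simp
  then show ?thesis unfolding sum_4 by (simp only: ac_simps)
qed

definition Q :: "real \<Rightarrow> idx \<Rightarrow> operator" where
  "Q \<zeta> d = mat (- \<i>) ** \<S> \<zeta> ** \<J> ** \<Gamma> d"

lemma J_J_mult: "\<J> ** (\<J> ** A) = - A" for A :: operator
  unfolding matrix_mul_assoc J_square by (simp add: matrix_mult_bilinear)

lemma i_i_mult: "mat \<i> ** (mat \<i> ** A) = - A" for A :: operator
  by (rule operator_eqI)
    (simp add: mat_mult vector_smult_assoc matrix_vector_bilinear flip: matrix_vector_mul_assoc)

lemma Q_eq: "Q \<zeta> d = - (sin \<zeta> *\<^sub>R (mat \<i> ** (\<J> ** \<Gamma> d))) - cos \<zeta> *\<^sub>R \<Gamma> d"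
proof -
  have minus: "mat (- \<i>) = - (mat \<i> :: operator)" by (simp add: mat_def vec_eq_iff)
  show ?thesis
    unfolding Q_def S_eq minus by (simp add: matrix_mult_bilinear J_J_mult i_i_mult flip: matrix_mul_assoc)
qed

text \<open>Expanding by \<open>Q_eq\<close>, the two mixed terms cancel because
  \<open>\<Gamma> d\<close> anticommutes with \<open>\<J>\<close>; the pure terms carry the square
  of the cosine and minus the square of the sine.\<close>

lemma Q_mult: "Q \<zeta> d ** Q \<zeta> e = cos (2 * \<zeta>) *\<^sub>R (\<Gamma> d ** \<Gamma> e)"
proof -
  have ci: "\<J> ** (mat \<i> ** A) = mat \<i> ** (\<J> ** A)" "\<Gamma> d ** (mat \<i> ** A) = mat \<i> ** (\<Gamma> d ** A)"
    for A :: operator and d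
    unfolding matrix_mul_assoc mat_commute by simp_all
  have GJ: "\<Gamma> d ** (\<J> ** A) = - (\<J> ** (\<Gamma> d ** A))" for A :: operator
    unfolding matrix_mul_assoc J_Gamma by (simp add: matrix_mult_bilinear)
  show ?thesis
    unfolding Q_eq
    by (simp add: matrix_mult_bilinear J_J_mult i_i_mult ci GJ cos_double power2_eq_square scaleR_diff_left scaleR_diff_right
        scaleR_add_right mult.commute[of "sin \<zeta>" "cos \<zeta>"] flip: matrix_mul_assoc)
qed

lemma J_Q: "\<J> ** Q \<zeta> d = - (Q \<zeta> d ** \<J>)"
proof -
  have ci: "\<J> ** (mat \<i> ** A) = mat \<i> ** (\<J> ** A)" for A :: operator
    unfolding matrix_mul_assoc mat_commute by simp_all
  have JG: "\<J> ** (\<Gamma> d ** A) = - (\<Gamma> d ** (\<J> ** A))" for A :: operator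
    unfolding matrix_mul_assoc J_Gamma by (simp add: matrix_mult_bilinear)
  show ?thesis unfolding Q_eq
    by (simp add: matrix_mult_bilinear ci J_Gamma JG flip: matrix_mul_assoc)
qed

lemma trace_Q_Gamma2: "trace (Q \<zeta> d ** (\<Gamma> a ** \<Gamma> b)) = 0"
proof (rule trace_odd)
  have JG: "\<J> ** (\<Gamma> a ** A) = - (\<Gamma> a ** (\<J> ** A))" for a and A :: operator
    unfolding matrix_mul_assoc J_Gamma by (simp add: matrix_mult_bilinear)
  have JQ: "\<J> ** (Q \<zeta> d ** A) = - (Q \<zeta> d ** (\<J> ** A))" for A :: operator
    unfolding matrix_mul_assoc J_Q by (simp add: matrix_mult_bilinear)
  show "\<J> ** (Q \<zeta> d ** (\<Gamma> a ** \<Gamma> b)) = - (Q \<zeta> d ** (\<Gamma> a ** \<Gamma> b) ** \<J>)"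
    by (simp add: matrix_mult_bilinear JQ JG J_Gamma flip: matrix_mul_assoc)
qed

text \<open>The contraction of \<open>w \<rho> \<sigma>\<close> with \<open>\<epsilon> \<alpha> \<rho> \<sigma> \<delta> \<eta> \<delta> \<delta>\<close>; this is the matrix of coefficients
  in \<open>\<Theta> [\<alpha>, \<rho>, \<sigma>] = \<epsilon> \<alpha> \<rho> \<sigma> \<delta> \<eta> \<delta> \<delta> \<J> \<Gamma> \<delta>\<close>.\<close>

definition dual :: "(idx \<Rightarrow> idx \<Rightarrow> real) \<Rightarrow> idx \<Rightarrow> idx \<Rightarrow> real" where
  "dual w \<alpha> \<delta> =
    (if \<alpha> = 0 then if \<delta> = 0 then 0 else if \<delta> = 1 then - 2 * w 2 3 else if \<delta> = 2 then 2 * w 1 3 else - 2 * w 1 2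
     else if \<alpha> = 1 then if \<delta> = 0 then - 2 * w 2 3 else if \<delta> = 1 then 0 else if \<delta> = 2 then - 2 * w 0 3 else 2 * w 0 2
     else if \<alpha> = 2 then if \<delta> = 0 then 2 * w 1 3 else if \<delta> = 1 then 2 * w 0 3 else if \<delta> = 2 then 0 else - 2 * w 0 1
     else if \<delta> = 0 then - 2 * w 1 2 else if \<delta> = 1 then - 2 * w 0 2 else if \<delta> = 2 then 2 * w 0 1 else 0)"

lemma antisymmetric_components:
  fixes w :: "idx \<Rightarrow> idx \<Rightarrow> 'b::real_vector"
  assumes "\<And>\<alpha> \<beta>. w \<beta> \<alpha> = - w \<alpha> \<beta>"
  shows "w a a = 0" "w 1 0 = - w 0 1" "w 2 0 = - w 0 2" "w 3 0 = - w 0 3" "w 2 1 = - w 1 2"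
    "w 3 1 = - w 1 3" "w 3 2 = - w 2 3"
proof -
  have "w a a = - w a a" by (rule assms)
  then show "w a a = 0" by (simp add: eq_neg_iff_add_eq_0 flip: scaleR_2)
qed (rule assms)+

text \<open>A product of three distinct generators is, up to sign, \<open>\<J>\<close> times the
  missing fourth one. This turns contraction with three-index operators into one sum over the
  generators \<open>Q\<close>.\<close>

lemma H_eq:
  assumes "\<And>\<alpha> \<beta>. W \<beta> \<alpha> x = - W \<alpha> \<beta> x"
  shows "H \<zeta> W \<alpha> x = (\<Sum>\<delta>\<in>UNIV. dual (\<lambda>\<rho> \<sigma>. W \<rho> \<sigma> x) \<alpha> \<delta> *\<^sub>R Q \<zeta> \<delta>)"
proof -
  note W = antisymmetric_components[of "\<lambda>\<rho> \<sigma>. W \<rho> \<sigma> x", OF assms]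
  let ?E = "mat (- \<i>) ** \<S> \<zeta>"
  \<comment> \<open>By antisymmetry the pairs (rho, sigma) and (sigma, rho) contribute equally;
    splitting the factor 2 of \<open>dual\<close> matches these two summands.\<close>
  have double: "(2 * r) *\<^sub>R A = r *\<^sub>R A + r *\<^sub>R A" for r and A :: operator
    by (simp only: mult_2 scaleR_add_left)
  have Q: "?E ** (\<J> ** \<Gamma> d) = Q \<zeta> d" for d
    by (simp add: Q_def matrix_mul_assoc)
  have "H \<zeta> W \<alpha> x = ?E ** (\<Sum>\<rho>\<in>UNIV. \<Sum>\<sigma>\<in>UNIV. W \<rho> \<sigma> x *\<^sub>R \<Theta> [\<alpha>, \<rho>, \<sigma>])"
    unfolding H_def mat_times_of_real by (simp add: matrix_mult_bilinear matrix_mult_sum matrix_mul_assoc)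
  also have "(\<Sum>\<rho>\<in>UNIV. \<Sum>\<sigma>\<in>UNIV. W \<rho> \<sigma> x *\<^sub>R \<Theta> [\<alpha>, \<rho>, \<sigma>])
     = (\<Sum>\<delta>\<in>UNIV. dual (\<lambda>\<rho> \<sigma>. W \<rho> \<sigma> x) \<alpha> \<delta> *\<^sub>R (\<J> ** \<Gamma> \<delta>))"
    using idx_cases[of \<alpha>]
    by (elim disjE)
      (simp_all add: double sum_idx W Theta3_repeated Theta3 J_eq Gamma_normalize dual_def matrix_mult_bilinear \<eta>_def
        flip: matrix_mul_assoc)
  finally show ?thesis
    by (simp add: matrix_mult_bilinear matrix_mult_sum Q)
qed

section \<open>Partial derivatives and smooth functions\<close>

lemma pd_eqI:
  "((\<lambda>t. f (x + t *\<^sub>R axis \<alpha> 1)) has_vector_derivative d) (at 0) \<Longrightarrow> pd \<alpha> f x = d"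
  by (simp add: pd_def vector_derivative_at)

lemma line_has_vector_derivative:
  fixes f :: "spacetime \<Rightarrow> 'b::real_normed_vector"
  assumes "f differentiable (at (x + t *\<^sub>R axis \<alpha> 1))"
  shows "((\<lambda>t. f (x + t *\<^sub>R axis \<alpha> 1)) has_vector_derivative pd \<alpha> f (x + t *\<^sub>R axis \<alpha> 1)) (at t)"
proof -
  let ?e = "axis \<alpha> 1 :: spacetime"
  obtain f' where f': "(f has_derivative f') (at (x + t *\<^sub>R ?e))"
    using assms by (auto simp: differentiable_def)
  \<comment> \<open>The base point y and parameter s are left free because two parametrizations of
    the same line are needed: one with parameter 0, which identifies the partial derivative, and one
    with parameter t, which is the claim.\<close>
  have line: "((\<lambda>t. f (y + t *\<^sub>R ?e)) has_vector_derivative f' ?e) (at s)"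
    if "y + s *\<^sub>R ?e = x + t *\<^sub>R ?e" for y s
  proof -
    have "((\<lambda>t. y + t *\<^sub>R ?e) has_derivative (\<lambda>t. t *\<^sub>R ?e)) (at s)"
      by (auto intro!: derivative_eq_intros)
    moreover have "(f has_derivative f') (at (y + s *\<^sub>R ?e))" using f' that by simp
    ultimately have "((\<lambda>t. f (y + t *\<^sub>R ?e)) has_derivative (\<lambda>t. f' (t *\<^sub>R ?e))) (at s)"
      by (rule has_derivative_compose)
    moreover have "f' (t *\<^sub>R ?e) = t *\<^sub>R f' ?e" for t
      using f' by (simp add: linear_scale has_derivative_linear)
    ultimately show ?thesis by (simp add: has_vector_derivative_def)
  qed
  have "pd \<alpha> f (x + t *\<^sub>R ?e) = f' ?e"
    by (rule pd_eqI, rule line) simp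
  then show ?thesis using line[of x t] by simp
qed

lemma line_has_vector_derivative_0:
  fixes f :: "spacetime \<Rightarrow> 'b::real_normed_vector"
  assumes "f differentiable (at x)"
  shows "((\<lambda>t. f (x + t *\<^sub>R axis \<alpha> 1)) has_vector_derivative pd \<alpha> f x) (at 0)"
  using line_has_vector_derivative[of f x 0 \<alpha>] assms by simp

lemma pd_const: "pd \<alpha> (\<lambda>x. c) x = 0"
  by (rule pd_eqI) (rule has_vector_derivative_const)

lemma pd_add:
  assumes "f differentiable (at x)" "g differentiable (at x)"
  shows "pd \<alpha> (\<lambda>x. f x + g x) x = pd \<alpha> f x + pd \<alpha> g x"
  by (rule pd_eqI) (intro has_vector_derivative_add line_has_vector_derivative_0 assms)

lemma pd_sum:
  assumes "\<And>i. i \<in> I \<Longrightarrow> f i differentiable (at x)"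
  shows "pd \<alpha> (\<lambda>x. \<Sum>i\<in>I. f i x) x = (\<Sum>i\<in>I. pd \<alpha> (f i) x)"
  by (rule pd_eqI) (intro has_vector_derivative_sum line_has_vector_derivative_0 assms)

lemma pd_mult:
  fixes f g :: "spacetime \<Rightarrow> real"
  assumes "f differentiable (at x)" "g differentiable (at x)"
  shows "pd \<alpha> (\<lambda>x. f x * g x) x = pd \<alpha> f x * g x + f x * pd \<alpha> g x"
  by (rule pd_eqI)
    (use has_vector_derivative_mult[OF line_has_vector_derivative_0[OF assms(1)]
        line_has_vector_derivative_0[OF assms(2)]] in \<open>simp add: add.commute\<close>)

lemma pd_cmult:
  fixes f :: "spacetime \<Rightarrow> real"
  assumes "f differentiable (at x)"
  shows "pd \<alpha> (\<lambda>x. c * f x) x = c * pd \<alpha> f x"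
  using pd_mult[of "\<lambda>x. c" x f] assms by (simp add: pd_const)

lemma pd_scaleR_left:
  fixes f :: "spacetime \<Rightarrow> real"
  assumes "f differentiable (at x)"
  shows "pd \<alpha> (\<lambda>x. f x *\<^sub>R c) x = pd \<alpha> f x *\<^sub>R c"
  by (rule pd_eqI)
    (rule bounded_linear.has_vector_derivative[OF bounded_linear_scaleR_left line_has_vector_derivative_0[OF assms]])

lemma pd_eq_0:
  assumes "closed K" "\<And>x. x \<notin> K \<Longrightarrow> f x = 0" "x \<notin> K"
  shows "pd \<alpha> f x = 0"
proof (rule pd_eqI, rule has_vector_derivative_transform_within_open)
  let ?l = "\<lambda>t. x + t *\<^sub>R (axis \<alpha> 1 :: spacetime)"
  have "open (?l -` (- K))"
    by (rule open_vimage) (use assms(1) in \<open>auto intro!: continuous_intros\<close>)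
  then show "open (?l -` (- K))" .
  show "0 \<in> ?l -` (- K)" using assms(3) by simp
  show "((\<lambda>t. 0) has_vector_derivative 0) (at 0)" by (rule has_vector_derivative_const)
  show "0 = f (?l t)" if "t \<in> ?l -` (- K)" for t using that assms(2) by simp
qed

section \<open>Closure properties of smooth functions, and smooth bumps\<close>

lemma smooth_differentiable: "smooth f \<Longrightarrow> f differentiable (at x)"
  unfolding smooth_def by (metis foldr_Nil id_apply)

lemma smooth_pd: "smooth f \<Longrightarrow> smooth (pd \<alpha> f)"
  unfolding smooth_def using foldr_append[of pd _ "[\<alpha>]" f] by (metis foldr_Cons foldr_Nil o_apply id_apply)

lemma differentiable_imp_continuous_UNIV:
  "(\<And>x. f differentiable (at x)) \<Longrightarrow> continuous_on UNIV f"
  by (simp add: continuous_at_imp_continuous_on differentiable_imp_continuous_within)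

lemma smooth_continuous: "smooth f \<Longrightarrow> continuous_on A f"
  using differentiable_imp_continuous_UNIV smooth_differentiable continuous_on_subset subset_UNIV by metis

text \<open>Coinduction for smoothness: a class of differentiable functions that is stable under
  partial derivatives consists of smooth functions.\<close>

lemma smooth_coinduct:
  assumes "P f" and "\<And>f x. P f \<Longrightarrow> f differentiable (at x)" and "\<And>f \<alpha>. P f \<Longrightarrow> P (pd \<alpha> f)"
  shows "smooth f"
proof -
  have "P (foldr pd \<alpha>s f)" for \<alpha>s
    by (induction \<alpha>s) (use assms in auto)
  then show ?thesis using assms(2) by (auto simp: smooth_def)
qed

text \<open>The standard smooth function that is flat at 0, together with its quotients by powers of
  t. The family is needed because the derivative of a member is a combination of later
  members.\<close>

definition flat :: "nat \<Rightarrow> real \<Rightarrow> real" where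
  "flat n t = (if t > 0 then exp (- 1 / t) / t ^ n else 0)"

lemma flat_derivative:
  "(flat n has_real_derivative (flat (n + 2) t - real n * flat (n + 1) t)) (at t)"
proof -
  consider "t > 0" | "t < 0" | "t = 0" by linarith
  then show ?thesis
  proof cases
    case 1
    have "((\<lambda>t. exp (- 1 / t) / t ^ n) has_real_derivative (flat (n + 2) t - real n * flat (n + 1) t)) (at t)"
    proof (cases n)
      case 0
      then show ?thesis using 1
        by (auto intro!: derivative_eq_intros simp: flat_def power2_eq_square)
    next
      case (Suc m)
      have "((\<lambda>t. exp (- 1 / t)) has_real_derivative exp (- 1 / t) / t\<^sup>2) (at t)"
        using 1 by (auto intro!: derivative_eq_intros simp: power2_eq_square)
      moreover have "((\<lambda>t. t ^ Suc m) has_real_derivative real (Suc m) * t ^ m) (at t)"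
        using DERIV_pow[of "Suc m" t] by simp
      ultimately have "((\<lambda>t. exp (- 1 / t) / t ^ Suc m) has_real_derivative
          (exp (- 1 / t) / t\<^sup>2 * t ^ Suc m - exp (- 1 / t) * (real (Suc m) * t ^ m)) / (t ^ Suc m * t ^ Suc m)) (at t)"
        by (rule DERIV_divide) (use 1 in simp)
      also have "(exp (- 1 / t) / t\<^sup>2 * t ^ Suc m - exp (- 1 / t) * (real (Suc m) * t ^ m)) / (t ^ Suc m * t ^ Suc m)
          = flat (n + 2) t - real n * flat (n + 1) t"
        using 1 by (simp add: Suc flat_def field_simps power2_eq_square)
      finally show ?thesis unfolding Suc .
    qed
    then show ?thesis
      by (rule has_field_derivative_transform_within_open[where S = "{0<..}"]) (use 1 in \<open>auto simp: flat_def\<close>)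
  next
    case 2
    have "((\<lambda>t. 0) has_real_derivative (flat (n + 2) t - real n * flat (n + 1) t)) (at t)"
      using 2 by (simp add: flat_def)
    then show ?thesis
      by (rule has_field_derivative_transform_within_open[where S = "{..<0}"]) (use 2 in \<open>auto simp: flat_def\<close>)
  next
    case 3
    \<comment> \<open>With u = 1 / h this is the decay of u^(n+1) / exp u at infinity.\<close>
    have "((\<lambda>h::real. inverse h ^ Suc n / exp (inverse h)) \<longlongrightarrow> 0) (at_right 0)"
      by (rule filterlim_compose[OF tendsto_power_div_exp_0 filterlim_inverse_at_top_right])
    then have "(flat (Suc n) \<longlongrightarrow> 0) (at_right 0)"
      by (rule Lim_transform_eventually)
        (auto simp: eventually_at_filter flat_def exp_minus field_simps inverse_eq_divide)
    moreover have "(flat (Suc n) \<longlongrightarrow> 0) (at_left 0)"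
      by (rule Lim_transform_eventually[OF tendsto_const]) (auto simp: eventually_at_filter flat_def)
    ultimately have "(flat (Suc n) \<longlongrightarrow> 0) (at 0)"
      by (simp add: filterlim_split_at)
    \<comment> \<open>The difference quotient of a member at 0 is the next member, so the limit just
      proved is the derivative at 0.\<close>
    moreover have "flat (Suc n) = (\<lambda>h. (flat n (0 + h) - flat n 0) / h)"
      by (simp add: flat_def fun_eq_iff)
    ultimately have "(flat n has_real_derivative 0) (at 0)"
      unfolding DERIV_def by (simp only:)
    moreover have "flat k 0 = 0" for k by (simp add: flat_def)
    ultimately show ?thesis using 3 by simp
  qed
qed

text \<open>The class to which \<open>smooth_coinduct\<close> is applied. Sums and products are
  included together because the product rule leads from a product to a sum of products; starting
  from all smooth functions yields their closure under both operations.\<close>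

inductive smooth_closure :: "(spacetime \<Rightarrow> real) \<Rightarrow> bool" where
  sc_smooth: "smooth f \<Longrightarrow> smooth_closure f"
| sc_const: "smooth_closure (\<lambda>x. c)"
| sc_flat: "smooth_closure (\<lambda>x. flat n (c + s * x $ i))"
| sc_add: "smooth_closure f \<Longrightarrow> smooth_closure g \<Longrightarrow> smooth_closure (\<lambda>x. f x + g x)"
| sc_mult: "smooth_closure f \<Longrightarrow> smooth_closure g \<Longrightarrow> smooth_closure (\<lambda>x. f x * g x)"

lemma flat_coordinate_has_derivative:
  "((\<lambda>x :: spacetime. flat n (c + s * x $ i)) has_derivative
    (\<lambda>h. (flat (n + 2) (c + s * x $ i) - real n * flat (n + 1) (c + s * x $ i)) * (s * h $ i))) (at x)"
proof -
  have "((\<lambda>x :: spacetime. c + s * x $ i) has_derivative (\<lambda>h. s * h $ i)) (at x)"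
    by (auto intro!: derivative_eq_intros bounded_linear.has_derivative[OF bounded_linear_vec_nth])
  from has_derivative_compose[OF this flat_derivative[unfolded has_field_derivative_def]]
  show ?thesis .
qed

lemma smooth_closure_imp_smooth: "smooth_closure f \<Longrightarrow> smooth f"
proof (rule smooth_coinduct[of smooth_closure])
  show d: "f differentiable (at x)" if "smooth_closure f" for f x
    using that
  proof induction
    case (sc_flat n c s i)
    then show ?case using flat_coordinate_has_derivative differentiable_def by blast
  qed (auto intro: smooth_differentiable)
  show "smooth_closure (pd \<alpha> f)" if "smooth_closure f" for f \<alpha>
    using that
  proof induction
    case (sc_smooth f)
    then show ?case by (intro smooth_closure.intros smooth_pd)
  next
    case (sc_const c)
    have "pd \<alpha> (\<lambda>x. c) = (\<lambda>x. 0 :: real)" by (simp add: fun_eq_iff pd_const)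
    then show ?case by (simp add: smooth_closure.intros)
  next
    case (sc_flat n c s i)
    let ?k = "s * (axis \<alpha> 1 :: spacetime) $ i"
    have "pd \<alpha> (\<lambda>x. flat n (c + s * x $ i)) = (\<lambda>x. ?k * flat (n + 2) (c + s * x $ i)
        + (- ?k * real n) * flat (n + 1) (c + s * x $ i))"
    proof
      fix x
      have "((\<lambda>t. flat n (c + s * (x + t *\<^sub>R axis \<alpha> 1) $ i)) has_vector_derivative
          (flat (n + 2) (c + s * x $ i) - real n * flat (n + 1) (c + s * x $ i)) * ?k) (at 0)"
      proof -
        have "((\<lambda>t. c + s * (x + t *\<^sub>R (axis \<alpha> 1 :: spacetime)) $ i) has_real_derivative ?k) (at 0)"
          by (auto intro!: derivative_eq_intros)
        moreover have "(flat n has_real_derivative (flat (n + 2) (c + s * x $ i) - real n * flat (n + 1) (c + s * x $ i)))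
            (at (c + s * (x + 0 *\<^sub>R (axis \<alpha> 1 :: spacetime)) $ i))"
          using flat_derivative by simp
        ultimately have "((\<lambda>t. flat n (c + s * (x + t *\<^sub>R axis \<alpha> 1) $ i)) has_real_derivative
          (flat (n + 2) (c + s * x $ i) - real n * flat (n + 1) (c + s * x $ i)) * ?k) (at 0)"
          by (rule DERIV_chain2[rotated])
        then show ?thesis by (simp add: has_real_derivative_iff_has_vector_derivative)
      qed
      then show "pd \<alpha> (\<lambda>x. flat n (c + s * x $ i)) x = ?k * flat (n + 2) (c + s * x $ i)
        + (- ?k * real n) * flat (n + 1) (c + s * x $ i)"
        by (subst pd_eqI) (auto simp: algebra_simps)
    qed
    moreover have "smooth_closure (\<lambda>x. ?k * flat (n + 2) (c + s * x $ i)
        + (- ?k * real n) * flat (n + 1) (c + s * x $ i))"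
      by (intro smooth_closure.intros)
    ultimately show ?case by (simp only:)
  next
    case (sc_add f g)
    have "pd \<alpha> (\<lambda>x. f x + g x) = (\<lambda>x. pd \<alpha> f x + pd \<alpha> g x)"
      using d sc_add by (simp add: fun_eq_iff pd_add)
    then show ?case using sc_add by (simp add: smooth_closure.intros)
  next
    case (sc_mult f g)
    have "pd \<alpha> (\<lambda>x. f x * g x) = (\<lambda>x. pd \<alpha> f x * g x + f x * pd \<alpha> g x)"
      using d sc_mult by (simp add: fun_eq_iff pd_mult)
    then show ?case using sc_mult by (simp add: smooth_closure.intros)
  qed
qed

lemma smooth_const: "smooth (\<lambda>x. c :: real)"
  by (rule smooth_closure_imp_smooth[OF sc_const])

lemma smooth_add: "smooth f \<Longrightarrow> smooth g \<Longrightarrow> smooth (\<lambda>x. f x + g x :: real)"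
  by (rule smooth_closure_imp_smooth[OF sc_add[OF sc_smooth sc_smooth]])

lemma smooth_mult: "smooth f \<Longrightarrow> smooth g \<Longrightarrow> smooth (\<lambda>x. f x * g x :: real)"
  by (rule smooth_closure_imp_smooth[OF sc_mult[OF sc_smooth sc_smooth]])

lemma smooth_bump_exists:
  fixes a :: spacetime and \<epsilon> :: real
  obtains \<phi> :: "spacetime \<Rightarrow> real" where "smooth \<phi>" "\<And>x. \<phi> x \<ge> 0"
    "\<And>x. \<phi> x > 0 \<longleftrightarrow> (\<forall>i. \<bar>x $ i - a $ i\<bar> < \<epsilon>)"
proof -
  \<comment> \<open>Each coordinate gets two factors, positive exactly to the right of the left edge
    and to the left of the right edge of the cube. The coefficients \<open>1 *\<close> and
    \<open>(- 1) *\<close> keep the arguments in the shape required by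
    \<open>sc_flat\<close>.\<close>
  define \<phi> :: "spacetime \<Rightarrow> real" where
    "\<phi> x = (\<Prod>i\<in>UNIV. flat 0 ((\<epsilon> - a $ i) + 1 * x $ i) * flat 0 ((\<epsilon> + a $ i) + (- 1) * x $ i))" for x
  have "smooth_closure (\<lambda>x. \<Prod>i\<in>A. flat 0 ((\<epsilon> - a $ i) + 1 * x $ i) * flat 0 ((\<epsilon> + a $ i) + (- 1) * x $ i))"
    for A :: "idx set"
    using finite[of A]
  proof induction
    case empty
    show ?case unfolding prod.empty by (rule sc_const)
  next
    case (insert i A)
    show ?case unfolding prod.insert[OF insert.hyps]
      by (intro sc_mult sc_flat insert.IH)
  qed
  then have "smooth \<phi>"
    unfolding \<phi>_def by (rule smooth_closure_imp_smooth)
  moreover have "\<phi> x \<ge> 0" for x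
    unfolding \<phi>_def by (intro prod_nonneg) (simp add: flat_def)
  moreover have "\<phi> x > 0 \<longleftrightarrow> (\<forall>i. \<bar>x $ i - a $ i\<bar> < \<epsilon>)" for x
  proof -
    have "flat 0 ((\<epsilon> - a $ i) + 1 * x $ i) * flat 0 ((\<epsilon> + a $ i) + (- 1) * x $ i) \<noteq> 0
      \<longleftrightarrow> \<bar>x $ i - a $ i\<bar> < \<epsilon>" for i by (auto simp: flat_def abs_less_iff)
    then have "\<phi> x \<noteq> 0 \<longleftrightarrow> (\<forall>i. \<bar>x $ i - a $ i\<bar> < \<epsilon>)"
      unfolding \<phi>_def prod_zero_iff[OF finite] by blast
    then show ?thesis using \<open>\<phi> x \<ge> 0\<close> by (simp add: less_le)
  qed
  ultimately show ?thesis using that by blast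
qed

section \<open>Integrals of compactly supported functions\<close>

lemma integral_support:
  fixes f :: "'a::euclidean_space \<Rightarrow> 'b::banach"
  assumes "\<And>x. x \<notin> S \<Longrightarrow> f x = 0"
  shows "integral S f = integral UNIV f"
proof -
  have "(\<lambda>x. if x \<in> S then f x else 0) = f" using assms by auto
  then show ?thesis using integral_restrict_UNIV[of S f] by simp
qed

lemma integrable_support:
  fixes f :: "'a::euclidean_space \<Rightarrow> 'b::banach"
  assumes "continuous_on UNIV f" "compact K" "\<And>x. x \<notin> K \<Longrightarrow> f x = 0"
  shows "f integrable_on UNIV"
proof -
  obtain a where "K \<subseteq> cbox (- a) a"
    using bounded_subset_cbox_symmetric compact_imp_bounded[OF assms(2)] by metis
  moreover have "f integrable_on cbox (- a) a"
    using assms(1) by (intro integrable_continuous continuous_on_subset[OF assms(1)]) simp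
  ultimately show ?thesis
    using assms(3) by (intro integrable_on_superset[of f "cbox (- a) a" UNIV]) auto
qed

text \<open>Stationarity allows any compact region, not only boxes, so integrability is obtained
  from the Lebesgue integral.\<close>

lemma integrable_on_compact:
  fixes f :: "'a::euclidean_space \<Rightarrow> 'b::euclidean_space"
  assumes "continuous_on UNIV f" "compact K"
  shows "f integrable_on K"
  using set_borel_integral_eq_integral(1)[of K f] borel_integrable_compact[of K f]
    continuous_on_subset[OF assms(1)] assms(2)
  by (simp add: set_integrable_def)

text \<open>The integral of \<open>F (x + t e)\<close> does not depend on \<open>t\<close>; differentiate at \<open>t = 0\<close>.\<close>

lemma integral_pd_eq_0:
  fixes F :: "spacetime \<Rightarrow> real"
  assumes F: "\<And>x. F differentiable (at x)" "continuous_on UNIV (pd \<alpha> F)"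
    and K: "compact K" "\<And>x. x \<notin> K \<Longrightarrow> F x = 0"
  shows "integral UNIV (pd \<alpha> F) = 0"
proof -
  let ?e = "axis \<alpha> 1 :: spacetime"
  obtain r where r: "\<And>x. x \<in> K \<Longrightarrow> norm x \<le> r"
    using compact_imp_bounded[OF K(1)] by (auto simp: bounded_iff)
  \<comment> \<open>The margin 1 leaves room for every translate by \<open>t\<close> with absolute
    value at most 1, so the support stays inside one fixed box.\<close>
  obtain b where b: "cball (0 :: spacetime) (r + 1) \<subseteq> cbox (- b) b"
    using bounded_subset_cbox_symmetric bounded_cball by metis
  have inB: "x - t *\<^sub>R ?e \<in> cbox (- b) b" if "x \<in> K" "t \<in> {- 1..1}" for x t
  proof -
    have "norm (x - t *\<^sub>R ?e) \<le> norm x + \<bar>t\<bar>"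
      using norm_triangle_ineq4[of x "t *\<^sub>R ?e"] by (simp add: norm_axis_1)
    then show ?thesis using r[OF that(1)] that(2) b by auto
  qed
  have const: "integral (cbox (- b) b) (\<lambda>x. F (x + t *\<^sub>R ?e)) = integral UNIV F" if "t \<in> {- 1..1}" for t
  proof -
    have "integral (cbox (- b) b) (\<lambda>x. F (x + t *\<^sub>R ?e)) = integral (cbox (- b + t *\<^sub>R ?e) (b + t *\<^sub>R ?e)) F"
      using integral_shift_cbox[of "- b + t *\<^sub>R ?e" "t *\<^sub>R ?e" "b + t *\<^sub>R ?e" F] by simp
    also have "\<dots> = integral UNIV F"
    proof (rule integral_support, rule K(2))
      fix x assume x: "x \<notin> cbox (- b + t *\<^sub>R ?e) (b + t *\<^sub>R ?e)"
      show "x \<notin> K"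
      proof
        assume "x \<in> K"
        then have "x - t *\<^sub>R ?e \<in> cbox (- b) b" using inB that by blast
        then have "x \<in> cbox (- b + t *\<^sub>R ?e) (b + t *\<^sub>R ?e)"
          by (simp add: mem_box algebra_simps)
        with x show False by simp
      qed
    qed
    finally show ?thesis .
  qed
  have "((\<lambda>t. integral (cbox (- b) b) (\<lambda>x. F (x + t *\<^sub>R ?e))) has_vector_derivative
      integral (cbox (- b) b) (\<lambda>x. pd \<alpha> F (x + 0 *\<^sub>R ?e))) (at 0 within {- 1..1})"
  proof (rule leibniz_rule_vector_derivative)
    show "((\<lambda>t. F (x + t *\<^sub>R ?e)) has_vector_derivative pd \<alpha> F (x + t *\<^sub>R ?e)) (at t within {- 1..1})" for x t
      by (rule has_vector_derivative_at_within[OF line_has_vector_derivative[OF F(1)]])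
    show "(\<lambda>x. F (x + t *\<^sub>R ?e)) integrable_on cbox (- b) b" for t
      by (intro integrable_continuous continuous_on_compose2[OF differentiable_imp_continuous_UNIV[OF F(1)]])
        (auto intro!: continuous_intros)
    show "continuous_on ({- 1..1} \<times> cbox (- b) b) (\<lambda>(t, x). pd \<alpha> F (x + t *\<^sub>R ?e))"
      unfolding split_def
      by (intro continuous_on_compose2[OF F(2)]) (auto intro!: continuous_intros)
  qed auto
  then have der: "((\<lambda>t. integral (cbox (- b) b) (\<lambda>x. F (x + t *\<^sub>R ?e))) has_vector_derivative
      integral (cbox (- b) b) (pd \<alpha> F)) (at 0 within {- 1..1})" by simp
  have "((\<lambda>t. integral UNIV F) has_vector_derivative integral (cbox (- b) b) (pd \<alpha> F)) (at (0 :: real) within {- 1..1})"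
    by (rule has_vector_derivative_transform[OF _ _ der]) (use const in auto)
  moreover have "((\<lambda>t. integral UNIV F) has_vector_derivative 0) (at (0 :: real) within {- 1..1})"
    by (rule has_vector_derivative_const)
  ultimately have "integral (cbox (- b) b) (pd \<alpha> F) = 0"
    by (intro vector_derivative_unique_within_closed_interval[of "-1" 1 0 "\<lambda>t. integral UNIV F"]) simp_all
  moreover have "integral (cbox (- b) b) (pd \<alpha> F) = integral UNIV (pd \<alpha> F)"
  proof (rule integral_support, rule pd_eq_0)
    show "closed K" using K(1) by (rule compact_imp_closed)
    show "x \<notin> K" if "x \<notin> cbox (- b) b" for x using that inB[of x 0] by auto
  qed (rule K(2))
  ultimately show ?thesis by simp
qed

lemma integral_by_parts:
  fixes f g :: "spacetime \<Rightarrow> real"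
  assumes f: "smooth f" and g: "smooth g" and K: "compact K" "\<And>x. x \<notin> K \<Longrightarrow> f x = 0"
  shows "integral UNIV (\<lambda>x. pd \<alpha> f x * g x) = - integral UNIV (\<lambda>x. f x * pd \<alpha> g x)"
proof -
  have eq: "pd \<alpha> (\<lambda>x. f x * g x) = (\<lambda>x. pd \<alpha> f x * g x + f x * pd \<alpha> g x)"
    using f g by (simp add: fun_eq_iff pd_mult smooth_differentiable)
  have cont: "continuous_on UNIV (\<lambda>x. pd \<alpha> f x * g x)" "continuous_on UNIV (\<lambda>x. f x * pd \<alpha> g x)"
    by (intro continuous_on_mult smooth_continuous smooth_pd f g)+
  have "integral UNIV (pd \<alpha> (\<lambda>x. f x * g x)) = 0"
    by (rule integral_pd_eq_0[OF _ _ K(1)])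
      (use K(2) in \<open>auto intro!: smooth_differentiable smooth_continuous smooth_pd smooth_mult f g\<close>)
  moreover have "integral UNIV (pd \<alpha> (\<lambda>x. f x * g x)) =
      integral UNIV (\<lambda>x. pd \<alpha> f x * g x) + integral UNIV (\<lambda>x. f x * pd \<alpha> g x)"
    unfolding eq
    using pd_eq_0[OF compact_imp_closed[OF K(1)] K(2)] K(2)
    by (intro integral_add integrable_support[OF _ K(1)] cont) auto
  ultimately show ?thesis by simp
qed

text \<open>The integral over K is split into a constant and the integral of
  \<open>G t x - G 0 x\<close>. The latter vanishes off K, so it may be taken over a box, where
  differentiation under the integral is available.\<close>

lemma variation_derivative:
  fixes G G' :: "real \<Rightarrow> 'a::euclidean_space \<Rightarrow> 'b::euclidean_space"
  assumes deriv: "\<And>t x. ((\<lambda>t. G t x) has_vector_derivative G' t x) (at t)"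
    and cont: "\<And>t. continuous_on UNIV (G t)" "continuous_on UNIV (\<lambda>(t, x). G' t x)"
    and K: "compact K" "\<And>t x. x \<notin> K \<Longrightarrow> G t x = G 0 x"
  shows "((\<lambda>t. integral K (G t)) has_vector_derivative integral UNIV (G' 0)) (at 0)"
proof -
  obtain b where b: "K \<subseteq> cbox (- b) b"
    using bounded_subset_cbox_symmetric compact_imp_bounded[OF K(1)] by metis
  have eq: "integral K (G t) = integral K (G 0) + integral (cbox (- b) b) (\<lambda>x. G t x - G 0 x)" for t
  proof -
    have "integral (cbox (- b) b) (\<lambda>x. G t x - G 0 x) = integral K (\<lambda>x. G t x - G 0 x)"
      using integral_support[of K "\<lambda>x. G t x - G 0 x"] integral_support[of "cbox (- b) b" "\<lambda>x. G t x - G 0 x"]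
        K(2) b by (metis eq_iff_diff_eq_0 subsetD)
    also have "\<dots> = integral K (G t) - integral K (G 0)"
      by (intro integral_diff integrable_on_compact cont(1) K(1))
    finally show ?thesis by simp
  qed
  have "((\<lambda>t. integral (cbox (- b) b) (\<lambda>x. G t x - G 0 x)) has_vector_derivative
      integral (cbox (- b) b) (G' 0)) (at 0 within UNIV)"
  proof (rule leibniz_rule_vector_derivative)
    show "((\<lambda>t. G t x - G 0 x) has_vector_derivative G' t x) (at t within UNIV)" for x t
      using has_vector_derivative_diff[OF deriv has_vector_derivative_const] by simp
    show "(\<lambda>x. G t x - G 0 x) integrable_on cbox (- b) b" for t
      by (intro integrable_continuous continuous_on_diff continuous_on_subset[OF cont(1)]) auto
    show "continuous_on (UNIV \<times> cbox (- b) b) (\<lambda>(t, x). G' t x)"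
      by (rule continuous_on_subset[OF cont(2)]) simp
  qed auto
  moreover have "integral (cbox (- b) b) (G' 0) = integral UNIV (G' 0)"
  proof (rule integral_support)
    fix x assume "x \<notin> cbox (- b) b"
    then have "(\<lambda>t. G t x) = (\<lambda>t. G 0 x)" using b K(2) by blast
    then show "G' 0 x = 0"
      using deriv[of x 0] has_vector_derivative_const vector_derivative_unique_at by metis
  qed
  ultimately have "((\<lambda>t. integral K (G 0) + integral (cbox (- b) b) (\<lambda>x. G t x - G 0 x)) has_vector_derivative
      0 + integral UNIV (G' 0)) (at 0)"
    by (intro has_vector_derivative_add has_vector_derivative_const) simp
  then show ?thesis by (simp add: eq[symmetric])
qed

lemma nonneg_integral_0_imp_0:
  fixes f :: "spacetime \<Rightarrow> real"
  assumes "continuous_on UNIV f" "\<And>x. f x \<ge> 0" "compact K" "\<And>x. x \<notin> K \<Longrightarrow> f x = 0"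
    and "integral UNIV f = 0"
  shows "f x = 0"
proof -
  obtain b where b: "insert x K \<subseteq> cbox (- b) b"
    using bounded_subset_cbox_symmetric compact_imp_bounded[OF compact_insert[OF assms(3)]] by metis
  \<comment> \<open>Enlarging the box by \<open>One\<close> gives it nonempty interior; only then
    does a zero integral of a nonnegative continuous function force the function to vanish on
    it.\<close>
  let ?B = "cbox (- b - One) (b + One)"
  have sub: "cbox (- b) b \<subseteq> box (- b - One) (b + One)"
  proof
    fix y assume "y \<in> cbox (- b) b"
    then have "- b \<bullet> i - 1 < y \<bullet> i \<and> y \<bullet> i < b \<bullet> i + 1" if "i \<in> Basis" for i
      using that by (fastforce simp: mem_box)
    then show "y \<in> box (- b - One) (b + One)"
      by (simp add: mem_box inner_diff_left inner_add_left)
  qed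
  then have ne: "box (- b - One) (b + One) \<noteq> {}" using b by blast
  have inB: "y \<in> ?B" if "y \<in> insert x K" for y
    using b sub box_subset_cbox[of "- b - One" "b + One"] that by blast
  have "integral ?B f = integral UNIV f"
    by (rule integral_support) (use assms(4) inB in blast)
  then have "integral ?B f = 0" using assms(5) by simp
  with ne have "\<forall>x\<in>?B. f x = 0"
    using integral_cbox_eq_0_iff[of "- b - One" "b + One" f] continuous_on_subset[OF assms(1)] assms(2) by simp
  then show ?thesis using inB by blast
qed

section \<open>The Lagrangian of the potential\<close>

text \<open>The metric is diagonal, so every contraction with it collapses to a sign. This replaces
  all raised and lowered indices by factors \<open>\<eta> \<alpha> \<alpha>\<close> in what
  follows.\<close>

lemma eta_sum_mult: "(\<Sum>\<mu>\<in>UNIV. \<eta> \<alpha> \<mu> * f \<mu>) = \<eta> \<alpha> \<alpha> * f \<alpha>"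
proof -
  have "(\<Sum>\<mu>\<in>UNIV. \<eta> \<alpha> \<mu> * f \<mu>) = (\<Sum>\<mu>\<in>UNIV. if \<mu> = \<alpha> then \<eta> \<alpha> \<alpha> * f \<alpha> else 0)"
    by (rule sum.cong) (auto simp: \<eta>_def)
  then show ?thesis by simp
qed

lemma eta_sum_scaleR:
  fixes f :: "idx \<Rightarrow> 'b::real_vector"
  shows "(\<Sum>\<mu>\<in>UNIV. \<eta> \<alpha> \<mu> *\<^sub>R f \<mu>) = \<eta> \<alpha> \<alpha> *\<^sub>R f \<alpha>"
proof -
  have "(\<Sum>\<mu>\<in>UNIV. \<eta> \<alpha> \<mu> *\<^sub>R f \<mu>) = (\<Sum>\<mu>\<in>UNIV. if \<mu> = \<alpha> then \<eta> \<alpha> \<alpha> *\<^sub>R f \<alpha> else 0)"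
    by (rule sum.cong) (auto simp: \<eta>_def)
  then show ?thesis by simp
qed

lemma eta_sym: "\<eta> \<alpha> \<beta> = \<eta> \<beta> \<alpha>"
  by (simp add: \<eta>_def)

lemma lower_eq: "lower T \<alpha> \<beta> x = \<eta> \<alpha> \<alpha> * \<eta> \<beta> \<beta> * T \<alpha> \<beta> x"
  by (simp add: lower_def mult.assoc eta_sum_mult flip: sum_distrib_left)

lemma pd_up_eq: "pd_up \<alpha> f x = \<eta> \<alpha> \<alpha> *\<^sub>R pd \<alpha> f x"
  by (simp add: pd_up_def eta_sum_scaleR)

lemma pd_lower:
  assumes "smooth (T \<alpha> \<beta>)"
  shows "pd \<mu> (lower T \<alpha> \<beta>) x = \<eta> \<alpha> \<alpha> * \<eta> \<beta> \<beta> * pd \<mu> (T \<alpha> \<beta>) x"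
proof -
  have "lower T \<alpha> \<beta> = (\<lambda>x. (\<eta> \<alpha> \<alpha> * \<eta> \<beta> \<beta>) * T \<alpha> \<beta> x)"
    by (simp add: fun_eq_iff lower_eq)
  then show ?thesis
    using pd_cmult[OF smooth_differentiable[OF assms]] by simp
qed

lemma smooth_dual:
  assumes "\<And>\<rho> \<sigma>. smooth (W \<rho> \<sigma>)"
  shows "smooth (\<lambda>x. dual (\<lambda>\<rho> \<sigma>. W \<rho> \<sigma> x) \<alpha> \<delta>)"
proof -
  have 1: "smooth (\<lambda>x. c * W \<rho> \<sigma> x)" for c \<rho> \<sigma> by (intro smooth_mult smooth_const assms)
  have 2: "smooth (\<lambda>x. - (c * W \<rho> \<sigma> x))" for c \<rho> \<sigma> using 1[of "- c"] by simp
  show ?thesis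
    using idx_cases[of \<alpha>] idx_cases[of \<delta>]
    by (elim disjE) (simp_all add: dual_def 1 2 smooth_const)
qed

lemma pd_dual:
  assumes "\<And>\<rho> \<sigma>. smooth (W \<rho> \<sigma>)"
  shows "pd \<mu> (\<lambda>x. dual (\<lambda>\<rho> \<sigma>. W \<rho> \<sigma> x) \<alpha> \<delta>) x = dual (\<lambda>\<rho> \<sigma>. pd \<mu> (W \<rho> \<sigma>) x) \<alpha> \<delta>"
proof -
  have 1: "pd \<mu> (\<lambda>x. c * W \<rho> \<sigma> x) x = c * pd \<mu> (W \<rho> \<sigma>) x" for c \<rho> \<sigma>
    by (intro pd_cmult smooth_differentiable assms)
  have 2: "pd \<mu> (\<lambda>x. - (c * W \<rho> \<sigma> x)) x = - (c * pd \<mu> (W \<rho> \<sigma>) x)" for c \<rho> \<sigma>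
    using 1[of "- c"] by simp
  show ?thesis
    using idx_cases[of \<alpha>] idx_cases[of \<delta>]
    by (elim disjE) (simp_all add: dual_def 1 2 pd_const)
qed

lemma smooth_antisymmetricD:
  assumes "smooth_antisymmetric W"
  shows "smooth (W \<alpha> \<beta>)" "W \<beta> \<alpha> x = - W \<alpha> \<beta> x"
  using assms unfolding smooth_antisymmetric_def by blast+

lemma pd_antisymmetric:
  assumes "smooth_antisymmetric W"
  shows "pd \<mu> (W \<beta> \<alpha>) x = - pd \<mu> (W \<alpha> \<beta>) x"
proof -
  have "W \<beta> \<alpha> = (\<lambda>x. (- 1) * W \<alpha> \<beta> x)"
    using smooth_antisymmetricD(2)[OF assms, of \<beta> \<alpha>] by (simp only: mult_minus1 fun_eq_iff) blast
  then show ?thesis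
    using pd_cmult[of "W \<alpha> \<beta>" x \<mu> "- 1"] smooth_differentiable[OF smooth_antisymmetricD(1)[OF assms]]
    by simp
qed

text \<open>The splitting by parity under \<open>\<J>\<close>: the potential is odd and its
  derivatives stay in the span of the \<open>Q\<close>, whereas \<open>Q_mult\<close> turns products
  of two potentials into even words.\<close>

lemma curvature_H:
  fixes W \<zeta> x
  defines "A \<equiv> dual (\<lambda>\<rho> \<sigma>. W \<rho> \<sigma> x)"
    and "F \<equiv> \<lambda>\<alpha> \<beta> \<delta>. dual (\<lambda>\<rho> \<sigma>. pd \<alpha> (W \<rho> \<sigma>) x) \<beta> \<delta> - dual (\<lambda>\<rho> \<sigma>. pd \<beta> (W \<rho> \<sigma>) x) \<alpha> \<delta>"
  assumes W: "smooth_antisymmetric W"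
  shows "curvature (H \<zeta> W) \<alpha> \<beta> x = (\<Sum>\<delta>\<in>UNIV. F \<alpha> \<beta> \<delta> *\<^sub>R Q \<zeta> \<delta>)
    + (\<Sum>\<delta>\<in>UNIV. \<Sum>\<epsilon>\<in>UNIV. (cos (2 * \<zeta>) * A \<alpha> \<delta> * A \<beta> \<epsilon>) *\<^sub>R (\<Gamma> \<delta> ** \<Gamma> \<epsilon> - \<Gamma> \<epsilon> ** \<Gamma> \<delta>))"
proof -
  have s: "smooth (W \<rho> \<sigma>)" for \<rho> \<sigma> by (rule smooth_antisymmetricD(1)[OF W])
  have H: "H \<zeta> W \<alpha> = (\<lambda>x. \<Sum>\<delta>\<in>UNIV. dual (\<lambda>\<rho> \<sigma>. W \<rho> \<sigma> x) \<alpha> \<delta> *\<^sub>R Q \<zeta> \<delta>)" for \<alpha>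
    by (rule ext) (rule H_eq[of W, OF smooth_antisymmetricD(2)[OF W]])
  have d: "(\<lambda>x. dual (\<lambda>\<rho> \<sigma>. W \<rho> \<sigma> x) \<alpha> \<delta>) differentiable (at x)" for \<alpha> \<delta>
    by (intro smooth_differentiable smooth_dual s)
  have "pd \<alpha> (H \<zeta> W \<beta>) x = (\<Sum>\<delta>\<in>UNIV. dual (\<lambda>\<rho> \<sigma>. pd \<alpha> (W \<rho> \<sigma>) x) \<beta> \<delta> *\<^sub>R Q \<zeta> \<delta>)" for \<alpha> \<beta>
  proof -
    have "(\<lambda>x. dual (\<lambda>\<rho> \<sigma>. W \<rho> \<sigma> x) \<beta> \<delta> *\<^sub>R Q \<zeta> \<delta>) differentiable (at x)" for \<delta>
      using d[of \<beta> \<delta>] unfolding differentiable_def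
      by (elim exE) (rule exI, erule bounded_linear.has_derivative[OF bounded_linear_scaleR_left])
    then show ?thesis
      unfolding H by (subst pd_sum) (simp_all add: pd_scaleR_left d pd_dual s)
  qed
  then have "pd \<alpha> (H \<zeta> W \<beta>) x - pd \<beta> (H \<zeta> W \<alpha>) x = (\<Sum>\<delta>\<in>UNIV. F \<alpha> \<beta> \<delta> *\<^sub>R Q \<zeta> \<delta>)"
    by (simp add: F_def scaleR_diff_left sum_subtractf)
  moreover have HH: "H \<zeta> W \<alpha> x ** H \<zeta> W \<beta> x =
      (\<Sum>\<delta>\<in>UNIV. \<Sum>\<epsilon>\<in>UNIV. (cos (2 * \<zeta>) * A \<alpha> \<delta> * A \<beta> \<epsilon>) *\<^sub>R (\<Gamma> \<delta> ** \<Gamma> \<epsilon>))" for \<alpha> \<beta>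
    unfolding H A_def
    by (simp add: matrix_mult_sum matrix_mult_bilinear Q_mult scaleR_sum_right mult_ac) (rule sum.swap)
  moreover have "(\<Sum>\<delta>\<in>UNIV. \<Sum>\<epsilon>\<in>UNIV. (cos (2 * \<zeta>) * A \<beta> \<delta> * A \<alpha> \<epsilon>) *\<^sub>R (\<Gamma> \<delta> ** \<Gamma> \<epsilon>)) =
      (\<Sum>\<delta>\<in>UNIV. \<Sum>\<epsilon>\<in>UNIV. (cos (2 * \<zeta>) * A \<alpha> \<delta> * A \<beta> \<epsilon>) *\<^sub>R (\<Gamma> \<epsilon> ** \<Gamma> \<delta>))"
    by (subst sum.swap) (simp add: mult_ac)
  ultimately show ?thesis
    by (simp add: curvature_def scaleR_diff_right sum_subtractf)
qed

text \<open>Among the four words of the expansion the terms with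
  \<open>\<eta> a b * \<eta> c d\<close> cancel, while the other two kinds add up four times; hence
  64 = 4 * 16.\<close>

lemma trace_commutators:
  "trace ((\<Gamma> a ** \<Gamma> b - \<Gamma> b ** \<Gamma> a) ** (\<Gamma> c ** \<Gamma> d - \<Gamma> d ** \<Gamma> c)) =
    of_real (64 * (\<eta> a d * \<eta> b c - \<eta> a c * \<eta> b d))"
  by (simp add: matrix_mult_bilinear trace_sub trace_add trace_Gamma4 eta_sym[of b a] eta_sym[of d c] algebra_simps
      flip: matrix_mul_assoc)

text \<open>The cross terms are traces of odd operators and vanish. The commutator part yields minus
  the Gram determinant of g and h, since the trace of two commutators is an antisymmetrized product
  of metrics.\<close>

lemma trace_curvature_square:
  fixes f g h :: "idx \<Rightarrow> real" and c \<zeta> :: real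
  defines "X \<equiv> (\<Sum>\<delta>\<in>UNIV. f \<delta> *\<^sub>R Q \<zeta> \<delta>)
    + (\<Sum>\<delta>\<in>UNIV. \<Sum>\<epsilon>\<in>UNIV. (c * g \<delta> * h \<epsilon>) *\<^sub>R (\<Gamma> \<delta> ** \<Gamma> \<epsilon> - \<Gamma> \<epsilon> ** \<Gamma> \<delta>))"
  shows "trace (X ** X) = of_real (- 16 * cos (2 * \<zeta>) * (\<Sum>\<delta>\<in>UNIV. \<eta> \<delta> \<delta> * (f \<delta>)\<^sup>2)
    + 64 * c\<^sup>2 * ((\<Sum>\<delta>\<in>UNIV. \<eta> \<delta> \<delta> * g \<delta> * h \<delta>)\<^sup>2 -
        (\<Sum>\<delta>\<in>UNIV. \<eta> \<delta> \<delta> * (g \<delta>)\<^sup>2) * (\<Sum>\<delta>\<in>UNIV. \<eta> \<delta> \<delta> * (h \<delta>)\<^sup>2)))"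
proof -
  let ?C = "\<lambda>\<delta> \<epsilon>. \<Gamma> \<delta> ** \<Gamma> \<epsilon> - \<Gamma> \<epsilon> ** \<Gamma> \<delta>"
  define Y where "Y = (\<Sum>\<delta>\<in>UNIV. f \<delta> *\<^sub>R Q \<zeta> \<delta>)"
  define Z where "Z = (\<Sum>\<delta>\<in>UNIV. \<Sum>\<epsilon>\<in>UNIV. (c * g \<delta> * h \<epsilon>) *\<^sub>R ?C \<delta> \<epsilon>)"
  have "trace (Q \<zeta> d ** Q \<zeta> e) = of_real (- 16 * cos (2 * \<zeta>) * \<eta> d e)" for d e
    by (simp add: Q_mult trace_scaleR trace_Gamma2)
  then have "trace (Y ** Y) = (\<Sum>d\<in>UNIV. \<Sum>e\<in>UNIV. of_real (f d) * (of_real (f e) * of_real (- 16 * cos (2 * \<zeta>) * \<eta> d e)))"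
    unfolding Y_def by (simp add: matrix_mult_sum matrix_mult_bilinear trace_sum trace_scaleR sum_distrib_left del: of_real_mult of_real_minus)
       (subst sum.swap, simp add: eta_sym mult_ac)
  also have "\<dots> = of_real (\<Sum>d\<in>UNIV. - 16 * cos (2 * \<zeta>) * f d * (\<Sum>e\<in>UNIV. \<eta> d e * f e))"
    by (simp add: sum_distrib_left sum_negf mult_ac)
  also have "\<dots> = of_real (- 16 * cos (2 * \<zeta>) * (\<Sum>\<delta>\<in>UNIV. \<eta> \<delta> \<delta> * (f \<delta>)\<^sup>2))"
    by (simp only: eta_sum_mult) (simp add: sum_distrib_left sum_negf power2_eq_square mult_ac)
  finally have YY: "trace (Y ** Y) = \<dots>" .
  have "trace (Q \<zeta> e ** ?C a b) = 0" for e a b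
    by (simp add: matrix_mult_bilinear trace_sub trace_Q_Gamma2)
  then have YZ: "trace (Y ** Z) = 0"
    unfolding Y_def Z_def by (simp add: matrix_mult_sum matrix_mult_bilinear(7,8) trace_sum trace_scaleR)
  have "trace (Z ** Z) = (\<Sum>a\<in>UNIV. \<Sum>b\<in>UNIV. \<Sum>d\<in>UNIV. \<Sum>e\<in>UNIV.
      of_real (c * g a * h b) * (of_real (c * g d * h e) * trace (?C a b ** ?C d e)))"
    unfolding Z_def
    by (simp only: matrix_mult_sum matrix_mult_bilinear(7,8) trace_sum trace_scaleR sum_distrib_left)
      (intro sum.cong refl arg_cong2[where f = "(*)"] trace_mul_sym)
  also have "\<dots> = of_real (\<Sum>a\<in>UNIV. \<Sum>b\<in>UNIV. \<Sum>d\<in>UNIV. \<Sum>e\<in>UNIV.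
      64 * c\<^sup>2 * (\<eta> b d * (\<eta> a e * (g a * h b * g d * h e)) - \<eta> a d * (\<eta> b e * (g a * h b * g d * h e))))"
    unfolding trace_commutators of_real_sum
    by (intro sum.cong refl) (simp add: power2_eq_square algebra_simps)
  also have "(\<Sum>a\<in>UNIV. \<Sum>b\<in>UNIV. \<Sum>d\<in>UNIV. \<Sum>e\<in>UNIV.
      64 * c\<^sup>2 * (\<eta> b d * (\<eta> a e * (g a * h b * g d * h e)) - \<eta> a d * (\<eta> b e * (g a * h b * g d * h e))))
    = (\<Sum>a\<in>UNIV. \<Sum>b\<in>UNIV. 64 * c\<^sup>2 * (\<eta> b b * (\<eta> a a * (g a * h b * g b * h a)) - \<eta> a a * (\<eta> b b * (g a * h b * g a * h b))))"
  proof -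
    have "(\<Sum>d\<in>UNIV. \<Sum>e\<in>UNIV. \<eta> b d * (\<eta> a e * k d e)) = \<eta> b b * (\<eta> a a * k b a)" for a b k
      by (simp only: eta_sum_mult flip: sum_distrib_left)
    then show ?thesis by (simp only: sum_subtractf flip: sum_distrib_left)
  qed
  also have "\<dots> = 64 * c\<^sup>2 * ((\<Sum>\<delta>\<in>UNIV. \<eta> \<delta> \<delta> * g \<delta> * h \<delta>)\<^sup>2 -
        (\<Sum>\<delta>\<in>UNIV. \<eta> \<delta> \<delta> * (g \<delta>)\<^sup>2) * (\<Sum>\<delta>\<in>UNIV. \<eta> \<delta> \<delta> * (h \<delta>)\<^sup>2))"
    unfolding power2_eq_square sum_product
    by (simp add: right_diff_distrib sum_distrib_left sum_subtractf mult_ac)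
  finally have ZZ: "trace (Z ** Z) = of_real \<dots>" .
  have "X = Y + Z" by (simp add: X_def Y_def Z_def)
  then have "trace (X ** X) = trace (Y ** Y) + trace (Y ** Z) + (trace (Z ** Y) + trace (Z ** Z))"
    by (simp add: matrix_mult_bilinear trace_add)
  moreover have "trace (Z ** Y) = 0" using YZ trace_mul_sym[of Z Y] by simp
  ultimately show ?thesis using YY YZ ZZ by simp
qed

section \<open>The Lagrangian as a polynomial in W and its derivatives\<close>

definition quartic :: "(idx \<Rightarrow> idx \<Rightarrow> real) \<Rightarrow> real" where
  "quartic w = (\<Sum>\<alpha>\<in>UNIV. \<Sum>\<beta>\<in>UNIV. \<Sum>\<rho>\<in>UNIV. \<Sum>\<sigma>\<in>UNIV.
      w \<alpha> \<beta> * (\<eta> \<beta> \<beta> * \<eta> \<rho> \<rho> * w \<beta> \<rho>) * w \<rho> \<sigma> * (\<eta> \<sigma> \<sigma> * \<eta> \<alpha> \<alpha> * w \<sigma> \<alpha>))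
    - (\<Sum>\<alpha>\<in>UNIV. \<Sum>\<beta>\<in>UNIV. w \<alpha> \<beta> * (\<eta> \<alpha> \<alpha> * \<eta> \<beta> \<beta> * w \<alpha> \<beta>))\<^sup>2"

definition kinetic :: "(idx \<Rightarrow> idx \<Rightarrow> idx \<Rightarrow> real) \<Rightarrow> real" where
  "kinetic d = (\<Sum>\<alpha>\<in>UNIV. \<Sum>\<rho>\<in>UNIV. \<Sum>\<sigma>\<in>UNIV. \<eta> \<alpha> \<alpha> * \<eta> \<rho> \<rho> * \<eta> \<sigma> \<sigma> * (d \<alpha> \<rho> \<sigma>)\<^sup>2)
    + 2 * (\<Sum>\<alpha>\<in>UNIV. \<eta> \<alpha> \<alpha> * (\<Sum>\<beta>\<in>UNIV. d \<beta> \<alpha> \<beta>)\<^sup>2)"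

text \<open>Expressed by the two Lorentz invariants of an antisymmetric tensor: the Pfaffian in the
  first square and half the full contraction of w with itself in the second.\<close>

lemma quartic_components:
  assumes "\<And>\<alpha> \<beta>. w \<beta> \<alpha> = - w \<alpha> \<beta>"
  shows "quartic w = 4 * (w 0 1 * w 2 3 - w 0 2 * w 1 3 + w 0 3 * w 1 2)\<^sup>2
    - 2 * ((w 1 2)\<^sup>2 + (w 1 3)\<^sup>2 + (w 2 3)\<^sup>2 - (w 0 1)\<^sup>2 - (w 0 2)\<^sup>2 - (w 0 3)\<^sup>2)\<^sup>2"
  unfolding quartic_def
  by (simp add: sum_idx antisymmetric_components[of w, OF assms] \<eta>_def) algebra

text \<open>The left side sums negated Gram determinants of pairs of rows of the dual; its four
  factors of 2 make up the 16. After expansion this is a polynomial identity in six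
  variables.\<close>

lemma quartic_dual:
  assumes "\<And>\<alpha> \<beta>. w \<beta> \<alpha> = - w \<alpha> \<beta>"
  shows "(\<Sum>\<alpha>\<in>UNIV. \<Sum>\<beta>\<in>UNIV. \<eta> \<alpha> \<alpha> * \<eta> \<beta> \<beta> * ((\<Sum>\<delta>\<in>UNIV. \<eta> \<delta> \<delta> * dual w \<alpha> \<delta> * dual w \<beta> \<delta>)\<^sup>2 -
        (\<Sum>\<delta>\<in>UNIV. \<eta> \<delta> \<delta> * (dual w \<alpha> \<delta>)\<^sup>2) * (\<Sum>\<delta>\<in>UNIV. \<eta> \<delta> \<delta> * (dual w \<beta> \<delta>)\<^sup>2)))
    = 16 * quartic w"
  unfolding quartic_components[OF assms]
  by (simp add: sum_idx antisymmetric_components[of w, OF assms] \<eta>_def dual_def) algebra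

text \<open>Pointwise in an arbitrary array d, so no integration by parts is hidden here. The 4 is
  the square of the factor 2 in \<open>dual\<close>, and the minus sign reflects the Lorentzian
  signature in the contraction of two epsilon symbols.\<close>

lemma kinetic_dual:
  assumes "\<And>\<mu> \<alpha> \<beta>. d \<mu> \<beta> \<alpha> = - d \<mu> \<alpha> \<beta>"
  shows "(\<Sum>\<alpha>\<in>UNIV. \<Sum>\<beta>\<in>UNIV. \<eta> \<alpha> \<alpha> * \<eta> \<beta> \<beta> * (\<Sum>\<delta>\<in>UNIV. \<eta> \<delta> \<delta> * (dual (d \<alpha>) \<beta> \<delta> - dual (d \<beta>) \<alpha> \<delta>)\<^sup>2))
    = - 4 * kinetic d"
  unfolding kinetic_def
  by (simp add: sum_idx antisymmetric_components[of "d \<mu>" for \<mu>, OF assms] \<eta>_def dual_def) algebra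

lemma L_V_eq:
  assumes W: "smooth_antisymmetric W"
  shows "L\<^sub>V (H \<zeta> W) x = of_real (1024 * (cos (2 * \<zeta>))\<^sup>2 * quartic (\<lambda>\<rho> \<sigma>. W \<rho> \<sigma> x)
    + 64 * cos (2 * \<zeta>) * kinetic (\<lambda>\<mu> \<rho> \<sigma>. pd \<mu> (W \<rho> \<sigma>) x))"
proof -
  let ?c = "cos (2 * \<zeta>)"
  define A where "A = dual (\<lambda>\<rho> \<sigma>. W \<rho> \<sigma> x)"
  define d where "d = (\<lambda>\<mu> \<rho> \<sigma>. pd \<mu> (W \<rho> \<sigma>) x)"
  let ?\<Omega> = "\<lambda>\<alpha> \<beta>. curvature (H \<zeta> W) \<alpha> \<beta> x"
  have "trace (\<Sum>\<alpha>\<in>UNIV. \<Sum>\<beta>\<in>UNIV. \<Sum>\<mu>\<in>UNIV. \<Sum>\<nu>\<in>UNIV. (\<eta> \<alpha> \<mu> * \<eta> \<beta> \<nu>) *\<^sub>R (?\<Omega> \<alpha> \<beta> ** ?\<Omega> \<mu> \<nu>))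
     = trace (\<Sum>\<alpha>\<in>UNIV. \<Sum>\<beta>\<in>UNIV. (\<eta> \<alpha> \<alpha> * \<eta> \<beta> \<beta>) *\<^sub>R (?\<Omega> \<alpha> \<beta> ** ?\<Omega> \<alpha> \<beta>))"
    by (simp only: scaleR_scaleR[symmetric] eta_sum_scaleR flip: scaleR_sum_right)
  also have "\<dots> = of_real (\<Sum>\<alpha>\<in>UNIV. \<Sum>\<beta>\<in>UNIV. \<eta> \<alpha> \<alpha> * \<eta> \<beta> \<beta> *
     (- 16 * ?c * (\<Sum>\<delta>\<in>UNIV. \<eta> \<delta> \<delta> * (dual (d \<alpha>) \<beta> \<delta> - dual (d \<beta>) \<alpha> \<delta>)\<^sup>2)
    + 64 * ?c\<^sup>2 * ((\<Sum>\<delta>\<in>UNIV. \<eta> \<delta> \<delta> * A \<alpha> \<delta> * A \<beta> \<delta>)\<^sup>2 -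
        (\<Sum>\<delta>\<in>UNIV. \<eta> \<delta> \<delta> * (A \<alpha> \<delta>)\<^sup>2) * (\<Sum>\<delta>\<in>UNIV. \<eta> \<delta> \<delta> * (A \<beta> \<delta>)\<^sup>2))))"
    unfolding trace_sum trace_scaleR curvature_H[OF W] trace_curvature_square of_real_sum
    by (simp only: of_real_mult A_def d_def)
  also have "\<dots> = of_real (- 16 * ?c * (- 4 * kinetic d) + 64 * ?c\<^sup>2 * (16 * quartic (\<lambda>\<rho> \<sigma>. W \<rho> \<sigma> x)))"
  proof -
    have *: "(\<Sum>\<alpha>\<in>UNIV. \<Sum>\<beta>\<in>UNIV. e \<alpha> \<beta> * (a * k \<alpha> \<beta> + b * l \<alpha> \<beta>)) =
        a * (\<Sum>\<alpha>\<in>UNIV. \<Sum>\<beta>\<in>UNIV. e \<alpha> \<beta> * k \<alpha> \<beta>) + b * (\<Sum>\<alpha>\<in>UNIV. \<Sum>\<beta>\<in>UNIV. e \<alpha> \<beta> * l \<alpha> \<beta>)"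
      for a b :: real and e k l :: "idx \<Rightarrow> idx \<Rightarrow> real"
      by (simp add: sum.distrib sum_distrib_left distrib_left mult_ac)
    have "d \<mu> \<beta> \<alpha> = - d \<mu> \<alpha> \<beta>" for \<mu> \<alpha> \<beta>
      unfolding d_def by (rule pd_antisymmetric[OF W])
    note k = kinetic_dual[of d, OF this]
      and q = quartic_dual[of "\<lambda>\<rho> \<sigma>. W \<rho> \<sigma> x", OF smooth_antisymmetricD(2)[OF W], folded A_def]
    show ?thesis unfolding * k q ..
  qed
  \<comment> \<open>The trace is real, so adding the complex conjugate cancels the factor
    1/2.\<close>
  finally show ?thesis
    unfolding L\<^sub>V_def by (simp add: plus_cc_def d_def)
qed

section \<open>The first variation\<close>

text \<open>Twice the symmetric bilinear form that polarizes \<open>kinetic\<close>, hence its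
  derivative at d in the direction e.\<close>

definition dkinetic :: "(idx \<Rightarrow> idx \<Rightarrow> idx \<Rightarrow> real) \<Rightarrow> (idx \<Rightarrow> idx \<Rightarrow> idx \<Rightarrow> real) \<Rightarrow> real" where
  "dkinetic d e = 2 * (\<Sum>\<alpha>\<in>UNIV. \<Sum>\<rho>\<in>UNIV. \<Sum>\<sigma>\<in>UNIV. \<eta> \<alpha> \<alpha> * \<eta> \<rho> \<rho> * \<eta> \<sigma> \<sigma> * d \<alpha> \<rho> \<sigma> * e \<alpha> \<rho> \<sigma>)
    + 4 * (\<Sum>\<alpha>\<in>UNIV. \<eta> \<alpha> \<alpha> * (\<Sum>\<beta>\<in>UNIV. d \<beta> \<alpha> \<beta>) * (\<Sum>\<beta>\<in>UNIV. e \<beta> \<alpha> \<beta>))"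

definition cubic :: "(idx \<Rightarrow> idx \<Rightarrow> real) \<Rightarrow> idx \<Rightarrow> idx \<Rightarrow> real" where
  "cubic w \<alpha> \<beta> =
    (\<Sum>\<rho>\<in>UNIV. \<Sum>\<sigma>\<in>UNIV. (\<eta> \<alpha> \<alpha> * \<eta> \<rho> \<rho> * w \<alpha> \<rho>) * w \<rho> \<sigma> * (\<eta> \<sigma> \<sigma> * \<eta> \<beta> \<beta> * w \<sigma> \<beta>))
    + (\<Sum>\<rho>\<in>UNIV. \<Sum>\<sigma>\<in>UNIV. w \<rho> \<sigma> * (\<eta> \<rho> \<rho> * \<eta> \<sigma> \<sigma> * w \<rho> \<sigma>)) * (\<eta> \<alpha> \<alpha> * \<eta> \<beta> \<beta> * w \<alpha> \<beta>)"

lemma kinetic_derivative: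
  "((\<lambda>t. kinetic (\<lambda>\<mu> \<rho> \<sigma>. d \<mu> \<rho> \<sigma> + t * e \<mu> \<rho> \<sigma>)) has_real_derivative
    dkinetic (\<lambda>\<mu> \<rho> \<sigma>. d \<mu> \<rho> \<sigma> + t * e \<mu> \<rho> \<sigma>) e) (at t)"
  unfolding kinetic_def dkinetic_def
  by (auto intro!: derivative_eq_intros sum.cong simp: sum_distrib_left mult_ac)

text \<open>The four factors of the cyclic contraction contribute equally, with the cubic expression
  in exchanged indices, so antisymmetry gives -4; the squared contraction gives -4 directly. The
  common factor makes \<open>cubic\<close> the gradient.\<close>

lemma quartic_derivative:
  assumes w: "\<And>\<alpha> \<beta>. w \<beta> \<alpha> = - w \<alpha> \<beta>" and v: "\<And>\<alpha> \<beta>. v \<beta> \<alpha> = - v \<alpha> \<beta>"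
  shows "((\<lambda>t. quartic (\<lambda>\<rho> \<sigma>. w \<rho> \<sigma> + t * v \<rho> \<sigma>)) has_real_derivative
    - 4 * (\<Sum>\<alpha>\<in>UNIV. \<Sum>\<beta>\<in>UNIV. v \<alpha> \<beta> * cubic (\<lambda>\<rho> \<sigma>. w \<rho> \<sigma> + t * v \<rho> \<sigma>) \<alpha> \<beta>)) (at t)"
proof -
  define u where "u t = (\<lambda>\<rho> \<sigma>. w \<rho> \<sigma> + t * v \<rho> \<sigma>)" for t
  have u: "u t \<beta> \<alpha> = - u t \<alpha> \<beta>" for t \<alpha> \<beta>
    unfolding u_def w[of \<beta> \<alpha>] v[of \<beta> \<alpha>] by simp
  have du: "((\<lambda>t. u t \<alpha> \<beta>) has_real_derivative v \<alpha> \<beta>) (at t)" for \<alpha> \<beta>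
    unfolding u_def by (auto intro!: derivative_eq_intros)
  have "((\<lambda>t. quartic (u t)) has_real_derivative
     8 * (u t 0 1 * u t 2 3 - u t 0 2 * u t 1 3 + u t 0 3 * u t 1 2) *
         (v 0 1 * u t 2 3 + u t 0 1 * v 2 3 - v 0 2 * u t 1 3 - u t 0 2 * v 1 3 + v 0 3 * u t 1 2 + u t 0 3 * v 1 2)
    - 8 * ((u t 1 2)\<^sup>2 + (u t 1 3)\<^sup>2 + (u t 2 3)\<^sup>2 - (u t 0 1)\<^sup>2 - (u t 0 2)\<^sup>2 - (u t 0 3)\<^sup>2) *
         (u t 1 2 * v 1 2 + u t 1 3 * v 1 3 + u t 2 3 * v 2 3 - u t 0 1 * v 0 1 - u t 0 2 * v 0 2 - u t 0 3 * v 0 3)) (at t)"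
    unfolding quartic_components[of "u t" for t, OF u]
    by (auto intro!: derivative_eq_intros du) algebra
  also have "8 * (u t 0 1 * u t 2 3 - u t 0 2 * u t 1 3 + u t 0 3 * u t 1 2) *
         (v 0 1 * u t 2 3 + u t 0 1 * v 2 3 - v 0 2 * u t 1 3 - u t 0 2 * v 1 3 + v 0 3 * u t 1 2 + u t 0 3 * v 1 2)
    - 8 * ((u t 1 2)\<^sup>2 + (u t 1 3)\<^sup>2 + (u t 2 3)\<^sup>2 - (u t 0 1)\<^sup>2 - (u t 0 2)\<^sup>2 - (u t 0 3)\<^sup>2) *
         (u t 1 2 * v 1 2 + u t 1 3 * v 1 3 + u t 2 3 * v 2 3 - u t 0 1 * v 0 1 - u t 0 2 * v 0 2 - u t 0 3 * v 0 3)
    = - 4 * (\<Sum>\<alpha>\<in>UNIV. \<Sum>\<beta>\<in>UNIV. v \<alpha> \<beta> * cubic (u t) \<alpha> \<beta>)"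
    unfolding cubic_def
    by (simp add: sum_idx antisymmetric_components[of "u t", OF u] antisymmetric_components[of v, OF v] \<eta>_def)
      algebra
  finally show ?thesis unfolding u_def .
qed

section \<open>The coupling to \<open>\<psi>\<close>\<close>

definition current :: "real \<Rightarrow> (spacetime \<Rightarrow> form) \<Rightarrow> idx \<Rightarrow> idx \<Rightarrow> spacetime \<Rightarrow> real" where
  "current \<zeta> \<psi> \<alpha> \<beta> x = Re (\<i> * pairing (\<psi> x) ((\<Sum>\<nu>\<in>UNIV. \<gamma>_up \<nu> ** \<S> \<zeta> ** \<Theta> [\<nu>, \<alpha>, \<beta>]) *v \<psi> x))"

text \<open>The real part in \<open>current\<close> loses nothing: the operator is anti-self-adjoint
  for the form, so its expectation is imaginary. This lets the variational problem be treated over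
  the reals.\<close>

lemma of_real_current:
  "of_real (current \<zeta> \<psi> \<alpha> \<beta> x) = \<i> * pairing (\<psi> x) ((\<Sum>\<nu>\<in>UNIV. \<gamma>_up \<nu> ** \<S> \<zeta> ** \<Theta> [\<nu>, \<alpha>, \<beta>]) *v \<psi> x)"
proof -
  let ?M = "\<Sum>\<nu>\<in>UNIV. \<gamma>_up \<nu> ** \<S> \<zeta> ** \<Theta> [\<nu>, \<alpha>, \<beta>]"
  have "adjoint_pair ?M (- ?M)"
    using adjoint_sum[OF adjoint_current] by (simp add: sum_negf)
  from pairing_imaginary[OF this] show ?thesis
    unfolding current_def by (rule of_real_Re)
qed

lemma current_antisymmetric: "current \<zeta> \<psi> \<beta> \<alpha> x = - current \<zeta> \<psi> \<alpha> \<beta> x"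
proof -
  have "(\<Sum>\<nu>\<in>UNIV. \<gamma>_up \<nu> ** \<S> \<zeta> ** \<Theta> [\<nu>, \<beta>, \<alpha>]) = - (\<Sum>\<nu>\<in>UNIV. \<gamma>_up \<nu> ** \<S> \<zeta> ** \<Theta> [\<nu>, \<alpha>, \<beta>])"
    by (simp add: Theta3_swap[of _ \<beta> \<alpha>] matrix_mult_bilinear sum_negf)
  then show ?thesis
    by (simp add: current_def matrix_vector_bilinear pairing_simps)
qed

text \<open>The potential enters \<open>dirac\<close> linearly and without derivatives. All
  dependence of \<open>L\<^sub>K\<close> on W is therefore one contraction with the current; the
  minus sign comes from the factor -i in \<open>H\<close>.\<close>

lemma L_K_eq:
  "L\<^sub>K m \<psi> (H \<zeta> W) x = L\<^sub>K m \<psi> (\<lambda>\<alpha> x. 0) x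
    - of_real (\<Sum>\<rho>\<in>UNIV. \<Sum>\<sigma>\<in>UNIV. W \<rho> \<sigma> x * current \<zeta> \<psi> \<rho> \<sigma> x)"
proof -
  let ?M = "\<lambda>\<rho> \<sigma>. \<Sum>\<nu>\<in>UNIV. \<gamma>_up \<nu> ** \<S> \<zeta> ** \<Theta> [\<nu>, \<rho>, \<sigma>]"
  have mi: "\<gamma>_up \<alpha> ** (mat (- \<i>) ** A) = mat (- \<i>) ** (\<gamma>_up \<alpha> ** A)" for \<alpha> and A :: operator
    unfolding matrix_mul_assoc mat_commute ..
  have "(\<Sum>\<alpha>\<in>UNIV. \<gamma>_up \<alpha> ** H \<zeta> W \<alpha> x) = (\<Sum>\<alpha>\<in>UNIV. \<Sum>\<rho>\<in>UNIV. \<Sum>\<sigma>\<in>UNIV.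
      W \<rho> \<sigma> x *\<^sub>R (mat (- \<i>) ** (\<gamma>_up \<alpha> ** \<S> \<zeta> ** \<Theta> [\<alpha>, \<rho>, \<sigma>])))"
    unfolding H_def mat_times_of_real
    by (simp add: matrix_mult_bilinear matrix_mult_sum mi flip: matrix_mul_assoc)
  also have "\<dots> = (\<Sum>\<rho>\<in>UNIV. \<Sum>\<alpha>\<in>UNIV. \<Sum>\<sigma>\<in>UNIV.
      W \<rho> \<sigma> x *\<^sub>R (mat (- \<i>) ** (\<gamma>_up \<alpha> ** \<S> \<zeta> ** \<Theta> [\<alpha>, \<rho>, \<sigma>])))"
    by (rule sum.swap)
  also have "\<dots> = (\<Sum>\<rho>\<in>UNIV. \<Sum>\<sigma>\<in>UNIV. W \<rho> \<sigma> x *\<^sub>R (mat (- \<i>) ** ?M \<rho> \<sigma>))"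
    unfolding matrix_mult_sum scaleR_sum_right by (intro sum.cong refl sum.swap)
  finally have 1: "(\<Sum>\<alpha>\<in>UNIV. \<gamma>_up \<alpha> ** H \<zeta> W \<alpha> x) = \<dots>" .
  have mv_sum: "sum F X *v v = (\<Sum>i\<in>X. F i *v v)" for F :: "idx \<Rightarrow> operator" and X and v :: form
    by (induction X rule: infinite_finite_induct) (simp_all add: matrix_vector_mult_add_rdistrib)
  have pairing_sum: "pairing u (sum F X) = (\<Sum>i\<in>X. pairing u (F i))" for F :: "idx \<Rightarrow> form" and u X
    by (induction X rule: infinite_finite_induct) (simp_all add: pairing_simps)
  have "pairing (\<psi> x) ((\<Sum>\<alpha>\<in>UNIV. \<gamma>_up \<alpha> ** H \<zeta> W \<alpha> x) *v \<psi> x)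
      = (\<Sum>\<rho>\<in>UNIV. \<Sum>\<sigma>\<in>UNIV. of_real (W \<rho> \<sigma> x) * (- \<i> * pairing (\<psi> x) (?M \<rho> \<sigma> *v \<psi> x)))"
    unfolding 1 mv_sum pairing_sum matrix_vector_bilinear matrix_vector_mul_assoc[symmetric] mat_mult pairing_simps ..
  also have "\<dots> = - of_real (\<Sum>\<rho>\<in>UNIV. \<Sum>\<sigma>\<in>UNIV. W \<rho> \<sigma> x * current \<zeta> \<psi> \<rho> \<sigma> x)"
    by (simp only: of_real_sum of_real_mult of_real_current mult_minus_left mult_minus_right sum_negf)
  finally have 2: "pairing (\<psi> x) ((\<Sum>\<alpha>\<in>UNIV. \<gamma>_up \<alpha> ** H \<zeta> W \<alpha> x) *v \<psi> x) = \<dots>" .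
  have "dirac (H \<zeta> W) \<psi> x = dirac (\<lambda>\<alpha> x. 0) \<psi> x + (\<Sum>\<alpha>\<in>UNIV. \<gamma>_up \<alpha> ** H \<zeta> W \<alpha> x) *v \<psi> x"
    by (simp add: dirac_def matrix_vector_right_distrib sum.distrib mv_sum flip: matrix_vector_mul_assoc)
  moreover define r where "r = (\<Sum>\<rho>\<in>UNIV. \<Sum>\<sigma>\<in>UNIV. W \<rho> \<sigma> x * current \<zeta> \<psi> \<rho> \<sigma> x)"
  ultimately have *: "dag (\<psi> x) (\<eta>_hat *v dirac (H \<zeta> W) \<psi> x) = dag (\<psi> x) (\<eta>_hat *v dirac (\<lambda>\<alpha> x. 0) \<psi> x)
      - of_real r"
    using 2 by (simp add: pairing_simps flip: pairing_def)
  \<comment> \<open>The coupling \<open>r\<close> is real, so half of it plus its conjugate is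
    \<open>r\<close> again.\<close>
  show ?thesis
    unfolding L\<^sub>K_def plus_cc_def r_def[symmetric] * by (simp add: field_simps)
qed

lemma continuous_matrix_vector [continuous_intros]:
  fixes f :: "'a::topological_space \<Rightarrow> form"
  assumes "continuous_on S f"
  shows "continuous_on S (\<lambda>x. A *v f x)"
  unfolding matrix_vector_mult_def using assms by (intro continuous_intros)

lemma continuous_pairing [continuous_intros]:
  fixes f g :: "'a::topological_space \<Rightarrow> form"
  assumes "continuous_on S f" "continuous_on S g"
  shows "continuous_on S (\<lambda>x. pairing (f x) (g x))"
  unfolding pairing_eq using assms by (intro continuous_intros)

lemma continuous_current: "smooth \<psi> \<Longrightarrow> continuous_on UNIV (current \<zeta> \<psi> \<alpha> \<beta>)"
  unfolding current_def by (intro continuous_intros smooth_continuous)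

lemma continuous_L_K_free: "smooth \<psi> \<Longrightarrow> continuous_on UNIV (L\<^sub>K m \<psi> (\<lambda>\<alpha> x. 0))"
  unfolding L\<^sub>K_def plus_cc_def dirac_def pairing_def[symmetric]
  by (intro continuous_intros smooth_continuous smooth_pd) auto

section \<open>The Euler-Lagrange expression and integration by parts\<close>

definition div2 :: "real tensor2 \<Rightarrow> idx \<Rightarrow> spacetime \<Rightarrow> real" where
  "div2 W \<rho> x = (\<Sum>\<beta>\<in>UNIV. pd \<beta> (W \<rho> \<beta>) x)"

lemma smooth_sum: "(\<And>i. smooth (f i)) \<Longrightarrow> smooth (\<lambda>x. \<Sum>i\<in>(UNIV :: idx set). f i x :: real)"
  unfolding sum_idx by (intro smooth_add)

lemma smooth_div2: "(\<And>\<alpha> \<beta>. smooth (W \<alpha> \<beta>)) \<Longrightarrow> smooth (div2 W \<rho>)"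
  unfolding div2_def by (intro smooth_sum smooth_pd)

text \<open>The left-hand side of the field equation with lowered indices written as signs and the
  two mixed second-derivative terms as gradients of the divergence; c stands for
  \<open>cos (2 * \<zeta>)\<close>.\<close>

definition field_operator :: "real \<Rightarrow> real tensor2 \<Rightarrow> idx \<Rightarrow> idx \<Rightarrow> spacetime \<Rightarrow> real" where
  "field_operator c W \<alpha> \<beta> x = (\<Sum>\<mu>\<in>UNIV. \<eta> \<mu> \<mu> * \<eta> \<alpha> \<alpha> * \<eta> \<beta> \<beta> * pd \<mu> (pd \<mu> (W \<alpha> \<beta>)) x)
     - \<eta> \<beta> \<beta> * pd \<alpha> (div2 W \<beta>) x + \<eta> \<alpha> \<alpha> * pd \<beta> (div2 W \<alpha>) x
     + 32 * c * cubic (\<lambda>\<rho> \<sigma>. W \<rho> \<sigma> x) \<alpha> \<beta>"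

lemma cubic_antisymmetric:
  assumes "\<And>\<alpha> \<beta>. w \<beta> \<alpha> = - w \<alpha> \<beta>"
  shows "cubic w \<beta> \<alpha> = - cubic w \<alpha> \<beta>"
proof -
  have "(\<Sum>\<rho>\<in>UNIV. \<Sum>\<sigma>\<in>UNIV. (\<eta> \<beta> \<beta> * \<eta> \<rho> \<rho> * w \<beta> \<rho>) * w \<rho> \<sigma> * (\<eta> \<sigma> \<sigma> * \<eta> \<alpha> \<alpha> * w \<sigma> \<alpha>))
      = (\<Sum>\<sigma>\<in>UNIV. \<Sum>\<rho>\<in>UNIV. - ((\<eta> \<alpha> \<alpha> * \<eta> \<sigma> \<sigma> * w \<alpha> \<sigma>) * w \<sigma> \<rho> * (\<eta> \<rho> \<rho> * \<eta> \<beta> \<beta> * w \<rho> \<beta>)))"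
    by (subst sum.swap, intro sum.cong refl, subst (1 2 3) assms) (simp add: mult_ac)
  then show ?thesis
    unfolding cubic_def assms[of \<beta> \<alpha>] by (simp add: sum_negf)
qed

lemma field_operator_antisymmetric:
  assumes W: "smooth_antisymmetric W"
  shows "field_operator c W \<beta> \<alpha> x = - field_operator c W \<alpha> \<beta> x"
proof -
  have "pd \<mu> (W \<beta> \<alpha>) = (\<lambda>x. - 1 * pd \<mu> (W \<alpha> \<beta>) x)" for \<mu>
    by (rule ext) (simp only: pd_antisymmetric[OF W, of \<mu> \<beta> \<alpha>] mult_minus1)
  then have "pd \<mu> (pd \<mu> (W \<beta> \<alpha>)) x = - pd \<mu> (pd \<mu> (W \<alpha> \<beta>)) x" for \<mu>
    using pd_cmult[of "pd \<mu> (W \<alpha> \<beta>)" x \<mu> "- 1"]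
      smooth_differentiable[OF smooth_pd[OF smooth_antisymmetricD(1)[OF W]]] by simp
  then show ?thesis
    unfolding field_operator_def cubic_antisymmetric[of "\<lambda>\<rho> \<sigma>. W \<rho> \<sigma> x" \<beta> \<alpha>, OF smooth_antisymmetricD(2)[OF W]]
    by (simp add: sum_negf mult_ac)
qed

lemma field_operator_eq:
  assumes W: "\<And>\<alpha> \<beta>. smooth (W \<alpha> \<beta>)"
  shows "(\<Sum>\<mu>\<in>UNIV. pd \<mu> (pd_up \<mu> (lower W \<alpha> \<beta>)) x)
           - (\<Sum>\<sigma>\<in>UNIV. pd \<alpha> (pd_up \<sigma> (lower W \<beta> \<sigma>)) x)
           + (\<Sum>\<sigma>\<in>UNIV. pd \<beta> (pd_up \<sigma> (lower W \<alpha> \<sigma>)) x)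
           + 32 * c *
               ((\<Sum>\<rho>\<in>UNIV. \<Sum>\<sigma>\<in>UNIV. lower W \<alpha> \<rho> x * W \<rho> \<sigma> x * lower W \<sigma> \<beta> x)
                + (\<Sum>\<rho>\<in>UNIV. \<Sum>\<sigma>\<in>UNIV. W \<rho> \<sigma> x * lower W \<rho> \<sigma> x) * lower W \<alpha> \<beta> x)
    = field_operator c W \<alpha> \<beta> x"
proof -
  have "pd_up \<mu> (lower W \<alpha> \<beta>) = (\<lambda>x. (\<eta> \<mu> \<mu> * \<eta> \<alpha> \<alpha> * \<eta> \<beta> \<beta>) * pd \<mu> (W \<alpha> \<beta>) x)" for \<mu> \<alpha> \<beta>
    by (simp add: fun_eq_iff pd_up_eq pd_lower W)
  then have 1: "pd \<nu> (pd_up \<mu> (lower W \<alpha> \<beta>)) x = \<eta> \<mu> \<mu> * \<eta> \<alpha> \<alpha> * \<eta> \<beta> \<beta> * pd \<nu> (pd \<mu> (W \<alpha> \<beta>)) x" for \<mu> \<nu> \<alpha> \<beta>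
    using pd_cmult[OF smooth_differentiable[OF smooth_pd[OF W]]] by simp
  have 2: "(\<Sum>\<sigma>\<in>UNIV. pd \<nu> (pd_up \<sigma> (lower W \<alpha> \<sigma>)) x) = \<eta> \<alpha> \<alpha> * pd \<nu> (div2 W \<alpha>) x" for \<nu> \<alpha>
  proof -
    have "pd \<nu> (div2 W \<alpha>) x = (\<Sum>\<sigma>\<in>UNIV. pd \<nu> (pd \<sigma> (W \<alpha> \<sigma>)) x)"
      unfolding div2_def by (rule pd_sum) (intro smooth_differentiable smooth_pd W)
    moreover have "\<eta> \<sigma> \<sigma> * \<eta> \<alpha> \<alpha> * \<eta> \<sigma> \<sigma> = \<eta> \<alpha> \<alpha>" for \<sigma>
      by (simp add: \<eta>_def)
    ultimately show ?thesis by (simp only: 1 sum_distrib_left)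
  qed
  show ?thesis
    unfolding field_operator_def cubic_def 2 unfolding 1 lower_eq ..
qed

lemma continuous_field_operator:
  assumes W: "\<And>\<alpha> \<beta>. smooth (W \<alpha> \<beta>)"
  shows "continuous_on UNIV (field_operator c W \<alpha> \<beta>)"
  unfolding field_operator_def cubic_def
  by (intro continuous_intros smooth_continuous smooth_pd smooth_div2 W)

text \<open>Integration by parts moves all derivatives onto W. The result pairs V with a
  non-antisymmetric expression, and antisymmetry of V permits replacing it by the antisymmetric B,
  as the test argument requires.\<close>

lemma integral_dkinetic:
  assumes W: "smooth_antisymmetric W" and V: "smooth_antisymmetric V"
    and K: "compact K" "\<And>\<alpha> \<beta> x. x \<notin> K \<Longrightarrow> V \<alpha> \<beta> x = 0"
  defines "B \<equiv> \<lambda>\<rho> \<sigma> x. (\<Sum>\<mu>\<in>UNIV. \<eta> \<mu> \<mu> * \<eta> \<rho> \<rho> * \<eta> \<sigma> \<sigma> * pd \<mu> (pd \<mu> (W \<rho> \<sigma>)) x)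
     - \<eta> \<sigma> \<sigma> * pd \<rho> (div2 W \<sigma>) x + \<eta> \<rho> \<rho> * pd \<sigma> (div2 W \<rho>) x"
  shows "integral UNIV (\<lambda>x. dkinetic (\<lambda>\<mu> \<rho> \<sigma>. pd \<mu> (W \<rho> \<sigma>) x) (\<lambda>\<mu> \<rho> \<sigma>. pd \<mu> (V \<rho> \<sigma>) x))
    = - 2 * integral UNIV (\<lambda>x. \<Sum>\<rho>\<in>UNIV. \<Sum>\<sigma>\<in>UNIV. V \<rho> \<sigma> x * B \<rho> \<sigma> x)"
proof -
  note sW = smooth_antisymmetricD(1)[OF W] and sV = smooth_antisymmetricD(1)[OF V]
  \<comment> \<open>The derivative of \<open>kinetic\<close> in its argument with indices (mu, rho,
    sigma), all entries taken as independent. The conditional is the Kronecker delta from the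
    divergence.\<close>
  define k where "k \<mu> \<rho> \<sigma> x = (2 * \<eta> \<mu> \<mu> * \<eta> \<rho> \<rho> * \<eta> \<sigma> \<sigma>) * pd \<mu> (W \<rho> \<sigma>) x
    + ((if \<mu> = \<sigma> then 4 else 0) * \<eta> \<rho> \<rho>) * div2 W \<rho> x" for \<mu> \<rho> \<sigma> x
  have k: "smooth (k \<mu> \<rho> \<sigma>)" for \<mu> \<rho> \<sigma>
    unfolding k_def by (intro smooth_add smooth_mult smooth_const smooth_pd smooth_div2 sW)
  have pdk: "pd \<mu> (k \<mu> \<rho> \<sigma>) x = 2 * \<eta> \<mu> \<mu> * \<eta> \<rho> \<rho> * \<eta> \<sigma> \<sigma> * pd \<mu> (pd \<mu> (W \<rho> \<sigma>)) x
    + (if \<mu> = \<sigma> then 4 * \<eta> \<rho> \<rho> * pd \<mu> (div2 W \<rho>) x else 0)" for \<mu> \<rho> \<sigma> x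
  proof -
    have d: "pd \<mu> (W \<rho> \<sigma>) differentiable (at x)" "div2 W \<rho> differentiable (at x)"
      by (intro smooth_differentiable smooth_pd smooth_div2 sW)+
    have cd: "(\<lambda>x. c * f x) differentiable (at x)" if "smooth f" for c and f :: "spacetime \<Rightarrow> real"
      using that by (intro smooth_differentiable smooth_mult smooth_const)
    show ?thesis
      unfolding k_def
      by (subst pd_add[OF cd[OF smooth_pd[OF sW]] cd[OF smooth_div2[OF sW]]])
        (simp add: pd_cmult[OF d(1)] pd_cmult[OF d(2)])
  qed
  have pV: "pd \<mu> (V \<rho> \<sigma>) x = 0" if "x \<notin> K" for \<mu> \<rho> \<sigma> x
    by (rule pd_eq_0[OF compact_imp_closed[OF K(1)] K(2) that])
  have int: "(\<lambda>x. pd \<mu> (V \<rho> \<sigma>) x * k \<mu> \<rho> \<sigma> x) integrable_on UNIV"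
    "(\<lambda>x. V \<rho> \<sigma> x * pd \<mu> (k \<mu> \<rho> \<sigma>) x) integrable_on UNIV" for \<mu> \<rho> \<sigma>
    by (rule integrable_support[OF _ K(1)], intro continuous_on_mult smooth_continuous smooth_pd k sV,
      simp add: pV K(2))+
  have expand: "dkinetic d e = (\<Sum>\<mu>\<in>UNIV. \<Sum>\<rho>\<in>UNIV. \<Sum>\<sigma>\<in>UNIV. e \<mu> \<rho> \<sigma> *
     ((2 * \<eta> \<mu> \<mu> * \<eta> \<rho> \<rho> * \<eta> \<sigma> \<sigma>) * d \<mu> \<rho> \<sigma>
    + ((if \<mu> = \<sigma> then 4 else 0) * \<eta> \<rho> \<rho>) * (\<Sum>\<beta>\<in>UNIV. d \<beta> \<rho> \<beta>)))" for d e
  proof -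
    have "(\<Sum>\<mu>\<in>UNIV. \<Sum>\<rho>\<in>UNIV. \<Sum>\<sigma>\<in>UNIV. e \<mu> \<rho> \<sigma> * (((if \<mu> = \<sigma> then 4 else 0) * \<eta> \<rho> \<rho>) * (\<Sum>\<beta>\<in>UNIV. d \<beta> \<rho> \<beta>)))
      = (\<Sum>\<mu>\<in>UNIV. \<Sum>\<rho>\<in>UNIV. \<Sum>\<sigma>\<in>UNIV. if \<mu> = \<sigma> then 4 * \<eta> \<rho> \<rho> * (\<Sum>\<beta>\<in>UNIV. d \<beta> \<rho> \<beta>) * e \<mu> \<rho> \<mu> else 0)"
      by (intro sum.cong refl) simp
    also have "\<dots> = (\<Sum>\<mu>\<in>UNIV. \<Sum>\<rho>\<in>UNIV. 4 * \<eta> \<rho> \<rho> * (\<Sum>\<beta>\<in>UNIV. d \<beta> \<rho> \<beta>) * e \<mu> \<rho> \<mu>)"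
      by simp
    also have "\<dots> = 4 * (\<Sum>\<rho>\<in>UNIV. \<eta> \<rho> \<rho> * (\<Sum>\<beta>\<in>UNIV. d \<beta> \<rho> \<beta>) * (\<Sum>\<beta>\<in>UNIV. e \<beta> \<rho> \<beta>))"
      by (subst sum.swap) (simp only: sum_distrib_left[symmetric] mult.assoc)
    finally show ?thesis
      unfolding dkinetic_def by (simp add: distrib_left sum.distrib sum_distrib_left[of 2] mult_ac)
  qed
  have "integral UNIV (\<lambda>x. dkinetic (\<lambda>\<mu> \<rho> \<sigma>. pd \<mu> (W \<rho> \<sigma>) x) (\<lambda>\<mu> \<rho> \<sigma>. pd \<mu> (V \<rho> \<sigma>) x))
     = integral UNIV (\<lambda>x. \<Sum>\<mu>\<in>UNIV. \<Sum>\<rho>\<in>UNIV. \<Sum>\<sigma>\<in>UNIV. pd \<mu> (V \<rho> \<sigma>) x * k \<mu> \<rho> \<sigma> x)"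
    unfolding expand k_def div2_def ..
  also have "\<dots> = (\<Sum>\<mu>\<in>UNIV. \<Sum>\<rho>\<in>UNIV. \<Sum>\<sigma>\<in>UNIV. integral UNIV (\<lambda>x. pd \<mu> (V \<rho> \<sigma>) x * k \<mu> \<rho> \<sigma> x))"
    using int by (simp add: integral_sum integrable_sum)
  also have "\<dots> = (\<Sum>\<mu>\<in>UNIV. \<Sum>\<rho>\<in>UNIV. \<Sum>\<sigma>\<in>UNIV. - integral UNIV (\<lambda>x. V \<rho> \<sigma> x * pd \<mu> (k \<mu> \<rho> \<sigma>) x))"
    by (intro sum.cong refl integral_by_parts[OF sV k K(1)] K(2))
  also have "\<dots> = - integral UNIV (\<lambda>x. \<Sum>\<mu>\<in>UNIV. \<Sum>\<rho>\<in>UNIV. \<Sum>\<sigma>\<in>UNIV. V \<rho> \<sigma> x * pd \<mu> (k \<mu> \<rho> \<sigma>) x)"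
    using int by (simp add: integral_sum integrable_sum sum_negf)
  also have "(\<lambda>x. \<Sum>\<mu>\<in>UNIV. \<Sum>\<rho>\<in>UNIV. \<Sum>\<sigma>\<in>UNIV. V \<rho> \<sigma> x * pd \<mu> (k \<mu> \<rho> \<sigma>) x)
     = (\<lambda>x. 2 * (\<Sum>\<rho>\<in>UNIV. \<Sum>\<sigma>\<in>UNIV. V \<rho> \<sigma> x * B \<rho> \<sigma> x))"
  proof
    fix x
    let ?E = "\<lambda>\<rho> \<sigma>. \<Sum>\<mu>\<in>UNIV. \<eta> \<mu> \<mu> * \<eta> \<rho> \<rho> * \<eta> \<sigma> \<sigma> * pd \<mu> (pd \<mu> (W \<rho> \<sigma>)) x"
    have "(\<Sum>\<mu>\<in>UNIV. \<Sum>\<rho>\<in>UNIV. \<Sum>\<sigma>\<in>UNIV. V \<rho> \<sigma> x * pd \<mu> (k \<mu> \<rho> \<sigma>) x)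
        = (\<Sum>\<rho>\<in>UNIV. \<Sum>\<sigma>\<in>UNIV. \<Sum>\<mu>\<in>UNIV. V \<rho> \<sigma> x * pd \<mu> (k \<mu> \<rho> \<sigma>) x)"
      by (subst sum.swap) (intro sum.cong refl sum.swap)
    also have "\<dots> = (\<Sum>\<rho>\<in>UNIV. \<Sum>\<sigma>\<in>UNIV. V \<rho> \<sigma> x * (2 * ?E \<rho> \<sigma> + 4 * \<eta> \<rho> \<rho> * pd \<sigma> (div2 W \<rho>) x))"
    proof -
      have "(\<Sum>\<mu>\<in>UNIV. pd \<mu> (k \<mu> \<rho> \<sigma>) x) = 2 * ?E \<rho> \<sigma> + 4 * \<eta> \<rho> \<rho> * pd \<sigma> (div2 W \<rho>) x" for \<rho> \<sigma>
        by (simp add: pdk sum.distrib sum_distrib_left mult_ac)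
      then show ?thesis by (simp only: flip: sum_distrib_left)
    qed
    \<comment> \<open>The divergence term is split into two halves. One stays; in the other the
      indices are exchanged at the cost of the sign of V, which produces the antisymmetric pair in
      B.\<close>
    also have "\<dots> = 2 * (\<Sum>\<rho>\<in>UNIV. \<Sum>\<sigma>\<in>UNIV. V \<rho> \<sigma> x * (?E \<rho> \<sigma> + \<eta> \<rho> \<rho> * pd \<sigma> (div2 W \<rho>) x))
       + 2 * (\<Sum>\<rho>\<in>UNIV. \<Sum>\<sigma>\<in>UNIV. V \<rho> \<sigma> x * (\<eta> \<rho> \<rho> * pd \<sigma> (div2 W \<rho>) x))"
    proof -
      have "(\<Sum>\<rho>\<in>UNIV. \<Sum>\<sigma>\<in>UNIV. v \<rho> \<sigma> * (2 * e \<rho> \<sigma> + 4 * \<eta> \<rho> \<rho> * a \<rho> \<sigma>)) =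
          2 * (\<Sum>\<rho>\<in>UNIV. \<Sum>\<sigma>\<in>UNIV. v \<rho> \<sigma> * (e \<rho> \<sigma> + \<eta> \<rho> \<rho> * a \<rho> \<sigma>))
          + 2 * (\<Sum>\<rho>\<in>UNIV. \<Sum>\<sigma>\<in>UNIV. v \<rho> \<sigma> * (\<eta> \<rho> \<rho> * a \<rho> \<sigma>))" for v e a :: "idx \<Rightarrow> idx \<Rightarrow> real"
        unfolding sum_distrib_left sum.distrib[symmetric]
        by (intro sum.cong refl) (simp add: algebra_simps)
      then show ?thesis .
    qed
    also have "(\<Sum>\<rho>\<in>UNIV. \<Sum>\<sigma>\<in>UNIV. V \<rho> \<sigma> x * (\<eta> \<rho> \<rho> * pd \<sigma> (div2 W \<rho>) x))
       = (\<Sum>\<rho>\<in>UNIV. \<Sum>\<sigma>\<in>UNIV. - (V \<rho> \<sigma> x * (\<eta> \<sigma> \<sigma> * pd \<rho> (div2 W \<sigma>) x)))"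
      by (subst sum.swap, intro sum.cong refl, subst smooth_antisymmetricD(2)[OF V]) simp
    finally show "(\<Sum>\<mu>\<in>UNIV. \<Sum>\<rho>\<in>UNIV. \<Sum>\<sigma>\<in>UNIV. V \<rho> \<sigma> x * pd \<mu> (k \<mu> \<rho> \<sigma>) x)
        = 2 * (\<Sum>\<rho>\<in>UNIV. \<Sum>\<sigma>\<in>UNIV. V \<rho> \<sigma> x * B \<rho> \<sigma> x)"
      unfolding B_def
      by (simp add: algebra_simps sum.distrib sum_negf sum_subtractf)
  qed
  finally show ?thesis by simp
qed

section \<open>The derivative of the action\<close>

definition action_density ::
    "real \<Rightarrow> real \<Rightarrow> (spacetime \<Rightarrow> form) \<Rightarrow> real tensor2 \<Rightarrow> spacetime \<Rightarrow> real" where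
  "action_density \<zeta> \<tau> \<psi> W x = - (\<Sum>\<rho>\<in>UNIV. \<Sum>\<sigma>\<in>UNIV. W \<rho> \<sigma> x * current \<zeta> \<psi> \<rho> \<sigma> x)
    - \<tau> * (1024 * (cos (2 * \<zeta>))\<^sup>2 * quartic (\<lambda>\<rho> \<sigma>. W \<rho> \<sigma> x)
      + 64 * cos (2 * \<zeta>) * kinetic (\<lambda>\<mu> \<rho> \<sigma>. pd \<mu> (W \<rho> \<sigma>) x))"

definition first_variation ::
    "real \<Rightarrow> real \<Rightarrow> (spacetime \<Rightarrow> form) \<Rightarrow> real tensor2 \<Rightarrow> real tensor2 \<Rightarrow> spacetime \<Rightarrow> real" where
  "first_variation \<zeta> \<tau> \<psi> W V x = - (\<Sum>\<rho>\<in>UNIV. \<Sum>\<sigma>\<in>UNIV. V \<rho> \<sigma> x * current \<zeta> \<psi> \<rho> \<sigma> x)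
    - \<tau> * (1024 * (cos (2 * \<zeta>))\<^sup>2 *
        (- 4 * (\<Sum>\<alpha>\<in>UNIV. \<Sum>\<beta>\<in>UNIV. V \<alpha> \<beta> x * cubic (\<lambda>\<rho> \<sigma>. W \<rho> \<sigma> x) \<alpha> \<beta>))
      + 64 * cos (2 * \<zeta>) * dkinetic (\<lambda>\<mu> \<rho> \<sigma>. pd \<mu> (W \<rho> \<sigma>) x) (\<lambda>\<mu> \<rho> \<sigma>. pd \<mu> (V \<rho> \<sigma>) x))"

lemma smooth_antisymmetric_add_scaled:
  assumes "smooth_antisymmetric W" "smooth_antisymmetric V"
  shows "smooth_antisymmetric (\<lambda>\<alpha> \<beta> x. W \<alpha> \<beta> x + t * V \<alpha> \<beta> x)"
  unfolding smooth_antisymmetric_def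
proof (intro conjI allI)
  show "smooth (\<lambda>x. W \<alpha> \<beta> x + t * V \<alpha> \<beta> x)" for \<alpha> \<beta>
    by (intro smooth_add smooth_mult smooth_const smooth_antisymmetricD(1) assms)
  show "W \<beta> \<alpha> x + t * V \<beta> \<alpha> x = - (W \<alpha> \<beta> x + t * V \<alpha> \<beta> x)" for \<alpha> \<beta> x
    using smooth_antisymmetricD(2)[OF assms(1), of \<beta> \<alpha> x] smooth_antisymmetricD(2)[OF assms(2), of \<beta> \<alpha> x]
    by simp
qed

lemma pd_add_scaled:
  assumes "smooth_antisymmetric W" "smooth_antisymmetric V"
  shows "pd \<mu> (\<lambda>x. W \<alpha> \<beta> x + t * V \<alpha> \<beta> x) x = pd \<mu> (W \<alpha> \<beta>) x + t * pd \<mu> (V \<alpha> \<beta>) x"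
proof -
  have s: "smooth (W \<alpha> \<beta>)" "smooth (V \<alpha> \<beta>)"
    by (intro smooth_antisymmetricD(1) assms)+
  have "(\<lambda>x. t * V \<alpha> \<beta> x) differentiable (at x)"
    by (intro smooth_differentiable smooth_mult smooth_const s)
  then show ?thesis
    by (simp add: pd_add pd_cmult smooth_differentiable s)
qed

text \<open>Isolates the real part that varies with W; the free term in front is the same for all
  variations and drops out on differentiation.\<close>

lemma Lagrangian_eq:
  assumes "smooth_antisymmetric W"
  shows "L\<^sub>K m \<psi> (H \<zeta> W) x - of_real \<tau> * L\<^sub>V (H \<zeta> W) x
    = L\<^sub>K m \<psi> (\<lambda>\<alpha> x. 0) x + of_real (action_density \<zeta> \<tau> \<psi> W x)"
  unfolding L_K_eq[of m \<psi> \<zeta> W] L_V_eq[OF assms] action_density_def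
  by (simp only: of_real_mult of_real_diff of_real_minus) (simp only: diff_conv_add_uminus add.assoc)

lemma action_density_derivative:
  assumes W: "smooth_antisymmetric W" and V: "smooth_antisymmetric V"
  shows "((\<lambda>t. action_density \<zeta> \<tau> \<psi> (\<lambda>\<alpha> \<beta> x. W \<alpha> \<beta> x + t * V \<alpha> \<beta> x) x) has_real_derivative
    first_variation \<zeta> \<tau> \<psi> (\<lambda>\<alpha> \<beta> x. W \<alpha> \<beta> x + t * V \<alpha> \<beta> x) V x) (at t)"
proof -
  note q = quartic_derivative[of "\<lambda>\<rho> \<sigma>. W \<rho> \<sigma> x" "\<lambda>\<rho> \<sigma>. V \<rho> \<sigma> x" t,
      OF smooth_antisymmetricD(2)[OF W] smooth_antisymmetricD(2)[OF V]]
  show ?thesis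
    unfolding action_density_def first_variation_def pd_add_scaled[OF W V]
    by (rule derivative_eq_intros q kinetic_derivative refl | simp)+
qed

lemma continuous_first_variation:
  assumes W: "smooth_antisymmetric W" and V: "smooth_antisymmetric V" and \<psi>: "smooth \<psi>"
  shows "continuous_on UNIV (\<lambda>(t, x). first_variation \<zeta> \<tau> \<psi> (\<lambda>\<alpha> \<beta> x. W \<alpha> \<beta> x + t * V \<alpha> \<beta> x) V x)"
proof -
  have snd: "continuous_on UNIV (\<lambda>p. f (snd p))" if "continuous_on UNIV f"
    for f :: "spacetime \<Rightarrow> real"
    using continuous_on_compose2[OF that continuous_on_snd[OF continuous_on_id]] by simp
  note [continuous_intros] =
    snd[OF smooth_continuous[OF smooth_antisymmetricD(1)[OF W]]]
    snd[OF smooth_continuous[OF smooth_antisymmetricD(1)[OF V]]]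
    snd[OF smooth_continuous[OF smooth_pd[OF smooth_antisymmetricD(1)[OF W]]]]
    snd[OF smooth_continuous[OF smooth_pd[OF smooth_antisymmetricD(1)[OF V]]]]
    snd[OF continuous_current[OF \<psi>]]
  show ?thesis
    unfolding split_def first_variation_def pd_add_scaled[OF W V] dkinetic_def cubic_def
    by (intro continuous_intros)
qed

lemma continuous_action_density:
  assumes W: "smooth_antisymmetric W" and \<psi>: "smooth \<psi>"
  shows "continuous_on UNIV (action_density \<zeta> \<tau> \<psi> W)"
  unfolding action_density_def quartic_def kinetic_def
  by (intro continuous_intros continuous_current[OF \<psi>] smooth_continuous smooth_pd smooth_antisymmetricD(1) W)

text \<open>Off K the field V and its first derivatives vanish, so the density there does not depend
  on t; this is the hypothesis under which \<open>variation_derivative\<close> applies.\<close>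

lemma action_derivative:
  assumes W: "smooth_antisymmetric W" and V: "smooth_antisymmetric V" and \<psi>: "smooth \<psi>"
    and K: "compact K" "\<And>\<alpha> \<beta> x. x \<notin> K \<Longrightarrow> V \<alpha> \<beta> x = 0"
  defines "W' \<equiv> \<lambda>t \<alpha> \<beta> x. W \<alpha> \<beta> x + t * V \<alpha> \<beta> x"
  shows "((\<lambda>t. integral K (\<lambda>x. L\<^sub>K m \<psi> (H \<zeta> (W' t)) x - of_real \<tau> * L\<^sub>V (H \<zeta> (W' t)) x))
    has_vector_derivative of_real (integral UNIV (first_variation \<zeta> \<tau> \<psi> W V))) (at 0)"
proof -
  let ?G = "\<lambda>t x. L\<^sub>K m \<psi> (\<lambda>\<alpha> x. 0) x + complex_of_real (action_density \<zeta> \<tau> \<psi> (W' t) x)"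
  let ?D = "\<lambda>t x. complex_of_real (first_variation \<zeta> \<tau> \<psi> (W' t) V x)"
  have W': "smooth_antisymmetric (W' t)" for t
    unfolding W'_def by (rule smooth_antisymmetric_add_scaled[OF W V])
  have pV: "pd \<mu> (V \<rho> \<sigma>) x = 0" if "x \<notin> K" for \<mu> \<rho> \<sigma> x
    by (rule pd_eq_0[OF compact_imp_closed[OF K(1)] K(2) that])
  have "((\<lambda>t. integral K (?G t)) has_vector_derivative integral UNIV (?D 0)) (at 0)"
  proof (rule variation_derivative[OF _ _ _ K(1)])
    show "((\<lambda>t. ?G t x) has_vector_derivative ?D t x) (at t)" for t x
    proof -
      have "((\<lambda>t. action_density \<zeta> \<tau> \<psi> (W' t) x) has_vector_derivative first_variation \<zeta> \<tau> \<psi> (W' t) V x) (at t)"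
        using action_density_derivative[OF W V]
        by (simp only: W'_def flip: has_real_derivative_iff_has_vector_derivative)
      from has_vector_derivative_add[OF has_vector_derivative_const
          bounded_linear.has_vector_derivative[OF bounded_linear_of_real this]]
      show ?thesis by simp
    qed
    show "continuous_on UNIV (?G t)" for t
      by (intro continuous_intros continuous_L_K_free continuous_action_density W' \<psi>)
    show "continuous_on UNIV (\<lambda>(t, x). ?D t x)"
      using continuous_on_of_real[OF continuous_first_variation[OF W V \<psi>]]
      by (simp only: W'_def split_def)
    show "?G t x = ?G 0 x" if "x \<notin> K" for t x
    proof -
      have "W' t \<rho> \<sigma> x = W' 0 \<rho> \<sigma> x" "pd \<mu> (W' t \<rho> \<sigma>) x = pd \<mu> (W' 0 \<rho> \<sigma>) x" for \<rho> \<sigma> \<mu>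
        unfolding W'_def pd_add_scaled[OF W V] by (simp_all add: K(2) pV that)
      then show ?thesis unfolding action_density_def by (simp only:)
    qed
  qed
  moreover have "integral UNIV (?D 0) = of_real (integral UNIV (first_variation \<zeta> \<tau> \<psi> W V))"
  proof -
    have 0: "W' 0 = W" by (simp add: W'_def)
    have "continuous_on UNIV (\<lambda>x :: spacetime. (0 :: real, x))" by (intro continuous_intros)
    from continuous_on_compose2[OF continuous_first_variation[OF W V \<psi>] this]
    have "continuous_on UNIV (first_variation \<zeta> \<tau> \<psi> W V)" by simp
    then have "first_variation \<zeta> \<tau> \<psi> W V integrable_on UNIV"
      by (rule integrable_support[OF _ K(1)]) (simp add: first_variation_def dkinetic_def K(2) pV)
    from integral_linear[OF this bounded_linear_of_real] show ?thesis
      by (simp add: o_def 0)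
  qed
  ultimately show ?thesis by (simp only: Lagrangian_eq[OF W'])
qed

lemma integral_first_variation:
  assumes W: "smooth_antisymmetric W" and V: "smooth_antisymmetric V" and \<psi>: "smooth \<psi>"
    and K: "compact K" "\<And>\<alpha> \<beta> x. x \<notin> K \<Longrightarrow> V \<alpha> \<beta> x = 0"
  shows "integral UNIV (first_variation \<zeta> \<tau> \<psi> W V) = integral UNIV (\<lambda>x. \<Sum>\<rho>\<in>UNIV. \<Sum>\<sigma>\<in>UNIV.
    V \<rho> \<sigma> x * (128 * \<tau> * cos (2 * \<zeta>) * field_operator (cos (2 * \<zeta>)) W \<rho> \<sigma> x - current \<zeta> \<psi> \<rho> \<sigma> x))"
proof -
  let ?c = "cos (2 * \<zeta>)"
  note sW = smooth_antisymmetricD(1)[OF W] and sV = smooth_antisymmetricD(1)[OF V]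
  let ?k = "\<lambda>x. dkinetic (\<lambda>\<mu> \<rho> \<sigma>. pd \<mu> (W \<rho> \<sigma>) x) (\<lambda>\<mu> \<rho> \<sigma>. pd \<mu> (V \<rho> \<sigma>) x)"
  let ?B = "\<lambda>\<rho> \<sigma> x. (\<Sum>\<mu>\<in>UNIV. \<eta> \<mu> \<mu> * \<eta> \<rho> \<rho> * \<eta> \<sigma> \<sigma> * pd \<mu> (pd \<mu> (W \<rho> \<sigma>)) x)
     - \<eta> \<sigma> \<sigma> * pd \<rho> (div2 W \<sigma>) x + \<eta> \<rho> \<rho> * pd \<sigma> (div2 W \<rho>) x"
  let ?b = "\<lambda>x. \<Sum>\<rho>\<in>UNIV. \<Sum>\<sigma>\<in>UNIV. V \<rho> \<sigma> x * ?B \<rho> \<sigma> x"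
  \<comment> \<open>Here 4096 = 4 * 1024 comes from varying the quartic term. It equals 128 * 32, so
    this part matches the cubic term of \<open>field_operator\<close> once the common factor 128
    from the kinetic term is extracted.\<close>
  let ?a = "\<lambda>x. \<Sum>\<rho>\<in>UNIV. \<Sum>\<sigma>\<in>UNIV. V \<rho> \<sigma> x *
      (4096 * \<tau> * ?c\<^sup>2 * cubic (\<lambda>\<rho> \<sigma>. W \<rho> \<sigma> x) \<rho> \<sigma> - current \<zeta> \<psi> \<rho> \<sigma> x)"
  have pV: "pd \<mu> (V \<rho> \<sigma>) x = 0" if "x \<notin> K" for \<mu> \<rho> \<sigma> x
    by (rule pd_eq_0[OF compact_imp_closed[OF K(1)] K(2) that])
  have k: "?k integrable_on UNIV"
    by (rule integrable_support[OF _ K(1)], unfold dkinetic_def,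
      intro continuous_intros smooth_continuous smooth_pd sV sW) (simp add: pV)
  have b: "?b integrable_on UNIV"
    by (rule integrable_support[OF _ K(1)],
      intro continuous_intros smooth_continuous smooth_pd smooth_div2 sV sW) (simp add: K(2))
  have a: "?a integrable_on UNIV"
    by (rule integrable_support[OF _ K(1)], unfold cubic_def,
      intro continuous_intros continuous_current[OF \<psi>] smooth_continuous sV sW) (simp add: K(2))
  have "first_variation \<zeta> \<tau> \<psi> W V = (\<lambda>x. ?a x - (64 * \<tau> * ?c) * ?k x)"
    by (simp add: fun_eq_iff first_variation_def right_diff_distrib sum_subtractf sum_distrib_left sum_negf
        algebra_simps)
  then have "integral UNIV (first_variation \<zeta> \<tau> \<psi> W V) = integral UNIV ?a - (64 * \<tau> * ?c) * integral UNIV ?k"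
    using k a by (simp add: integral_diff integrable_on_mult_right)
  also have "\<dots> = integral UNIV ?a + (128 * \<tau> * ?c) * integral UNIV ?b"
    by (subst integral_dkinetic[OF W V K(1)]) (simp_all add: K(2))
  also have "\<dots> = integral UNIV (\<lambda>x. ?a x + (128 * \<tau> * ?c) * ?b x)"
    using a b by (simp add: integral_add integrable_on_mult_right)
  also have "(\<lambda>x. ?a x + (128 * \<tau> * ?c) * ?b x) = (\<lambda>x. \<Sum>\<rho>\<in>UNIV. \<Sum>\<sigma>\<in>UNIV.
    V \<rho> \<sigma> x * (128 * \<tau> * ?c * field_operator ?c W \<rho> \<sigma> x - current \<zeta> \<psi> \<rho> \<sigma> x))"
  proof
    fix x
    define B where "B \<rho> \<sigma> = ?B \<rho> \<sigma> x" for \<rho> \<sigma>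
    define E where "E = cubic (\<lambda>\<rho> \<sigma>. W \<rho> \<sigma> x)"
    have fo: "field_operator ?c W \<rho> \<sigma> x = B \<rho> \<sigma> + 32 * ?c * E \<rho> \<sigma>" for \<rho> \<sigma>
      by (simp add: field_operator_def B_def E_def)
    have "(\<Sum>\<rho>\<in>UNIV. \<Sum>\<sigma>\<in>UNIV. V \<rho> \<sigma> x * (4096 * \<tau> * ?c\<^sup>2 * E \<rho> \<sigma> - current \<zeta> \<psi> \<rho> \<sigma> x))
        + (128 * \<tau> * ?c) * (\<Sum>\<rho>\<in>UNIV. \<Sum>\<sigma>\<in>UNIV. V \<rho> \<sigma> x * B \<rho> \<sigma>)
      = (\<Sum>\<rho>\<in>UNIV. \<Sum>\<sigma>\<in>UNIV. V \<rho> \<sigma> x * (128 * \<tau> * ?c * field_operator ?c W \<rho> \<sigma> x - current \<zeta> \<psi> \<rho> \<sigma> x))"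
      unfolding fo sum_distrib_left sum.distrib[symmetric]
      by (intro sum.cong refl) (simp add: power2_eq_square algebra_simps)
    then show "?a x + (128 * \<tau> * ?c) * ?b x = (\<Sum>\<rho>\<in>UNIV. \<Sum>\<sigma>\<in>UNIV.
        V \<rho> \<sigma> x * (128 * \<tau> * ?c * field_operator ?c W \<rho> \<sigma> x - current \<zeta> \<psi> \<rho> \<sigma> x))"
      unfolding B_def E_def .
  qed
  finally show ?thesis .
qed

text \<open>The admissible test fields are antisymmetric, so a bump is placed in the component (a,
  b) and its negative in (b, a). Antisymmetry of M makes both contributions equal instead of
  cancelling, and the integrand has one sign near the chosen point.\<close>

lemma fundamental_lemma_antisymmetric:
  assumes M: "\<And>\<alpha> \<beta>. continuous_on UNIV (M \<alpha> \<beta>)" "\<And>\<alpha> \<beta> x. M \<beta> \<alpha> x = - M \<alpha> \<beta> x"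
    and zero: "\<And>V K. smooth_antisymmetric V \<Longrightarrow> compact K \<Longrightarrow> (\<And>\<alpha> \<beta>. closure {x. V \<alpha> \<beta> x \<noteq> 0} \<subseteq> K) \<Longrightarrow>
      integral UNIV (\<lambda>x. \<Sum>\<alpha>\<in>UNIV. \<Sum>\<beta>\<in>UNIV. V \<alpha> \<beta> x * M \<alpha> \<beta> x) = 0"
  shows "M a b x\<^sub>0 = (0 :: real)"
proof (rule ccontr)
  assume nz: "M a b x\<^sub>0 \<noteq> 0"
  then have ab: "a \<noteq> b" using M(2)[of a a x\<^sub>0] by auto
  define s where "s = sgn (M a b x\<^sub>0)"
  have cont: "continuous_on UNIV (\<lambda>x. s * M a b x)" by (intro continuous_intros M)
  have s: "s * M a b x\<^sub>0 > 0" using nz by (simp add: s_def sgn_mult_self_eq abs_sgn[symmetric] mult.commute)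
  then have "x\<^sub>0 \<in> {x. 0 < s * M a b x}" by simp
  moreover have "open {x. 0 < s * M a b x}"
    by (rule open_Collect_less) (use cont in \<open>auto intro: continuous_intros\<close>)
  ultimately obtain \<delta> where \<delta>: "\<delta> > 0" "cball x\<^sub>0 \<delta> \<subseteq> {x. 0 < s * M a b x}"
    using open_contains_cball by blast
  \<comment> \<open>With half-width a quarter of \<delta>, the sum of the four coordinate distances
    is at most \<delta>, so the cube lies in the ball on which M keeps its sign.\<close>
  obtain \<phi> :: "spacetime \<Rightarrow> real" where \<phi>: "smooth \<phi>" "\<And>x. \<phi> x \<ge> 0"
    "\<And>x. \<phi> x > 0 \<longleftrightarrow> (\<forall>i. \<bar>x $ i - x\<^sub>0 $ i\<bar> < \<delta> / 4)"
    using smooth_bump_exists[of x\<^sub>0 "\<delta> / 4"] by metis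
  have off: "\<phi> x = 0" if "x \<notin> cball x\<^sub>0 \<delta>" for x
  proof (rule ccontr)
    assume "\<phi> x \<noteq> 0"
    then have "\<phi> x > 0" using \<phi>(2)[of x] by simp
    then have "\<bar>(x - x\<^sub>0) $ i\<bar> \<le> \<delta> / 4" for i using \<phi>(3)[of x] by (simp add: less_imp_le)
    then have "(\<Sum>i\<in>UNIV. \<bar>(x - x\<^sub>0) $ i\<bar>) \<le> (\<Sum>i\<in>(UNIV :: idx set). \<delta> / 4)"
      by (intro sum_mono) auto
    then have "norm (x - x\<^sub>0) \<le> \<delta>" using norm_le_l1_cart[of "x - x\<^sub>0"] by simp
    then show False using that by (simp add: dist_norm norm_minus_commute)
  qed
  define V :: "real tensor2" where "V \<alpha> \<beta> x =
    (if \<alpha> = a \<and> \<beta> = b then 1 else if \<alpha> = b \<and> \<beta> = a then - 1 else 0) * \<phi> x" for \<alpha> \<beta> x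
  have V: "smooth_antisymmetric V"
    unfolding smooth_antisymmetric_def
  proof (intro conjI allI)
    show "smooth (V \<alpha> \<beta>)" for \<alpha> \<beta>
      unfolding V_def by (intro smooth_mult smooth_const \<phi>(1))
    show "V \<beta> \<alpha> x = - V \<alpha> \<beta> x" for \<alpha> \<beta> x
      using ab by (auto simp: V_def)
  qed
  have supp: "closure {x. V \<alpha> \<beta> x \<noteq> 0} \<subseteq> cball x\<^sub>0 \<delta>" for \<alpha> \<beta>
    by (rule closure_minimal[OF _ closed_cball], rule subsetI, rule ccontr) (simp add: V_def off)
  have "(\<Sum>\<alpha>\<in>UNIV. \<Sum>\<beta>\<in>UNIV. V \<alpha> \<beta> x * M \<alpha> \<beta> x) = 2 * (\<phi> x * M a b x)" for x
  proof -
    have "(\<Sum>\<alpha>\<in>UNIV. \<Sum>\<beta>\<in>UNIV. V \<alpha> \<beta> x * M \<alpha> \<beta> x) = (\<Sum>\<alpha>\<in>UNIV. \<Sum>\<beta>\<in>UNIV.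
      (if \<beta> = b then if \<alpha> = a then \<phi> x * M a b x else 0 else 0)
      + (if \<beta> = a then if \<alpha> = b then - (\<phi> x * M b a x) else 0 else 0))"
      using ab by (intro sum.cong refl) (auto simp: V_def)
    then show ?thesis by (simp add: sum.distrib M(2)[of b a x])
  qed
  then have "integral UNIV (\<lambda>x. 2 * (\<phi> x * M a b x)) = 0"
    using zero[OF V compact_cball supp] by simp
  then have "integral UNIV (\<lambda>x. \<phi> x * M a b x) = 0"
    unfolding integral_mult_right by simp
  then have "integral UNIV (\<lambda>x. s * (\<phi> x * M a b x)) = 0"
    unfolding integral_mult_right by simp
  then have int: "integral UNIV (\<lambda>x. \<phi> x * (s * M a b x)) = 0"
    by (simp only: mult.left_commute[of s])
  have nonneg: "\<phi> x * (s * M a b x) \<ge> 0" for x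
  proof (cases "x \<in> cball x\<^sub>0 \<delta>")
    case True
    then have "0 < s * M a b x" using \<delta>(2) by blast
    then show ?thesis using \<phi>(2)[of x] by simp
  next
    case False
    then show ?thesis using off by simp
  qed
  have "continuous_on UNIV (\<lambda>x. \<phi> x * (s * M a b x))"
    by (intro continuous_on_mult[OF _ cont] smooth_continuous \<phi>(1))
  from nonneg_integral_0_imp_0[OF this nonneg compact_cball[of x\<^sub>0 \<delta>] _ int, of x\<^sub>0]
  have "\<phi> x\<^sub>0 * (s * M a b x\<^sub>0) = 0" by (simp add: off)
  moreover have "\<phi> x\<^sub>0 > 0" using \<phi>(3)[of x\<^sub>0] \<delta>(1) by simp
  ultimately show False using s by auto
qed

text \<open>Both directions read off the same formula for the derivative of the action: uniqueness
  of the derivative makes every tested integral zero, and conversely a vanishing expression makes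
  the derivative zero.\<close>

lemma stationary_iff:
  assumes W: "smooth_antisymmetric W" and \<psi>: "smooth \<psi>"
  shows "stationary (\<lambda>W' x. L\<^sub>K m \<psi> (H \<zeta> W') x - of_real \<tau> * L\<^sub>V (H \<zeta> W') x) W \<longleftrightarrow>
    (\<forall>x \<alpha> \<beta>. 128 * \<tau> * cos (2 * \<zeta>) * field_operator (cos (2 * \<zeta>)) W \<alpha> \<beta> x = current \<zeta> \<psi> \<alpha> \<beta> x)"
    (is "?stat \<longleftrightarrow> ?eq")
proof -
  let ?M = "\<lambda>\<alpha> \<beta> x. 128 * \<tau> * cos (2 * \<zeta>) * field_operator (cos (2 * \<zeta>)) W \<alpha> \<beta> x - current \<zeta> \<psi> \<alpha> \<beta> x"
  have deriv: "((\<lambda>t. integral K (\<lambda>x. L\<^sub>K m \<psi> (H \<zeta> (\<lambda>\<alpha> \<beta> x. W \<alpha> \<beta> x + t * V \<alpha> \<beta> x)) x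
        - of_real \<tau> * L\<^sub>V (H \<zeta> (\<lambda>\<alpha> \<beta> x. W \<alpha> \<beta> x + t * V \<alpha> \<beta> x)) x)) has_vector_derivative
      of_real (integral UNIV (\<lambda>x. \<Sum>\<alpha>\<in>UNIV. \<Sum>\<beta>\<in>UNIV. V \<alpha> \<beta> x * ?M \<alpha> \<beta> x))) (at 0)"
    if V: "smooth_antisymmetric V" and K: "compact K" and s: "\<And>\<alpha> \<beta>. closure {x. V \<alpha> \<beta> x \<noteq> 0} \<subseteq> K" for V K
  proof -
    have "V \<alpha> \<beta> x = 0" if "x \<notin> K" for \<alpha> \<beta> x
      using s[of \<alpha> \<beta>] closure_subset[of "{x. V \<alpha> \<beta> x \<noteq> 0}"] that by auto
    note off = this
    have "integral UNIV (first_variation \<zeta> \<tau> \<psi> W V) = integral UNIV (\<lambda>x. \<Sum>\<alpha>\<in>UNIV. \<Sum>\<beta>\<in>UNIV. V \<alpha> \<beta> x * ?M \<alpha> \<beta> x)"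
      by (rule integral_first_variation[OF W V \<psi> K]) (rule off)
    moreover have "((\<lambda>t. integral K (\<lambda>x. L\<^sub>K m \<psi> (H \<zeta> (\<lambda>\<alpha> \<beta> x. W \<alpha> \<beta> x + t * V \<alpha> \<beta> x)) x
        - of_real \<tau> * L\<^sub>V (H \<zeta> (\<lambda>\<alpha> \<beta> x. W \<alpha> \<beta> x + t * V \<alpha> \<beta> x)) x)) has_vector_derivative
      of_real (integral UNIV (first_variation \<zeta> \<tau> \<psi> W V))) (at 0)"
      by (rule action_derivative[OF W V \<psi> K]) (rule off)
    ultimately show ?thesis by (simp only:)
  qed
  show ?thesis
  proof
    assume stat: ?stat
    have "?M \<alpha> \<beta> x = 0" for \<alpha> \<beta> x
    proof (rule fundamental_lemma_antisymmetric[of ?M])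
      show "continuous_on UNIV (?M \<alpha> \<beta>)" for \<alpha> \<beta>
        by (intro continuous_intros continuous_field_operator continuous_current \<psi> smooth_antisymmetricD(1) W)
      show "?M \<beta> \<alpha> x = - ?M \<alpha> \<beta> x" for \<alpha> \<beta> x
        by (simp add: field_operator_antisymmetric[OF W, of _ \<beta> \<alpha>] current_antisymmetric[of _ _ \<beta> \<alpha>])
    next
      fix V K assume VK: "smooth_antisymmetric V" "compact K" "\<And>\<alpha> \<beta>. closure {x. V \<alpha> \<beta> x \<noteq> 0} \<subseteq> K"
      have "((\<lambda>t. integral K (\<lambda>x. L\<^sub>K m \<psi> (H \<zeta> (\<lambda>\<alpha> \<beta> x. W \<alpha> \<beta> x + t * V \<alpha> \<beta> x)) x
        - of_real \<tau> * L\<^sub>V (H \<zeta> (\<lambda>\<alpha> \<beta> x. W \<alpha> \<beta> x + t * V \<alpha> \<beta> x)) x)) has_vector_derivative 0) (at 0)"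
        using stat VK unfolding stationary_def by blast
      then have "complex_of_real (integral UNIV (\<lambda>x. \<Sum>\<alpha>\<in>UNIV. \<Sum>\<beta>\<in>UNIV. V \<alpha> \<beta> x * ?M \<alpha> \<beta> x)) = 0"
        by (rule vector_derivative_unique_at[rotated], intro deriv VK)
      then show "integral UNIV (\<lambda>x. \<Sum>\<alpha>\<in>UNIV. \<Sum>\<beta>\<in>UNIV. V \<alpha> \<beta> x * ?M \<alpha> \<beta> x) = 0"
        by (simp only: of_real_eq_0_iff)
    qed
    then show ?eq by simp
  next
    assume eq: ?eq
    show ?stat
      unfolding stationary_def
    proof (intro allI impI, elim conjE)
      fix V K assume VK: "smooth_antisymmetric V" "compact K" "\<forall>\<alpha> \<beta>. closure {x. V \<alpha> \<beta> x \<noteq> 0} \<subseteq> K"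
      have "closure {x. V \<alpha> \<beta> x \<noteq> 0} \<subseteq> K" for \<alpha> \<beta> using VK(3) by blast
      from deriv[OF VK(1,2) this]
      show "((\<lambda>t. integral K (\<lambda>x. L\<^sub>K m \<psi> (H \<zeta> (\<lambda>\<alpha> \<beta> x. W \<alpha> \<beta> x + t * V \<alpha> \<beta> x)) x
        - of_real \<tau> * L\<^sub>V (H \<zeta> (\<lambda>\<alpha> \<beta> x. W \<alpha> \<beta> x + t * V \<alpha> \<beta> x)) x)) has_vector_derivative 0) (at 0)"
        by (simp add: eq)
    qed
  qed
qed

(* The factor 32 of the cubic term corrects the factor 16 of the informal text: the quartic and
   kinetic terms of the first formula have coefficients 1024 c^2 and 64 c with c = cos (2 zeta),
   and their variation yields (4 * 1024 c^2) / (2 * 64 c) = 32 c. *)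

theorem mainTheorem8:
  fixes W :: "real tensor2" and \<zeta> \<tau> m :: real and \<psi> :: "spacetime \<Rightarrow> form"
  assumes W: "smooth_antisymmetric W"
  shows "(\<forall>x. L\<^sub>V (H \<zeta> W) x = of_real (
       1024 * (cos (2 * \<zeta>))\<^sup>2 *
         ((\<Sum>\<alpha>\<in>UNIV. \<Sum>\<beta>\<in>UNIV. \<Sum>\<rho>\<in>UNIV. \<Sum>\<sigma>\<in>UNIV. W \<alpha> \<beta> x * lower W \<beta> \<rho> x * W \<rho> \<sigma> x * lower W \<sigma> \<alpha> x)
          - (\<Sum>\<alpha>\<in>UNIV. \<Sum>\<beta>\<in>UNIV. W \<alpha> \<beta> x * lower W \<alpha> \<beta> x)\<^sup>2)
     + 64 * cos (2 * \<zeta>) *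
         ((\<Sum>\<alpha>\<in>UNIV. \<Sum>\<rho>\<in>UNIV. \<Sum>\<sigma>\<in>UNIV. pd \<alpha> (W \<rho> \<sigma>) x * pd_up \<alpha> (lower W \<rho> \<sigma>) x)
          + 2 * (\<Sum>\<alpha>\<in>UNIV. (\<Sum>\<beta>\<in>UNIV. pd \<beta> (W \<alpha> \<beta>) x) * (\<Sum>\<sigma>\<in>UNIV. pd_up \<sigma> (lower W \<alpha> \<sigma>) x)))))
     \<and>
     (\<tau> \<noteq> 0 \<and> cos (2 * \<zeta>) \<noteq> 0 \<and> smooth \<psi> \<longrightarrow>
       (stationary (\<lambda>W' x. L\<^sub>K m \<psi> (H \<zeta> W') x - of_real \<tau> * L\<^sub>V (H \<zeta> W') x) W
        \<longleftrightarrow>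
        (\<forall>x \<alpha> \<beta>. of_real (
             (\<Sum>\<mu>\<in>UNIV. pd \<mu> (pd_up \<mu> (lower W \<alpha> \<beta>)) x)
           - (\<Sum>\<sigma>\<in>UNIV. pd \<alpha> (pd_up \<sigma> (lower W \<beta> \<sigma>)) x)
           + (\<Sum>\<sigma>\<in>UNIV. pd \<beta> (pd_up \<sigma> (lower W \<alpha> \<sigma>)) x)
           + 32 * cos (2 * \<zeta>) *
               ((\<Sum>\<rho>\<in>UNIV. \<Sum>\<sigma>\<in>UNIV. lower W \<alpha> \<rho> x * W \<rho> \<sigma> x * lower W \<sigma> \<beta> x)
                + (\<Sum>\<rho>\<in>UNIV. \<Sum>\<sigma>\<in>UNIV. W \<rho> \<sigma> x * lower W \<rho> \<sigma> x) * lower W \<alpha> \<beta> x))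
           = \<i> / of_real (128 * \<tau> * cos (2 * \<zeta>)) *
               dag (\<psi> x) (\<eta>_hat *v ((\<Sum>\<nu>\<in>UNIV. \<gamma>_up \<nu> ** \<S> \<zeta> ** \<Theta> [\<nu>, \<alpha>, \<beta>]) *v \<psi> x)))))"
proof (intro conjI allI impI)
  fix x
  have s: "smooth (W \<alpha> \<beta>)" for \<alpha> \<beta> by (rule smooth_antisymmetricD(1)[OF W])
  have div: "(\<Sum>\<sigma>\<in>UNIV. pd_up \<sigma> (lower W \<alpha> \<sigma>) x) = \<eta> \<alpha> \<alpha> * (\<Sum>\<sigma>\<in>UNIV. pd \<sigma> (W \<alpha> \<sigma>) x)" for \<alpha>
    by (auto simp: pd_up_eq pd_lower s sum_distrib_left \<eta>_def intro!: sum.cong)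
  have "quartic (\<lambda>\<rho> \<sigma>. W \<rho> \<sigma> x) =
      (\<Sum>\<alpha>\<in>UNIV. \<Sum>\<beta>\<in>UNIV. \<Sum>\<rho>\<in>UNIV. \<Sum>\<sigma>\<in>UNIV. W \<alpha> \<beta> x * lower W \<beta> \<rho> x * W \<rho> \<sigma> x * lower W \<sigma> \<alpha> x)
      - (\<Sum>\<alpha>\<in>UNIV. \<Sum>\<beta>\<in>UNIV. W \<alpha> \<beta> x * lower W \<alpha> \<beta> x)\<^sup>2"
    unfolding quartic_def lower_eq ..
  moreover have "kinetic (\<lambda>\<mu> \<rho> \<sigma>. pd \<mu> (W \<rho> \<sigma>) x) =
      (\<Sum>\<alpha>\<in>UNIV. \<Sum>\<rho>\<in>UNIV. \<Sum>\<sigma>\<in>UNIV. pd \<alpha> (W \<rho> \<sigma>) x * pd_up \<alpha> (lower W \<rho> \<sigma>) x)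
      + 2 * (\<Sum>\<alpha>\<in>UNIV. (\<Sum>\<beta>\<in>UNIV. pd \<beta> (W \<alpha> \<beta>) x) * (\<Sum>\<sigma>\<in>UNIV. pd_up \<sigma> (lower W \<alpha> \<sigma>) x))"
    unfolding kinetic_def div
    by (simp add: pd_up_eq pd_lower s power2_eq_square mult_ac)
  ultimately show "L\<^sub>V (H \<zeta> W) x = of_real (
       1024 * (cos (2 * \<zeta>))\<^sup>2 *
         ((\<Sum>\<alpha>\<in>UNIV. \<Sum>\<beta>\<in>UNIV. \<Sum>\<rho>\<in>UNIV. \<Sum>\<sigma>\<in>UNIV. W \<alpha> \<beta> x * lower W \<beta> \<rho> x * W \<rho> \<sigma> x * lower W \<sigma> \<alpha> x)
          - (\<Sum>\<alpha>\<in>UNIV. \<Sum>\<beta>\<in>UNIV. W \<alpha> \<beta> x * lower W \<alpha> \<beta> x)\<^sup>2)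
     + 64 * cos (2 * \<zeta>) *
         ((\<Sum>\<alpha>\<in>UNIV. \<Sum>\<rho>\<in>UNIV. \<Sum>\<sigma>\<in>UNIV. pd \<alpha> (W \<rho> \<sigma>) x * pd_up \<alpha> (lower W \<rho> \<sigma>) x)
          + 2 * (\<Sum>\<alpha>\<in>UNIV. (\<Sum>\<beta>\<in>UNIV. pd \<beta> (W \<alpha> \<beta>) x) * (\<Sum>\<sigma>\<in>UNIV. pd_up \<sigma> (lower W \<alpha> \<sigma>) x))))"
    unfolding L_V_eq[OF W] by (simp only:)
next
  assume h: "\<tau> \<noteq> 0 \<and> cos (2 * \<zeta>) \<noteq> 0 \<and> smooth \<psi>"
  define \<kappa> where "\<kappa> = 128 * \<tau> * cos (2 * \<zeta>)"
  have \<kappa>: "\<kappa> \<noteq> 0" using h by (simp add: \<kappa>_def)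
  \<comment> \<open>Reality of the current turns the complex field equation into the real one of
    \<open>stationary_iff\<close>, up to division by the nonzero \<open>\<kappa>\<close>.\<close>
  have rhs: "\<i> / of_real \<kappa> * dag (\<psi> x) (\<eta>_hat *v ((\<Sum>\<nu>\<in>UNIV. \<gamma>_up \<nu> ** \<S> \<zeta> ** \<Theta> [\<nu>, \<alpha>, \<beta>]) *v \<psi> x))
      = of_real (current \<zeta> \<psi> \<alpha> \<beta> x / \<kappa>)" for x \<alpha> \<beta>
    using of_real_current[of \<zeta> \<psi> \<alpha> \<beta> x] by (simp add: pairing_def)
  show "stationary (\<lambda>W' x. L\<^sub>K m \<psi> (H \<zeta> W') x - of_real \<tau> * L\<^sub>V (H \<zeta> W') x) W \<longleftrightarrow> (\<forall>x \<alpha> \<beta>. of_real (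
             (\<Sum>\<mu>\<in>UNIV. pd \<mu> (pd_up \<mu> (lower W \<alpha> \<beta>)) x)
           - (\<Sum>\<sigma>\<in>UNIV. pd \<alpha> (pd_up \<sigma> (lower W \<beta> \<sigma>)) x)
           + (\<Sum>\<sigma>\<in>UNIV. pd \<beta> (pd_up \<sigma> (lower W \<alpha> \<sigma>)) x)
           + 32 * cos (2 * \<zeta>) *
               ((\<Sum>\<rho>\<in>UNIV. \<Sum>\<sigma>\<in>UNIV. lower W \<alpha> \<rho> x * W \<rho> \<sigma> x * lower W \<sigma> \<beta> x)
                + (\<Sum>\<rho>\<in>UNIV. \<Sum>\<sigma>\<in>UNIV. W \<rho> \<sigma> x * lower W \<rho> \<sigma> x) * lower W \<alpha> \<beta> x))
           = \<i> / of_real (128 * \<tau> * cos (2 * \<zeta>)) *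
               dag (\<psi> x) (\<eta>_hat *v ((\<Sum>\<nu>\<in>UNIV. \<gamma>_up \<nu> ** \<S> \<zeta> ** \<Theta> [\<nu>, \<alpha>, \<beta>]) *v \<psi> x)))"
    unfolding \<kappa>_def[symmetric] rhs field_operator_eq[OF smooth_antisymmetricD(1)[OF W]] of_real_eq_iff
      stationary_iff[OF W conjunct2[OF conjunct2[OF h]]]
    using \<kappa> by (simp add: field_simps)
qed

end
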